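(* Let $n\ge2$, $\lambda,p\in(1,\infty)$, $\kappa>h\ge0$, and let $\mathcal{F}_{\kappa,h,\lambda}=\{(\mathbb{B}^n,F_\varepsilon,\mathsf{m}_\varepsilon)\}_{\varepsilon>0}$ be the family described in the context. Then for every $\varepsilon>0$ and every $u\in C_0^\infty(\mathbb{B}^n)$, \[\lambda^p\int_{\mathbb{B}^n}F^*_\varepsilon(Du)^p\,\mathrm{d}\mathsf{m}_\varepsilon\ \ge\ c_{n,p,\kappa,h}\int_{\mathbb{B}^n}|u|^p\,\mathrm{d}\mathsf{m}_\varepsilon,\qquad c_{n,p,\kappa,h}=\Big(\frac{(n-1)(\kappa-h)}{p}\Big)^p.\] Moreover $c_{n,p,\kappa,h}$ is sharp in $\mathcal{F}_{\kappa,h,\lambda}$: it is the greatest constant for which this inequality holds for every $\varepsilon>0$ and every $u\in C_0^\infty(\mathbb{B}^n)$.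
   Context: $\mathbb{B}^n$ is the open Euclidean unit ball, $|\cdot|,\langle\cdot,\cdot\rangle$ Euclidean, tangent spaces identified with $\mathbb{R}^n$. Let $\theta=\frac{\lambda-1}{\lambda+1}$. Define $K_{\varepsilon,0}=(1-\theta)^2\big(1+\frac{3\theta(1-\theta)}{\varepsilon^2}\big)$, $\varepsilon_0=\sqrt{\frac{3(1-\theta)}{8\theta}}$; for $0<\varepsilon\le\varepsilon_0$, with $Q_\varepsilon=\sqrt{3(1-\theta)^3(3(1-\theta)-8\varepsilon^2\theta)}$, $K_\varepsilon=\frac{6(1-\theta)^2((1-\theta)(3(1-\theta)-2\varepsilon^2\theta)+Q_\varepsilon)^3}{(3(1-\theta)^2+Q_\varepsilon)^4}$, and for $\varepsilon>\varepsilon_0$, $K_\varepsilon=+\infty$ (so $\kappa/\sqrt{K_\varepsilon}=0$). $k_\varepsilon=\max\{\kappa,\kappa/\sqrt{K_{\varepsilon,0}},\kappa/\sqrt{K_\varepsilon}\}$. With $\bar r=\operatorname{arctanh}|x|$, $F_\varepsilon(x,y)=\frac{\sqrt{|y|^2-|x|^2|y|^2+\langle x,y\rangle^2}}{k_\varepsilon(1-\theta)(1-|x|^2)}-\frac{\theta\langle x,y\rangle}{k_\varepsilon(1-\theta)|x|(1-|x|^2)}\cdot\frac{\bar r(\bar r+2\varepsilon)}{(\bar r+\varepsilon)^2}$ (second term $0$ at $x=0$). $\rho_\varepsilon=d_{F_\varepsilon}(0,\cdot)$, where $d_F(x_0,x_1)$ is the infimum of $F$-lengths of Lipschitz curves from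 $x_0$ to $x_1$. $\mathsf{m}_\varepsilon$ has density $\exp(-(n-1)h\rho_\varepsilon)\sigma_{F_\varepsilon}$ w.r.t. Lebesgue measure, where $\sigma_F(x)=\mathrm{vol}(\mathbb{B}^n)/\mathrm{vol}\{y:F(x,y)<1\}$. $F^*_\varepsilon(x,\xi)=\sup_{y\ne0}\xi(y)/F_\varepsilon(x,y)$ is the dual metric; $Du$ is the differential of $u$. *)

theory Defs
  imports "HOL-Analysis.Analysis"
begin

definition theta :: "real \<Rightarrow> real" where
  "theta lam = (lam - 1) / (lam + 1)"

definition K0 :: "real \<Rightarrow> real \<Rightarrow> real" where
  "K0 lam eps = (1 - theta lam)^2 * (1 + 3 * theta lam * (1 - theta lam) / eps^2)"

definition eps0 :: "real \<Rightarrow> real" where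
  "eps0 lam = sqrt (3 * (1 - theta lam) / (8 * theta lam))"

definition Qeps :: "real \<Rightarrow> real \<Rightarrow> real" where
  "Qeps lam eps = sqrt (3 * (1 - theta lam)^3 * (3 * (1 - theta lam) - 8 * eps^2 * theta lam))"

text \<open>K_eps for 0 < eps <= eps0 (for eps > eps0 it is +infinity).\<close>
definition Keps :: "real \<Rightarrow> real \<Rightarrow> real" where
  "Keps lam eps = 6 * (1 - theta lam)^2 *
     ((1 - theta lam) * (3 * (1 - theta lam) - 2 * eps^2 * theta lam) + Qeps lam eps)^3
     / (3 * (1 - theta lam)^2 + Qeps lam eps)^4"

text \<open>kappa / sqrt K_eps, with the convention kappa / sqrt(+infinity) = 0 for eps > eps0.\<close>
definition kap_over_sqrtK :: "real \<Rightarrow> real \<Rightarrow> real \<Rightarrow> real" where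
  "kap_over_sqrtK lam kap eps = (if eps \<le> eps0 lam then kap / sqrt (Keps lam eps) else 0)"

definition keps :: "real \<Rightarrow> real \<Rightarrow> real \<Rightarrow> real" where
  "keps lam kap eps = max kap (max (kap / sqrt (K0 lam eps)) (kap_over_sqrtK lam kap eps))"

definition Feps :: "real \<Rightarrow> real \<Rightarrow> real \<Rightarrow> 'a::euclidean_space \<Rightarrow> 'a \<Rightarrow> real" where
  "Feps lam kap eps x y =
     (let th = theta lam; k = keps lam kap eps; r = artanh (norm x) in
       sqrt ((norm y)^2 - (norm x)^2 * (norm y)^2 + (x \<bullet> y)^2) / (k * (1 - th) * (1 - (norm x)^2))
       - (if x = 0 then 0 else
           th * (x \<bullet> y) / (k * (1 - th) * norm x * (1 - (norm x)^2)) * (r * (r + 2 * eps) / (r + eps)^2)))"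

definition flength :: "('a::euclidean_space \<Rightarrow> 'a \<Rightarrow> real) \<Rightarrow> (real \<Rightarrow> 'a) \<Rightarrow> real" where
  "flength F \<gamma> = integral {0..1} (\<lambda>t. F (\<gamma> t) (vector_derivative \<gamma> (at t within {0..1})))"

definition lip_curves :: "'a::euclidean_space \<Rightarrow> 'a \<Rightarrow> (real \<Rightarrow> 'a) set" where
  "lip_curves x0 x1 = {\<gamma>. (\<exists>C. C-lipschitz_on {0..1} \<gamma>) \<and> \<gamma> ` {0..1} \<subseteq> ball 0 1
                            \<and> \<gamma> 0 = x0 \<and> \<gamma> 1 = x1}"

definition fdist :: "('a::euclidean_space \<Rightarrow> 'a \<Rightarrow> real) \<Rightarrow> 'a \<Rightarrow> 'a \<Rightarrow> real" where
  "fdist F x0 x1 = Inf (flength F ` lip_curves x0 x1)"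

definition sigmaF :: "('a::euclidean_space \<Rightarrow> 'a \<Rightarrow> real) \<Rightarrow> 'a \<Rightarrow> real" where
  "sigmaF F x = measure lebesgue (ball (0::'a) 1) / measure lebesgue {y. F x y < 1}"

definition rho :: "real \<Rightarrow> real \<Rightarrow> real \<Rightarrow> 'a::euclidean_space \<Rightarrow> real" where
  "rho lam kap eps x = fdist (Feps lam kap eps) 0 x"

definition meps :: "real \<Rightarrow> real \<Rightarrow> real \<Rightarrow> real \<Rightarrow> 'a::euclidean_space measure" where
  "meps lam kap h eps = density (restrict_space lebesgue (ball 0 1))
     (\<lambda>x. ennreal (exp (- (real DIM('a) - 1) * h * rho lam kap eps x)
                  * sigmaF (Feps lam kap eps) x))"

definition dual_norm :: "('a::euclidean_space \<Rightarrow> 'a \<Rightarrow> real) \<Rightarrow> 'a \<Rightarrow> ('a \<Rightarrow> real) \<Rightarrow> real" where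
  "dual_norm F x \<xi> = (SUP y\<in>-{0}. \<xi> y / F x y)"

fun iter_dder :: "('a::real_normed_vector \<Rightarrow> real) \<Rightarrow> 'a list \<Rightarrow> 'a \<Rightarrow> real" where
  "iter_dder u [] = u"
| "iter_dder u (v # vs) = (\<lambda>x. frechet_derivative (iter_dder u vs) (at x) v)"

definition smooth :: "('a::real_normed_vector \<Rightarrow> real) \<Rightarrow> bool" where
  "smooth u \<longleftrightarrow> (\<forall>vs x. iter_dder u vs differentiable (at x))"

definition tsupport :: "('a::real_normed_vector \<Rightarrow> real) \<Rightarrow> 'a set" where
  "tsupport u = closure {x. u x \<noteq> 0}"

definition C0inf_ball :: "('a::euclidean_space \<Rightarrow> real) set" where
  "C0inf_ball = {u. smooth u \<and> compact (tsupport u) \<and> tsupport u \<subseteq> ball 0 1}"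

definition hardy_lhs :: "real \<Rightarrow> real \<Rightarrow> real \<Rightarrow> real \<Rightarrow> real \<Rightarrow> ('a::euclidean_space \<Rightarrow> real) \<Rightarrow> ennreal" where
  "hardy_lhs lam kap h p eps u = ennreal (lam powr p) *
     (\<integral>\<^sup>+ x. ennreal (dual_norm (Feps lam kap eps) x (frechet_derivative u (at x)) powr p)
       \<partial>(meps lam kap h eps))"

definition hardy_rhs_int :: "real \<Rightarrow> real \<Rightarrow> real \<Rightarrow> real \<Rightarrow> real \<Rightarrow> ('a::euclidean_space \<Rightarrow> real) \<Rightarrow> ennreal" where
  "hardy_rhs_int lam kap h p eps u = (\<integral>\<^sup>+ x. ennreal (\<bar>u x\<bar> powr p) \<partial>(meps lam kap h eps))"

end

theory Submission
  imports Defs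
begin

text \<open>
  In polar form the metric is \<open>(|v| - \<beta>(r) dr(v)) / (k a)\<close>, where \<open>|v|\<close> is the Klein norm, \<open>r = artanh |x|\<close>
  and \<open>a = 1 - \<theta>\<close>. As \<open>|v| \<ge> |dr(v)|\<close>, radial segments are minimizing, so the distance from the origin is an
  explicit function of \<open>r\<close> with derivative \<open>1 / (k y)\<close>, \<open>y = a / (1 - \<beta>)\<close>. The unit balls are ellipsoids, so the
  density of the measure is explicit too.

  Testing the dual metric on the radial vectors of both signs gives \<open>\<lambda> F\<^sup>*(\<xi>) \<ge> k y |\<xi>(\<partial>\<^sub>r)|\<close>, which reduces the
  inequality to a weighted one-dimensional Hardy inequality on rays. Its weight condition follows from
  \<open>\<phi> := k (y coth r - y' / 2) \<ge> \<kappa>\<close>. Here \<open>\<phi>\<close> solves the Riccati equation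
  \<open>k y \<phi>' = k\<^sup>2 f(y) - \<phi>\<^sup>2\<close> with \<open>f(y) = y\<^sup>2 (1 + C (1 - y)\<^sup>2)\<close>, and \<open>k\<close> is chosen precisely so that
  \<open>k\<^sup>2 f \<ge> \<kappa>\<^sup>2\<close> on \<open>[a, 1]\<close>: the numbers \<open>K\<^bsub>\<epsilon>,0\<^esub>\<close> and \<open>K\<^sub>\<epsilon>\<close> are the values of \<open>f\<close> at \<open>a\<close> and at its
  local minimum.

  For sharpness, fix \<open>\<epsilon>\<close> and write \<open>z = 1 - |x|\<^sup>2\<close>. The density is comparable to \<open>z\<close> to the power
  \<open>-1 - p \<alpha>\<close>, where \<open>\<alpha> = (n - 1) (1 - h / k) / (2 p)\<close>, so \<open>u = z\<^sup>\<alpha>\<close> is critical: for its smooth cut-offs both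
  integrals diverge, and their quotient tends to the boundary value \<open>((n - 1) (k - h) / p)\<^sup>p\<close>. Finally \<open>k\<close>
  tends to \<open>\<kappa>\<close> as \<open>\<epsilon>\<close> tends to 0.
\<close>

text \<open>The factor \<open>lam\<close> pays for the asymmetry of the metric. A backward radial
  step costs \<open>(1 + drift) / (1 - drift)\<close> times a forward one, and this ratio grows to
  \<open>(1 + th) / (1 - th) = lam\<close> at the boundary. The differential of a radially
  decreasing function is tested by backward steps, so \<open>lam\<close> times its dual norm comes
  down to \<open>k\<close> times the Klein value exactly at the boundary, where the critical
  functions concentrate; hence nothing is lost there.

  The function \<open>phi\<close> is not guessed: up to the factor \<open>n - 1\<close> and the
  shift by \<open>h\<close> it bounds from below the divergence of the outward radial unit field
  with respect to the measure, and a lower bound on such a divergence is what a Hardy inequality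
  needs.

  On the formal side, \<open>integral\<close> is 0 for a non-integrable integrand and
  \<open>vector_derivative\<close> is arbitrary where no derivative exists. That no Lipschitz curve
  is shorter than the radial segment therefore requires differentiability almost everywhere and
  integrability of the speed.\<close>

subsection \<open>Lipschitz curves\<close>

text \<open>Adding a linear function makes \<open>f\<close> a bi-Lipschitz homeomorphism, whose pull-back of Lebesgue measure
  has a Radon-Nikodym density.\<close>

lemma lipschitz_has_integral_density:
  fixes f :: "real \<Rightarrow> real"
  assumes L: "L-lipschitz_on UNIV f"
  obtains \<phi> where "\<phi> \<in> borel_measurable borel"
    "\<And>a b. a \<le> b \<Longrightarrow> (\<phi> has_integral (f b - f a)) {a..b}"
proof -
  have L0: "L \<ge> 0" using L lipschitz_on_nonneg by blast
  have fl: "\<bar>f x - f y\<bar> \<le> L * \<bar>x - y\<bar>" for x y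
    using lipschitz_onD[OF L, of x y] by (simp add: dist_real_def)
  define g where "g t = f t + (L + 1) * t" for t
  have gexp: "g t - g s \<ge> t - s" if "s \<le> t" for s t
    using fl[of s t] that by (simp add: g_def algebra_simps abs_if split: if_splits)
  have smono: "strict_mono g"
    unfolding strict_mono_def using gexp by (smt (verit))
  have contf: "continuous_on UNIV f" using L lipschitz_on_continuous_on by blast
  have contg: "continuous_on UNIV g" unfolding g_def by (intro continuous_intros contf)
  have surj: "surj g"
    unfolding surj_def
  proof
    fix y
    define s where "s = min 0 (y - g 0)"
    define t where "t = max 0 (y - g 0)"
    have "g s \<le> y" using gexp[of s 0] by (auto simp: s_def min_def split: if_splits)
    moreover have "g t \<ge> y" using gexp[of 0 t] by (auto simp: t_def max_def split: if_splits)
    moreover have "s \<le> t" by (auto simp: s_def t_def)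
    ultimately obtain x where "g x = y"
      using IVT'[of g s y t] continuous_on_subset[OF contg, of "{s..t}"] by auto
    then show "\<exists>x. y = g x" by auto
  qed
  have inj: "inj g" using smono strict_mono_imp_inj_on by blast
  define gi where "gi = inv g"
  have ggi[simp]: "g (gi x) = x" for x unfolding gi_def by (simp add: surj surj_f_inv_f)
  have gig[simp]: "gi (g x) = x" for x unfolding gi_def by (simp add: inj)
  have gimono: "mono gi"
  proof (rule monoI)
    fix x y :: real assume "x \<le> y"
    then show "gi x \<le> gi y" using strict_mono_less_eq[OF smono, of "gi x" "gi y"] by simp
  qed
  have gi_meas[measurable]: "gi \<in> borel_measurable borel"
    using gimono borel_measurable_mono by blast
  have vim: "gi -` A = g ` A" for A
  proof
    show "gi -` A \<subseteq> g ` A"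
    proof
      fix y assume "y \<in> gi -` A"
      then show "y \<in> g ` A" using imageI[of "gi y" A g] by simp
    qed
  qed auto
  define \<mu> where "\<mu> = distr lborel borel gi"
  have em: "emeasure \<mu> A = emeasure lborel (g ` A)" if "A \<in> sets borel" for A
    using that unfolding \<mu>_def by (simp add: emeasure_distr vim)
  have lipg: "\<bar>g x - g y\<bar> \<le> (2 * L + 1) * \<bar>x - y\<bar>" for x y
  proof -
    have "g x - g y = (f x - f y) + (L + 1) * (x - y)" by (simp add: g_def algebra_simps)
    also have "\<bar>\<dots>\<bar> \<le> \<bar>f x - f y\<bar> + \<bar>(L + 1) * (x - y)\<bar>" by (rule abs_triangle_ineq)
    also have "\<bar>(L + 1) * (x - y)\<bar> = (L + 1) * \<bar>x - y\<bar>" using L0 by (simp add: abs_mult)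
    finally have "\<bar>g x - g y\<bar> \<le> \<bar>f x - f y\<bar> + (L + 1) * \<bar>x - y\<bar>" .
    then show ?thesis using fl[of x y] by (simp add: algebra_simps)
  qed
  \<comment> \<open>The measure \<open>\<mu>\<close> gives a set the length of its image under
    \<open>g\<close>, and a Lipschitz map sends null sets to null sets.\<close>
  have ac: "absolutely_continuous lborel \<mu>"
    unfolding absolutely_continuous_def
  proof
    fix A assume A: "A \<in> null_sets (lborel :: real measure)"
    have "negligible A" using A null_sets_completionI negligible_iff_null_sets by blast
    then have "negligible (g ` A)"
      by (intro negligible_locally_Lipschitz_image)
        (auto intro!: exI[of _ UNIV] exI[of _ "2 * L + 1"] lipg)
    moreover have "g ` A \<in> sets borel"
      using measurable_sets_borel[OF gi_meas, of A] A by (auto simp: vim null_sets_def)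
    ultimately have "emeasure lborel (g ` A) = 0"
      by (simp add: negligible_iff_null_sets null_sets_def)
    with A show "A \<in> null_sets \<mu>" by (auto simp: null_sets_def em) (simp add: \<mu>_def)
  qed
  obtain \<phi>0 where m0[measurable]: "\<phi>0 \<in> borel_measurable lborel" and d0: "density lborel \<phi>0 = \<mu>"
    using sigma_finite_measure.Radon_Nikodym[OF lborel.sigma_finite_measure_axioms ac] by (auto simp: \<mu>_def)
  have img: "g ` {a..b} = {g a..g b}" if "a \<le> b" for a b
  proof
    show "g ` {a..b} \<subseteq> {g a..g b}" using smono by (auto simp: strict_mono_less_eq)
    show "{g a..g b} \<subseteq> g ` {a..b}"
    proof
      fix y assume "y \<in> {g a..g b}"
      then have "gi y \<in> {a..b}" using strict_mono_less_eq[OF smono, of _ "gi y"] strict_mono_less_eq[OF smono, of "gi y"] by simp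
      then show "y \<in> g ` {a..b}" using imageI[of "gi y" "{a..b}" g] by simp
    qed
  qed
  have int0: "(\<integral>\<^sup>+x. \<phi>0 x * indicator {a..b} x \<partial>lborel) = ennreal (g b - g a)" if "a \<le> b" for a b
  proof -
    have "(\<integral>\<^sup>+x. \<phi>0 x * indicator {a..b} x \<partial>lborel) = emeasure (density lborel \<phi>0) {a..b}"
      by (simp add: emeasure_density)
    also have "\<dots> = emeasure lborel {g a..g b}"
      using that by (simp add: d0 em img)
    also have "\<dots> = ennreal (g b - g a)" using that smono by (simp add: strict_mono_less_eq)
    finally show ?thesis .
  qed
  define \<psi> where "\<psi> x = enn2real (\<phi>0 x)" for x
  have \<psi>m[measurable]: "\<psi> \<in> borel_measurable borel" unfolding \<psi>_def using m0 by simp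
  have \<psi>i: "(\<psi> has_integral (g b - g a)) {a..b}" if ab: "a \<le> b" for a b
  proof -
    \<comment> \<open>The Radon-Nikodym density may take the value infinity, where
      \<open>enn2real\<close> returns 0; finite integrals over intervals confine this to a null
      set.\<close>
    have "AE x in lborel. \<phi>0 x * indicator {a..b} x \<noteq> \<infinity>"
      by (rule nn_integral_PInf_AE) (auto simp: int0[OF ab])
    then have "(\<integral>\<^sup>+x. ennreal (\<psi> x * indicator {a..b} x) \<partial>lborel) = (\<integral>\<^sup>+x. \<phi>0 x * indicator {a..b} x \<partial>lborel)"
      by (intro nn_integral_cong_AE) (auto elim!: eventually_mono simp: \<psi>_def indicator_def less_top)
    then have "((\<lambda>x. \<psi> x * indicator {a..b} x) has_integral (g b - g a)) UNIV"
      using ab gexp[OF ab] by (intro nn_integral_has_integral) (auto simp: int0 \<psi>_def)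
    moreover have "(\<lambda>x. \<psi> x * indicator {a..b} x) = (\<lambda>x. if x \<in> {a..b} then \<psi> x else 0)" by auto
    ultimately show ?thesis by (simp only: has_integral_restrict_UNIV)
  qed
  show thesis
  proof (rule that[of "\<lambda>x. \<psi> x - (L + 1)"])
    show "((\<lambda>x. \<psi> x - (L + 1)) has_integral f b - f a) {a..b}" if "a \<le> b" for a b
      using has_integral_diff[OF \<psi>i[OF that] has_integral_const_real[of "L+1" a b]] that
      by (simp add: g_def algebra_simps)
  qed simp
qed

text \<open>Lebesgue's differentiation theorem. \<open>integrable_ccontinuous_explicit\<close>
  controls averages over intervals to the right of a point only, so the left-hand difference
  quotients are obtained by applying it to the reflected function.\<close>

lemma integral_has_derivative_off_negligible:
  fixes \<phi> f :: "real \<Rightarrow> real"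
  assumes I: "\<And>a b. a \<le> b \<Longrightarrow> (\<phi> has_integral (f b - f a)) {a..b}"
  obtains N where "negligible N" "\<And>t. t \<notin> N \<Longrightarrow> (f has_real_derivative \<phi> t) (at t)"
proof -
  have "\<phi> integrable_on cbox a b" for a b
    by (cases "a \<le> b") (use I in \<open>auto simp: integrable_on_def\<close>)
  then obtain N1 where N1: "negligible N1" "\<And>x e. \<lbrakk>x \<notin> N1; 0 < e\<rbrakk> \<Longrightarrow>
      \<exists>d>0. \<forall>h. 0 < h \<and> h < d \<longrightarrow> norm(integral (cbox x (x + h *\<^sub>R One)) \<phi> /\<^sub>R h ^ DIM(real) - \<phi> x) < e"
    by (rule integrable_ccontinuous_explicit) blast
  have I': "((\<lambda>x. \<phi> (- x)) has_integral (f (-a) - f (-b))) {a..b}" if "a \<le> b" for a b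
    using has_integral_reflect_lemma_real[OF I[of "-b" "-a"]] that by simp
  then have "(\<lambda>x. \<phi> (-x)) integrable_on cbox a b" for a b
    by (cases "a \<le> b") (use I' in \<open>auto simp: integrable_on_def\<close>)
  then obtain N2 where N2: "negligible N2" "\<And>x e. \<lbrakk>x \<notin> N2; 0 < e\<rbrakk> \<Longrightarrow>
      \<exists>d>0. \<forall>h. 0 < h \<and> h < d \<longrightarrow> norm(integral (cbox x (x + h *\<^sub>R One)) (\<lambda>x. \<phi> (-x)) /\<^sub>R h ^ DIM(real) - \<phi> (-x)) < e"
    by (rule integrable_ccontinuous_explicit) blast
  show thesis
  proof (rule that[of "N1 \<union> uminus ` N2"])
    have "negligible (uminus ` N2)"
      using N2(1)
      by (intro negligible_locally_Lipschitz_image) (auto intro!: exI[of _ UNIV] exI[of _ "1::real"])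
    then show "negligible (N1 \<union> uminus ` N2)" using N1(1) by (simp add: negligible_Un)
    fix t assume t: "t \<notin> N1 \<union> uminus ` N2"
    then have t2: "-t \<notin> N2" by (metis UnI2 image_eqI minus_minus)
    show "(f has_real_derivative \<phi> t) (at t)"
      unfolding DERIV_def LIM_def
    proof (intro allI impI)
      fix e :: real assume e: "0 < e"
      obtain d1 where d1: "d1 > 0" "\<And>h. 0 < h \<Longrightarrow> h < d1 \<Longrightarrow> \<bar>integral {t..t+h} \<phi> / h - \<phi> t\<bar> < e"
        using N1(2)[of t e] t e by (auto simp: field_simps)
      obtain d2 where d2: "d2 > 0" "\<And>h. 0 < h \<Longrightarrow> h < d2 \<Longrightarrow> \<bar>integral {-t..-t+h} (\<lambda>x. \<phi> (-x)) / h - \<phi> t\<bar> < e"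
        using N2(2)[of "-t" e] t2 e by (auto simp: field_simps)
      show "\<exists>s>0. \<forall>h. h \<noteq> 0 \<and> dist h 0 < s \<longrightarrow> dist ((f (t + h) - f t) / h) (\<phi> t) < e"
      proof (intro exI[of _ "min d1 d2"] conjI allI impI)
        fix h :: real assume h: "h \<noteq> 0 \<and> dist h 0 < min d1 d2"
        show "dist ((f (t + h) - f t) / h) (\<phi> t) < e"
        proof (cases "h > 0")
          case True
          then show ?thesis
            using d1(2)[of h] h integral_unique[OF I[of t "t+h"]] by (simp add: dist_real_def)
        next
          case False
          define k where "k = - h"
          have k: "k > 0" "h = - k" using False h by (auto simp: k_def)
          have "integral {-t..-t+k} (\<lambda>x. \<phi> (-x)) = f t - f (t - k)"
            using integral_unique[OF I'[of "-t" "-t+k"]] k by simp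
          then show ?thesis
            using d2(2)[of k] h k by (simp add: dist_real_def minus_divide_left)
        qed
      qed (use d1 d2 in auto)
    qed
  qed
qed

lemma lipschitz_on_clamp:
  fixes f :: "real \<Rightarrow> 'a::metric_space"
  assumes "L-lipschitz_on {0..1} f"
  shows "L-lipschitz_on UNIV (\<lambda>t. f (max 0 (min 1 t)))"
proof (rule lipschitz_onI)
  fix x y :: real
  have "dist (f (max 0 (min 1 x))) (f (max 0 (min 1 y))) \<le> L * dist (max 0 (min 1 x)) (max 0 (min 1 y))"
    by (rule lipschitz_onD[OF assms]) auto
  also have "\<dots> \<le> L * dist x y"
    by (rule mult_left_mono) (auto simp: dist_real_def lipschitz_on_nonneg[OF assms])
  finally show "dist (f (max 0 (min 1 x))) (f (max 0 (min 1 y))) \<le> L * dist x y" .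
qed (rule lipschitz_on_nonneg[OF assms])

text \<open>Clamping the argument to the unit interval extends the function to the line with the
  same constant. The bound on the derivative is recorded because it later makes the speed of a curve
  integrable.\<close>

lemma lipschitz_on_AE_real_derivative:
  fixes f :: "real \<Rightarrow> real"
  assumes L: "L-lipschitz_on {0..1} f"
  obtains \<phi> N where "\<phi> \<in> borel_measurable borel" "negligible N"
    "(\<phi> has_integral (f 1 - f 0)) {0..1}"
    "\<And>t. t \<in> {0<..<1} - N \<Longrightarrow> (f has_real_derivative \<phi> t) (at t)"
    "\<And>t. t \<in> {0<..<1} - N \<Longrightarrow> \<bar>\<phi> t\<bar> \<le> L"
proof -
  define g where "g t = f (max 0 (min 1 t))" for t
  obtain \<phi> where \<phi>: "\<phi> \<in> borel_measurable borel"
    "\<And>a b. a \<le> b \<Longrightarrow> (\<phi> has_integral (g b - g a)) {a..b}"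
    using lipschitz_has_integral_density[OF lipschitz_on_clamp[OF L]] unfolding g_def by blast
  obtain N where N: "negligible N" "\<And>t. t \<notin> N \<Longrightarrow> (g has_real_derivative \<phi> t) (at t)"
    using integral_has_derivative_off_negligible[OF \<phi>(2)] by blast
  show thesis
  proof (rule that[OF \<phi>(1) N(1)])
    show "(\<phi> has_integral (f 1 - f 0)) {0..1}" using \<phi>(2)[of 0 1] by (simp add: g_def)
    show "(f has_real_derivative \<phi> t) (at t)" if "t \<in> {0<..<1} - N" for t
      by (rule has_field_derivative_transform_within_open[OF N(2), of t "{0<..<1}"])
        (use that in \<open>auto simp: g_def\<close>)
    show "\<bar>\<phi> t\<bar> \<le> L" if "t \<in> {0<..<1} - N" for t
    proof -
      have "((\<lambda>h. \<bar>(g (t + h) - g t) / h\<bar>) \<longlongrightarrow> \<bar>\<phi> t\<bar>) (at 0)"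
        using N(2)[of t] that by (intro tendsto_rabs) (auto simp: DERIV_def)
      moreover have "\<forall>\<^sub>F h in at 0. \<bar>(g (t + h) - g t) / h\<bar> \<le> L"
        unfolding eventually_at_filter
      proof (intro always_eventually allI impI)
        fix h :: real assume "h \<noteq> 0"
        moreover have "\<bar>g (t + h) - g t\<bar> \<le> L * \<bar>h\<bar>"
          using lipschitz_onD[OF lipschitz_on_clamp[OF L], of "t + h" t] by (simp add: g_def dist_real_def)
        ultimately show "\<bar>(g (t + h) - g t) / h\<bar> \<le> L" by (simp add: abs_divide divide_le_eq)
      qed
      ultimately show ?thesis by (rule tendsto_upperbound) simp
    qed
  qed
qed

text \<open>Differentiability is checked coordinatewise. Summing the coordinates costs the factor
  \<open>DIM('a)\<close>, which is harmless because only boundedness is used.\<close>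

lemma lipschitz_on_AE_vector_derivative:
  fixes f :: "real \<Rightarrow> 'a::euclidean_space"
  assumes L: "L-lipschitz_on {0..1} f"
  obtains \<phi> N where "\<phi> \<in> borel_measurable borel" "negligible N"
    "\<And>t. t \<in> {0<..<1} - N \<Longrightarrow> (f has_vector_derivative \<phi> t) (at t)"
    "\<And>t. t \<in> {0<..<1} - N \<Longrightarrow> norm (\<phi> t) \<le> real DIM('a) * L"
proof -
  have "\<exists>\<phi> N. \<phi> \<in> borel_measurable borel \<and> negligible N \<and>
      (\<forall>t \<in> {0<..<1} - N. ((\<lambda>t. f t \<bullet> b) has_real_derivative \<phi> t) (at t) \<and> \<bar>\<phi> t\<bar> \<le> L)" if "b \<in> Basis" for b
  proof -
    have "L-lipschitz_on {0..1} (\<lambda>t. f t \<bullet> b)"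
    proof (rule lipschitz_onI)
      fix x y :: real assume xy: "x \<in> {0..1}" "y \<in> {0..1}"
      have "\<bar>(f x - f y) \<bullet> b\<bar> \<le> norm (f x - f y)" using that by (rule Basis_le_norm)
      then show "dist (f x \<bullet> b) (f y \<bullet> b) \<le> L * dist x y"
        using lipschitz_onD[OF L xy] by (simp add: dist_norm inner_diff_left)
    qed (rule lipschitz_on_nonneg[OF L])
    from lipschitz_on_AE_real_derivative[OF this] show ?thesis by metis
  qed
  then obtain \<phi> N where \<phi>: "\<And>b. b \<in> Basis \<Longrightarrow> \<phi> b \<in> borel_measurable borel"
    and N: "\<And>b. b \<in> Basis \<Longrightarrow> negligible (N b)"
    and D: "\<And>b t. b \<in> Basis \<Longrightarrow> t \<in> {0<..<1} - N b \<Longrightarrow> ((\<lambda>t. f t \<bullet> b) has_real_derivative \<phi> b t) (at t)"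
    and D': "\<And>b t. b \<in> Basis \<Longrightarrow> t \<in> {0<..<1} - N b \<Longrightarrow> \<bar>\<phi> b t\<bar> \<le> L"
    by metis
  show thesis
  proof (rule that[of "\<lambda>t. \<Sum>b\<in>Basis. \<phi> b t *\<^sub>R b" "\<Union>b\<in>Basis. N b"])
    show "(\<lambda>t. \<Sum>b\<in>Basis. \<phi> b t *\<^sub>R b) \<in> borel_measurable borel"
      by (intro borel_measurable_sum borel_measurable_scaleR \<phi>) auto
    show "negligible (\<Union>b\<in>Basis. N b)" using N by (intro negligible_Union) auto
    fix t assume t: "t \<in> {0<..<1} - (\<Union>b\<in>Basis. N b)"
    have "((\<lambda>t. \<Sum>b\<in>Basis. (f t \<bullet> b) *\<^sub>R b) has_vector_derivative (\<Sum>b\<in>Basis. \<phi> b t *\<^sub>R b)) (at t)"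
    proof (rule has_vector_derivative_sum)
      fix b :: 'a assume b: "b \<in> Basis"
      then have "((\<lambda>t. f t \<bullet> b) has_vector_derivative \<phi> b t) (at t)"
        using D[OF b, of t] t by (auto simp: has_real_derivative_iff_has_vector_derivative)
      then show "((\<lambda>t. (f t \<bullet> b) *\<^sub>R b) has_vector_derivative \<phi> b t *\<^sub>R b) (at t)"
        by (rule bounded_linear.has_vector_derivative[OF bounded_linear_scaleR_left])
    qed
    then show "(f has_vector_derivative (\<Sum>b\<in>Basis. \<phi> b t *\<^sub>R b)) (at t)"
      by (simp add: euclidean_representation)
    have "norm (\<Sum>b\<in>Basis. \<phi> b t *\<^sub>R b) \<le> (\<Sum>b\<in>(Basis :: 'a set). (L::real))"
      using D' t by (intro sum_norm_le) auto
    then show "norm (\<Sum>b\<in>Basis. \<phi> b t *\<^sub>R b) \<le> real DIM('a) * L" by simp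
  qed
qed

text \<open>A calibration principle: if \<open>R\<close> never grows faster than the speed measured
  by \<open>F\<close>, its total increase is at most the length. The comparison \<open>le\<close> is
  asked for only at times where both derivatives exist. Most of the work is the integrability of the
  speed, without which \<open>integral\<close> would be 0.\<close>

lemma lipschitz_increment_le_integral:
  fixes \<gamma> :: "real \<Rightarrow> 'a::euclidean_space" and F :: "'a \<Rightarrow> 'a \<Rightarrow> real"
  assumes \<gamma>: "L-lipschitz_on {0..1} \<gamma>" and R: "M-lipschitz_on {0..1} R"
    and meas: "(\<lambda>(x, v). F x v) \<in> borel_measurable borel"
    and bnd: "\<And>t v. t \<in> {0..1} \<Longrightarrow> 0 \<le> F (\<gamma> t) v" "\<And>t v. t \<in> {0..1} \<Longrightarrow> F (\<gamma> t) v \<le> B * norm v" "0 \<le> B"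
    and le: "\<And>t v d. t \<in> {0<..<1} \<Longrightarrow> (\<gamma> has_vector_derivative v) (at t) \<Longrightarrow>
      (R has_real_derivative d) (at t) \<Longrightarrow> d \<le> F (\<gamma> t) v"
  shows "R 1 - R 0 \<le> integral {0..1} (\<lambda>t. F (\<gamma> t) (vector_derivative \<gamma> (at t within {0..1})))"
proof -
  obtain \<phi> N where \<phi>[measurable]: "\<phi> \<in> borel_measurable borel" and N: "negligible N"
    and D: "\<And>t. t \<in> {0<..<1} - N \<Longrightarrow> (\<gamma> has_vector_derivative \<phi> t) (at t)"
    and \<phi>b: "\<And>t. t \<in> {0<..<1} - N \<Longrightarrow> norm (\<phi> t) \<le> real DIM('a) * L"
    by (rule lipschitz_on_AE_vector_derivative[OF \<gamma>], rule that) auto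
  obtain \<psi> N' where N': "negligible N'" and I: "(\<psi> has_integral (R 1 - R 0)) {0..1}"
    and D': "\<And>t. t \<in> {0<..<1} - N' \<Longrightarrow> (R has_real_derivative \<psi> t) (at t)"
    by (rule lipschitz_on_AE_real_derivative[OF R], rule that) auto
  \<comment> \<open>The endpoints join the exceptional set because two-sided derivatives are
    available in the open interval only.\<close>
  define Z where "Z = N \<union> N' \<union> {0, 1}"
  have Z: "negligible Z" unfolding Z_def using N N' by (intro negligible_Un) auto
  have Zin: "t \<in> {0<..<1} - N" "t \<in> {0<..<1} - N'" if "t \<in> {0..1} - Z" for t
    using that by (auto simp: Z_def)
  define \<gamma>' where "\<gamma>' t = \<gamma> (max 0 (min 1 t))" for t
  have "continuous_on UNIV \<gamma>'"
    unfolding \<gamma>'_def using lipschitz_on_clamp[OF \<gamma>] lipschitz_on_continuous_on by blast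
  then have [measurable]: "\<gamma>' \<in> borel_measurable borel"
    by (rule borel_measurable_continuous_onI)
  \<comment> \<open>The truncation changes nothing off \<open>Z\<close> and makes the speed a
    bounded Borel function on the whole line.\<close>
  define G where "G t = max 0 (min (B * (real DIM('a) * L)) (F (\<gamma>' t) (\<phi> t)))" for t
  have "(\<lambda>t. (\<gamma>' t, \<phi> t)) \<in> borel \<rightarrow>\<^sub>M borel \<Otimes>\<^sub>M borel" by measurable
  then have "(\<lambda>t. (\<gamma>' t, \<phi> t)) \<in> borel \<rightarrow>\<^sub>M borel" by (simp only: borel_prod)
  from measurable_compose[OF this meas] have [measurable]: "(\<lambda>t. F (\<gamma>' t) (\<phi> t)) \<in> borel_measurable borel" by simp
  have Gm: "G \<in> borel_measurable borel" unfolding G_def by measurable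
  have G\<gamma>: "G t = F (\<gamma> t) (\<phi> t)" if "t \<in> {0..1} - Z" for t
  proof -
    have "F (\<gamma> t) (\<phi> t) \<le> B * norm (\<phi> t)" using bnd(2) that by auto
    also have "\<dots> \<le> B * (real DIM('a) * L)" using \<phi>b[OF Zin(1)[OF that]] bnd(3) by (intro mult_left_mono) auto
    finally show ?thesis using bnd(1) that by (auto simp: G_def \<gamma>'_def)
  qed
  have Gint: "G absolutely_integrable_on {0..1}"
  proof (rule measurable_bounded_by_integrable_imp_absolutely_integrable)
    show "G \<in> borel_measurable (lebesgue_on {0..1})"
      using Gm by (intro measurable_restrict_space1 measurable_completion) simp
    show "(\<lambda>_. \<bar>B * (real DIM('a) * L)\<bar>) integrable_on {0..1::real}" by (intro integrable_const_ivl)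
  qed (auto simp: G_def)
  \<comment> \<open>On \<open>Z\<close> the density is replaced by 0, so that the comparison with
    the nonnegative \<open>G\<close> holds at every point.\<close>
  have I': "((\<lambda>t. if t \<in> Z then 0 else \<psi> t) has_integral (R 1 - R 0)) {0..1}"
    by (rule has_integral_spike[OF Z _ I]) auto
  then have "R 1 - R 0 = integral {0..1} (\<lambda>t. if t \<in> Z then 0 else \<psi> t)"
    by (simp add: integral_unique)
  also have "\<dots> \<le> integral {0..1} G"
  proof (rule integral_le)
    show "(\<lambda>t. if t \<in> Z then 0 else \<psi> t) integrable_on {0..1}"
      using I' by blast
    show "G integrable_on {0..1}" using Gint set_lebesgue_integral_eq_integral(1) by blast
    fix t :: real assume t: "t \<in> {0..1}"
    show "(if t \<in> Z then 0 else \<psi> t) \<le> G t"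
    proof (cases "t \<in> Z")
      case True then show ?thesis by (simp add: G_def)
    next
      case False
      then have "t \<in> {0..1} - Z" using t by simp
      note tz = Zin[OF this] G\<gamma>[OF this]
      show ?thesis using le[OF _ D[OF tz(1)] D'[OF tz(2)]] tz False by auto
    qed
  qed
  also have "integral {0..1} G = integral {0..1} (\<lambda>t. F (\<gamma> t) (vector_derivative \<gamma> (at t within {0..1})))"
  proof (rule integral_spike[OF Z])
    fix t :: real assume t: "t \<in> {0..1} - Z"
    show "F (\<gamma> t) (vector_derivative \<gamma> (at t within {0..1})) = G t"
      using vector_derivative_at_within_ivl[OF D[OF Zin(1)[OF t]], of 0 1] t G\<gamma>[OF t] by auto
  qed
  finally show ?thesis .
qed

subsection \<open>Volume of Randers balls\<close>

text \<open>A linear isometry sends a ball to a ball of the same radius. By Vitali's theorem an open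
  set is a countable disjoint union of balls up to a null set, and null sets are preserved since the
  map is Lipschitz.\<close>

lemma emeasure_isometry_image_open:
  fixes Q :: "'a::euclidean_space \<Rightarrow> 'a"
  assumes Q: "linear Q" and n: "\<And>x. norm (Q x) = norm x" and U: "open U"
  shows "emeasure lebesgue (Q ` U) = emeasure lebesgue U"
proof -
  have inj: "inj Q"
    using n linear_injective_0[OF Q] by (metis norm_eq_zero)
  then have surj: "surj Q" using Q linear_injective_imp_surjective by blast
  have ballQ: "Q ` ball x r = ball (Q x) r" for x r
  proof -
    have d: "dist (Q x) (Q y) = dist x y" for y
      by (metis dist_norm linear_diff[OF Q] n)
    show ?thesis
    proof
      show "ball (Q x) r \<subseteq> Q ` ball x r"
      proof
        fix z assume "z \<in> ball (Q x) r"
        moreover obtain y where "z = Q y" using surj by blast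
        ultimately show "z \<in> Q ` ball x r" using d by auto
      qed
    qed (auto simp: d)
  qed
  define K where "K = {(x, r). 0 < r \<and> ball x r \<subseteq> U}"
  obtain C where C: "countable C" "C \<subseteq> K"
     "pairwise (\<lambda>i j. disjnt (ball (fst i) (snd i)) (ball (fst j) (snd j))) C"
     "negligible (U - (\<Union>i \<in> C. ball (fst i) (snd i)))"
  proof (rule Vitali_covering_theorem_balls[of U K fst snd])
    fix x and d :: real assume x: "x \<in> U" "0 < d"
    obtain e where "e > 0" "ball x e \<subseteq> U" using U x openE by blast
    then show "\<exists>i. i \<in> K \<and> x \<in> ball (fst i) (snd i) \<and> snd i < d"
      using x by (intro exI[of _ "(x, min e (d/2))"]) (auto simp: K_def)
  qed blast
  define B where "B = (\<Union>i \<in> C. ball (fst i) (snd i))"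
  have BU: "B \<subseteq> U"
    unfolding B_def using C(2) by (intro UN_least) (auto simp: K_def subset_iff)
  have disj: "disjoint_family_on (\<lambda>i. ball (fst i) (snd i)) C"
    using C(3) by (auto simp: disjoint_family_on_def pairwise_def disjnt_def)
  have disjQ: "disjoint_family_on (\<lambda>i. ball (Q (fst i)) (snd i)) C"
    unfolding disjoint_family_on_def
  proof (intro ballI impI)
    fix i j assume ij: "i \<in> C" "j \<in> C" "i \<noteq> j"
    then have "ball (fst i) (snd i) \<inter> ball (fst j) (snd j) = {}"
      using disj by (auto simp: disjoint_family_on_def)
    then show "ball (Q (fst i)) (snd i) \<inter> ball (Q (fst j)) (snd j) = {}"
      using inj by (metis ballQ image_Int image_empty)
  qed
  have null: "negligible (Q ` (U - B))"
    using C(4) linear_diff[OF Q]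
    by (intro negligible_locally_Lipschitz_image)
      (auto simp: B_def n intro!: exI[of _ UNIV] exI[of _ "1::real"] simp flip: linear_diff[OF Q])
  have 1: "emeasure lebesgue U = emeasure lebesgue B"
  proof -
    have "U = B \<union> (U - B)" using BU by auto
    moreover have "B \<in> sets lebesgue" unfolding B_def by (intro sets.countable_UN' C(1)) auto
    moreover have "U - B \<in> null_sets lebesgue" using C(4) by (simp add: B_def negligible_iff_null_sets)
    ultimately show ?thesis using emeasure_Un_null_set by metis
  qed
  have QB: "Q ` B = (\<Union>i \<in> C. ball (Q (fst i)) (snd i))" by (simp add: B_def image_UN ballQ)
  have 2: "emeasure lebesgue (Q ` U) = emeasure lebesgue (Q ` B)"
  proof -
    have "Q ` U = Q ` B \<union> Q ` (U - B)" using BU by auto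
    moreover have "Q ` B \<in> sets lebesgue" unfolding QB by (intro sets.countable_UN' C(1)) auto
    moreover have "Q ` (U - B) \<in> null_sets lebesgue" using null by (simp add: negligible_iff_null_sets)
    ultimately show ?thesis using emeasure_Un_null_set by metis
  qed
  have eb: "emeasure lebesgue (ball (Q c) r) = emeasure lebesgue (ball c r)" for c r
  proof (cases "r \<ge> 0")
    case True
    have "emeasure lebesgue (ball c r) = ennreal (r ^ DIM('a) * measure lborel (ball (0::'a) 1))" for c :: 'a
    proof -
      have "emeasure lebesgue (ball c r) = ennreal (measure lborel (ball c r))"
        using emeasure_lborel_ball_finite[of c r] by (subst emeasure_eq_ennreal_measure) auto
      then show ?thesis using content_ball_conv_unit_ball[OF True] by metis
    qed
    then show ?thesis by metis
  qed (simp add: ball_empty)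
  show ?thesis
    unfolding 1 2 unfolding QB unfolding B_def
    by (subst (1 2) emeasure_UN_countable) (use C(1) disj disjQ in \<open>auto simp: eb\<close>)
qed

text \<open>Unless \<open>a = b\<close>, this is the reflection in the hyperplane orthogonal to
  \<open>a - b\<close>. It is its own inverse, which makes it easy to transport sets in
  \<open>measure_randers_ball\<close>.\<close>

lemma isometry_between_unit_vectors:
  fixes a b :: "'a::euclidean_space"
  assumes "norm a = 1" "norm b = 1"
  obtains Q where "linear Q" "\<And>x. norm (Q x) = norm x" "\<And>x. Q (Q x) = x" "\<And>x. a \<bullet> Q x = b \<bullet> x"
proof (cases "a = b")
  case True
  then show thesis using that[of "\<lambda>x. x"] by (auto intro!: linearI)
next
  case False
  define v where "v = a - b"
  have vv: "v \<bullet> v > 0" using False by (simp add: v_def)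
  have ab: "a \<bullet> a = 1" "b \<bullet> b = 1" using assms by (simp_all add: dot_square_norm)
  then have vab: "v \<bullet> v = 2 * (a \<bullet> v)" by (simp add: v_def inner_diff inner_commute)
  define Q where "Q x = x - (2 * (v \<bullet> x) / (v \<bullet> v)) *\<^sub>R v" for x
  have vQ: "v \<bullet> Q x = - (v \<bullet> x)" for x using vv by (simp add: Q_def inner_diff)
  show thesis
  proof (rule that[of Q])
    show "linear Q" by (intro linearI) (simp_all add: Q_def inner_add algebra_simps add_divide_distrib)
    show "Q (Q x) = x" for x
      by (subst Q_def[of "Q x"], subst vQ) (simp add: Q_def)
    show "norm (Q x) = norm x" for x
    proof -
      have "Q x \<bullet> Q x = x \<bullet> x - 2 * (2 * (v \<bullet> x) / (v \<bullet> v)) * (v \<bullet> x) + (2 * (v \<bullet> x) / (v \<bullet> v))^2 * (v \<bullet> v)"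
        by (simp add: Q_def inner_diff inner_commute power2_eq_square algebra_simps)
      also have "\<dots> = x \<bullet> x" using vv by (simp add: power2_eq_square field_simps)
      finally show ?thesis by (simp add: norm_eq_sqrt_inner)
    qed
    show "a \<bullet> Q x = b \<bullet> x" for x
    proof -
      have "a \<bullet> Q x = a \<bullet> x - (2 * (a \<bullet> v)) * (v \<bullet> x) / (v \<bullet> v)" by (simp add: Q_def inner_diff)
      also have "\<dots> = a \<bullet> x - v \<bullet> x" using vv by (simp flip: vab)
      finally show ?thesis by (simp add: v_def inner_diff)
    qed
  qed
qed

text \<open>Put \<open>D = 1 - \<beta>^2\<close> and \<open>S = 1 - s^2\<close>. Squaring and
  completing the square shows that the set is an ellipsoid with centre
  \<open>R * \<beta> / D\<close> times \<open>e\<close>, semi-axis \<open>R / D\<close> along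
  \<open>e\<close> and semi-axes \<open>R / sqrt (D * S)\<close> across it. Its volume is the
  product of the semi-axes times that of the unit ball.\<close>

lemma measure_randers_ball:
  fixes e :: "'a::euclidean_space"
  assumes e: "norm e = 1" and s: "0 \<le> s" "s < 1" and \<beta>: "\<bar>\<beta>\<bar> < 1" and R: "R > 0"
  shows "measure lebesgue {y. sqrt ((norm y)^2 * (1 - s^2) + s^2 * (e \<bullet> y)^2) - \<beta> * (e \<bullet> y) < R}
    = R ^ DIM('a) * (1 - \<beta>^2) powr (- (real DIM('a) + 1) / 2) * (1 - s^2) powr (- (real DIM('a) - 1) / 2)
      * measure lebesgue (ball (0::'a) 1)"
proof -
  define E where "E = (\<lambda>e. {y::'a. sqrt ((norm y)^2 * (1 - s^2) + s^2 * (e \<bullet> y)^2) - \<beta> * (e \<bullet> y) < R})"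
  have openE: "open (E u)" for u
    unfolding E_def by (intro open_Collect_less continuous_intros)
  \<comment> \<open>Turning \<open>e\<close> into a basis vector makes the ellipsoid axis-parallel,
    so that a diagonal affine map \<open>T\<close> carries the unit ball onto it.\<close>
  obtain b :: 'a where b: "b \<in> Basis" using nonempty_Basis by blast
  obtain Q where Q: "linear Q" "\<And>x. norm (Q x) = norm x" "\<And>x. Q (Q x) = x" "\<And>x. e \<bullet> Q x = b \<bullet> x"
    using isometry_between_unit_vectors[OF e, of b] b by auto
  have "Q ` E b = E e"
  proof -
    have "z \<in> E b \<longleftrightarrow> Q z \<in> E e" for z by (simp add: E_def Q)
    moreover have "z = Q (Q z)" for z by (simp add: Q)
    ultimately show ?thesis by (smt (verit, del_insts) Q(3) image_iff set_eqI)
  qed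
  then have 1: "emeasure lebesgue (E e) = emeasure lebesgue (E b)"
    using emeasure_isometry_image_open[OF Q(1,2) openE] by metis
  define D where "D = 1 - \<beta>^2"
  have D: "D > 0" using \<beta> by (simp add: D_def abs_square_less_1)
  define S where "S = 1 - s^2"
  have S: "S > 0" using s by (simp add: S_def abs_square_less_1)
  define c where "c j = (if j = b then R / D else R / sqrt (D * S))" for j
  define T where "T z = (R * \<beta> / D) *\<^sub>R b + (\<Sum>j\<in>Basis. (c j * (z \<bullet> j)) *\<^sub>R j)" for z
  have T_meas: "T \<in> borel_measurable borel"
    unfolding T_def by (intro borel_measurable_continuous_onI continuous_intros)
  have c0: "c j \<noteq> 0" for j using R D S by (simp add: c_def)
  have T_in: "T z \<in> E b \<longleftrightarrow> z \<in> ball 0 1" for z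
  proof -
    define \<zeta> where "\<zeta> = z \<bullet> b"
    define \<nu> where "\<nu> = (\<Sum>j\<in>Basis - {b}. (z \<bullet> j)^2)"
    define \<omega> where "\<omega> = R * (\<beta> + \<zeta>) / D"
    have \<nu>0: "\<nu> \<ge> 0" by (simp add: \<nu>_def sum_nonneg)
    have Tj: "T z \<bullet> j = (if j = b then R * \<beta> / D else 0) + c j * (z \<bullet> j)" if "j \<in> Basis" for j
      using that b by (simp add: T_def inner_add_left inner_Basis)
    have nz: "(norm z)^2 = \<zeta>^2 + \<nu>"
      unfolding power2_norm_eq_inner euclidean_inner[of z z] \<zeta>_def \<nu>_def
      by (subst sum.remove[OF _ b]) (auto simp: power2_eq_square)
    have Tb: "b \<bullet> T z = \<omega>"
      using Tj[OF b] by (simp add: inner_commute \<omega>_def c_def \<zeta>_def add_divide_distrib algebra_simps)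
    have "(norm (T z))^2 = (T z \<bullet> b)^2 + (\<Sum>j\<in>Basis - {b}. (T z \<bullet> j)^2)"
      unfolding power2_norm_eq_inner euclidean_inner[of "T z" "T z"]
      by (subst sum.remove[OF _ b]) (auto simp: power2_eq_square)
    also have "(\<Sum>j\<in>Basis - {b}. (T z \<bullet> j)^2) = (\<Sum>j\<in>Basis - {b}. (R^2 / (D * S)) * (z \<bullet> j)^2)"
      using D S by (intro sum.cong) (auto simp: Tj c_def power_mult_distrib power_divide)
    also have "\<dots> = R^2 / (D * S) * \<nu>" by (simp add: \<nu>_def sum_distrib_left)
    finally have nT: "(norm (T z))^2 = \<omega>^2 + R^2 / (D * S) * \<nu>" using Tb by (simp add: inner_commute)
    have X: "(norm (T z))^2 * (1 - s^2) + s^2 * (b \<bullet> T z)^2 = \<omega>^2 + R^2 * \<nu> / D"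
      unfolding nT Tb using S D by (simp add: S_def[symmetric] field_simps) (simp add: S_def algebra_simps)
    have Y: "R + \<beta> * \<omega> = R * (1 + \<beta> * \<zeta>) / D"
      using D by (simp add: \<omega>_def D_def field_simps power2_eq_square)
    have "T z \<in> E b \<longleftrightarrow> sqrt (\<omega>^2 + R^2 * \<nu> / D) < R + \<beta> * \<omega>"
      unfolding E_def mem_Collect_eq X unfolding Tb by linarith
    also have "\<dots> \<longleftrightarrow> 0 < R + \<beta> * \<omega> \<and> \<omega>^2 + R^2 * \<nu> / D < (R + \<beta> * \<omega>)^2"
    proof -
      have p: "\<omega>^2 + R^2 * \<nu> / D \<ge> 0" using \<nu>0 D by simp
      have "sqrt X < Y \<longleftrightarrow> 0 < Y \<and> X < Y^2" if "X \<ge> 0" for X Y :: real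
      proof (cases "Y > 0")
        case True
        then show ?thesis using real_sqrt_less_iff[of X "Y^2"] by simp
      next
        case False
        moreover have "sqrt X \<ge> 0" using that by simp
        ultimately show ?thesis by linarith
      qed
      from this[OF p] show ?thesis .
    qed
    also have "\<dots> \<longleftrightarrow> 0 < 1 + \<beta> * \<zeta> \<and> \<zeta>^2 + \<nu> < 1"
    proof -
      have "(R + \<beta> * \<omega>)^2 - (\<omega>^2 + R^2 * \<nu> / D) = R^2 / D^2 * ((1 + \<beta> * \<zeta>)^2 - (\<beta> + \<zeta>)^2 - D * \<nu>)"
        unfolding Y using D by (simp add: \<omega>_def field_simps power2_eq_square)
      also have "(1 + \<beta> * \<zeta>)^2 - (\<beta> + \<zeta>)^2 - D * \<nu> = D * (1 - \<zeta>^2 - \<nu>)"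
        by (simp add: D_def algebra_simps power2_eq_square)
      finally have "\<omega>^2 + R^2 * \<nu> / D < (R + \<beta> * \<omega>)^2 \<longleftrightarrow> 0 < R^2 / D^2 * (D * (1 - \<zeta>^2 - \<nu>))" by linarith
      also have "\<dots> \<longleftrightarrow> \<zeta>^2 + \<nu> < 1" using R D by (simp add: zero_less_mult_iff zero_less_divide_iff) linarith
      finally show ?thesis unfolding Y using R D by (auto simp: zero_less_mult_iff zero_less_divide_iff)
    qed
    \<comment> \<open>The sign condition left over from squaring is automatic inside the ball,
      because \<open>\<zeta>\<close> and \<open>\<beta>\<close> are less than 1 in absolute
      value.\<close>
    also have "\<dots> \<longleftrightarrow> \<zeta>^2 + \<nu> < 1"
    proof -
      have "0 < 1 + \<beta> * \<zeta>" if "\<zeta>^2 + \<nu> < 1"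
      proof -
        have "\<bar>\<zeta>\<bar> < 1" using that \<nu>0 by (simp add: abs_square_less_1[symmetric])
        then have "\<bar>\<beta> * \<zeta>\<bar> < 1 * 1" unfolding abs_mult using \<beta> by (intro mult_strict_mono') auto
        then show ?thesis by linarith
      qed
      then show ?thesis by blast
    qed
    also have "\<dots> \<longleftrightarrow> z \<in> ball 0 1" using abs_square_less_1[of "norm z"] by (simp flip: nz)
    finally show ?thesis .
  qed
  have "emeasure lborel (E b) = emeasure (density (distr lborel borel T) (\<lambda>_. (\<Prod>j\<in>Basis. \<bar>c j\<bar>))) (E b)"
    using lborel_affine_euclidean[of c "(R * \<beta> / D) *\<^sub>R b"] c0 unfolding T_def by simp
  also have "\<dots> = (\<Prod>j\<in>(Basis::'a set). \<bar>c j\<bar>) * emeasure (distr lborel borel T) (E b)"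
    using openE[of b] by (subst emeasure_density) (auto simp: nn_integral_cmult)
  also have "emeasure (distr lborel borel T) (E b) = emeasure lborel (T -` E b)"
    using openE[of b] by (subst emeasure_distr) (auto simp: T_meas)
  also have "T -` E b = ball 0 1" using T_in by auto
  finally have 2: "emeasure lborel (E b) = ennreal (\<Prod>j\<in>(Basis::'a set). \<bar>c j\<bar>) * emeasure lborel (ball (0::'a) 1)" .
  have "(\<Prod>j\<in>(Basis::'a set). \<bar>c j\<bar>) = R / D * (R / sqrt (D * S)) ^ (DIM('a) - 1)"
    using R D S b by (subst prod.remove[OF _ b]) (auto simp: c_def abs_mult)
  also have "\<dots> = R ^ DIM('a) * (1 / D * (1 / sqrt (D * S)) ^ (DIM('a) - 1))"
    using DIM_positive[where 'a='a] by (cases "DIM('a)") (auto simp: power_divide)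
  also have "(1 / sqrt (D * S)) ^ (DIM('a) - 1) = D powr (- (real DIM('a) - 1) / 2) * S powr (- (real DIM('a) - 1) / 2)"
  proof -
    have "(1 / sqrt X) ^ (DIM('a) - 1) = X powr (- (real DIM('a) - 1) / 2)" if "X > 0" for X
    proof -
      have "1 / sqrt X = X powr (- (1/2))" using that by (simp only: powr_minus_divide powr_half_sqrt less_imp_le)
      then have "(1 / sqrt X) ^ (DIM('a) - 1) = (X powr (- (1/2))) ^ (DIM('a) - 1)" by (simp only:)
      also have "\<dots> = (X powr (- (1/2))) powr real (DIM('a) - 1)"
        by (rule powr_realpow[symmetric]) (use that in simp)
      also have "\<dots> = X powr (- (1/2) * real (DIM('a) - 1))" by (rule powr_powr)
      also have "- (1/2) * real (DIM('a) - 1) = - (real DIM('a) - 1) / 2"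
        using DIM_positive[where 'a='a] by (simp add: of_nat_diff Suc_leI field_simps)
      finally show ?thesis .
    qed
    moreover have "1 / sqrt (D * S) = 1 / sqrt D * (1 / sqrt S)" by (simp add: real_sqrt_mult)
    ultimately show ?thesis using D S by (simp only: power_mult_distrib)
  qed
  also have "1 / D * (D powr (- (real DIM('a) - 1) / 2) * S powr (- (real DIM('a) - 1) / 2))
      = D powr (- (real DIM('a) + 1) / 2) * S powr (- (real DIM('a) - 1) / 2)"
  proof -
    have "1 / D = D powr (-1)" using D by (simp add: powr_minus divide_inverse)
    then have "1 / D * D powr (- (real DIM('a) - 1) / 2) = D powr (-1 + - (real DIM('a) - 1) / 2)"
      by (simp only: powr_add)
    also have "-1 + - (real DIM('a) - 1) / 2 = - (real DIM('a) + 1) / 2" by (simp add: field_simps)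
    finally show ?thesis by (simp only: mult.assoc[symmetric])
  qed
  finally have 3: "(\<Prod>j\<in>(Basis::'a set). \<bar>c j\<bar>) = R ^ DIM('a) * (D powr (- (real DIM('a) + 1) / 2) * S powr (- (real DIM('a) - 1) / 2))" .
  have "measure lebesgue (E e) = measure lebesgue (E b)" by (simp add: measure_def 1)
  also have "\<dots> = measure lborel (E b)" using openE[of b] by (simp add: measure_completion)
  also have "\<dots> = (\<Prod>j\<in>(Basis::'a set). \<bar>c j\<bar>) * measure lborel (ball (0::'a) 1)"
    by (simp add: measure_def 2 enn2real_mult prod_nonneg)
  finally show ?thesis unfolding E_def 3 unfolding D_def S_def by (simp add: mult.assoc)
qed

subsection \<open>The radial Riccati equation\<close>

lemma DERIV_nonneg_on_imp_le:
  fixes f :: "real \<Rightarrow> real"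
  assumes "a \<le> b" "\<And>x. a \<le> x \<Longrightarrow> x \<le> b \<Longrightarrow> (f has_real_derivative f' x) (at x)"
    "\<And>x. a \<le> x \<Longrightarrow> x \<le> b \<Longrightarrow> 0 \<le> f' x"
  shows "f a \<le> f b"
  using assms by (intro DERIV_nonneg_imp_nondecreasing[of a b f]) auto

lemma DERIV_nonpos_on_imp_le:
  fixes f :: "real \<Rightarrow> real"
  assumes "a \<le> b" "\<And>x. a \<le> x \<Longrightarrow> x \<le> b \<Longrightarrow> (f has_real_derivative f' x) (at x)"
    "\<And>x. a \<le> x \<Longrightarrow> x \<le> b \<Longrightarrow> f' x \<le> 0"
  shows "f b \<le> f a"
  using assms by (intro DERIV_nonpos_imp_nonincreasing[of a b f]) auto

section \<open>Lower bounds for the quartic \<open>f\<close> of the Riccati equation\<close>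

definition quartic :: "real \<Rightarrow> real \<Rightarrow> real" where
  "quartic C y = y^2 * (1 + C * (1 - y)^2)"

lemma quartic_deriv:
  "(quartic C has_real_derivative 2 * y * (1 + C * (2 * (y - 3/4)^2 - 1/8))) (at y)"
  unfolding quartic_def[abs_def]
  by (auto intro!: derivative_eq_intros) (simp add: field_simps power2_eq_square power3_eq_cube)

text \<open>The derivative is \<open>2 * y\<close> times a quadratic with minimum
  \<open>1 - C / 8\<close> at 3/4. For \<open>C < 8\<close> the quartic therefore increases.
  Otherwise it increases, decreases between the zeros \<open>(3 - S) / 4\<close> and
  \<open>(3 + S) / 4\<close>, and increases again, so to the right of \<open>a\<close> it is bounded
  below by its value at \<open>a\<close> or at the larger zero.\<close>

lemma quartic_min:
  assumes C: "C > 0" and a: "0 < a" "a \<le> y"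
  shows "quartic C a \<le> quartic C y \<or> (C \<ge> 8 \<and> quartic C ((3 + sqrt (1 - 8 / C)) / 4) \<le> quartic C y)"
proof (cases "C < 8")
  case True
  have "quartic C a \<le> quartic C y"
  proof (rule DERIV_nonneg_on_imp_le[OF a(2) quartic_deriv])
    fix x assume "a \<le> x" "x \<le> y"
    have "1 + C * (2 * (x - 3/4)^2 - 1/8) = (1 - C / 8) + C * (2 * (x - 3/4)^2)" by (simp add: algebra_simps)
    also have "\<dots> \<ge> 0" using True C by (intro add_nonneg_nonneg mult_nonneg_nonneg) auto
    finally show "0 \<le> 2 * x * (1 + C * (2 * (x - 3/4)^2 - 1/8))"
      using a \<open>a \<le> x\<close> by (intro mult_nonneg_nonneg) auto
  qed
  then show ?thesis ..
next
  case False
  define S where "S = sqrt (1 - 8 / C)"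
  have S2: "S^2 = 1 - 8 / C" using False C unfolding S_def by (subst real_sqrt_pow2) (auto simp: field_simps)
  have S0: "S \<ge> 0" unfolding S_def using False C by (simp add: field_simps)
  have fac: "1 + C * (2 * (x - 3/4)^2 - 1/8) = 2 * C * ((x - (3 - S) / 4) * (x - (3 + S) / 4))" for x
  proof -
    have "2 * C * ((x - (3 - S) / 4) * (x - (3 + S) / 4)) = 2 * C * ((x - 3/4)^2 - S^2 / 16)"
      by (simp add: power2_eq_square field_simps)
    also have "\<dots> = 1 + C * (2 * (x - 3/4)^2 - 1/8)" unfolding S2 using C by (simp add: field_simps)
    finally show ?thesis by simp
  qed
  consider "y \<le> (3 - S) / 4" | "(3 - S) / 4 \<le> y" "y \<le> (3 + S) / 4" | "(3 + S) / 4 \<le> y" by linarith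
  then show ?thesis
  proof cases
    case 1
    have "quartic C a \<le> quartic C y"
    proof (rule DERIV_nonneg_on_imp_le[OF a(2) quartic_deriv])
      fix x assume x: "a \<le> x" "x \<le> y"
      then have P: "(x - (3 - S) / 4) * (x - (3 + S) / 4) \<ge> 0" using 1 S0 by (intro mult_nonpos_nonpos) (auto simp: field_simps)
      show "0 \<le> 2 * x * (1 + C * (2 * (x - 3/4)^2 - 1/8))"
        unfolding fac by (rule mult_nonneg_nonneg[OF _ mult_nonneg_nonneg[OF _ P]]) (use a x C in auto)
    qed
    then show ?thesis ..
  next
    case 2
    have "quartic C ((3 + S) / 4) \<le> quartic C y"
    proof (rule DERIV_nonpos_on_imp_le[OF 2(2) quartic_deriv])
      fix x assume x: "y \<le> x" "x \<le> (3 + S) / 4"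
      then have P: "(x - (3 - S) / 4) * (x - (3 + S) / 4) \<le> 0" using 2 S0 by (intro mult_nonneg_nonpos) (auto simp: field_simps)
      show "2 * x * (1 + C * (2 * (x - 3/4)^2 - 1/8)) \<le> 0"
        unfolding fac by (rule mult_nonneg_nonpos[OF _ mult_nonneg_nonpos[OF _ P]]) (use a x C in auto)
    qed
    then show ?thesis using False by (auto simp: S_def)
  next
    case 3
    have "quartic C ((3 + S) / 4) \<le> quartic C y"
    proof (rule DERIV_nonneg_on_imp_le[OF 3 quartic_deriv])
      fix x assume x: "(3 + S) / 4 \<le> x" "x \<le> y"
      then have P: "(x - (3 - S) / 4) * (x - (3 + S) / 4) \<ge> 0" using S0 by (intro mult_nonneg_nonneg) (auto simp: field_simps)
      show "0 \<le> 2 * x * (1 + C * (2 * (x - 3/4)^2 - 1/8))"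
        unfolding fac by (rule mult_nonneg_nonneg[OF _ mult_nonneg_nonneg[OF _ P]]) (use S0 x C in auto)
    qed
    then show ?thesis using False by (auto simp: S_def)
  qed
qed

text \<open>Logarithmic derivatives add under products. Keeping every derivative as the function
  times a factor allows the weights to be divided out at the end.\<close>

lemma has_real_derivative_log_mult:
  assumes "(f has_real_derivative f x * l) (at x)" "(g has_real_derivative g x * m) (at x)"
  shows "((\<lambda>x. f x * g x) has_real_derivative f x * g x * (l + m)) (at x)"
  by (rule DERIV_cong[OF DERIV_mult[OF assms]]) (simp add: algebra_simps)

lemma artanh_ge:
  fixes t :: real
  assumes "0 \<le> t" "t < 1"
  shows "t \<le> artanh t"
proof -
  have "artanh 0 - 0 \<le> artanh t - t"
  proof (rule DERIV_nonneg_on_imp_le[of 0 t "\<lambda>t. artanh t - t"])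
    show "((\<lambda>t. artanh t - t) has_real_derivative 1 / (1 - x^2) - 1) (at x)" if "0 \<le> x" "x \<le> t" for x
      using that assms by (auto intro!: derivative_eq_intros)
    show "0 \<le> 1 / (1 - x^2) - 1" if "0 \<le> x" "x \<le> t" for x
    proof -
      have "x^2 < 1" using that assms by (simp add: abs_square_less_1)
      then show ?thesis by (simp add: field_simps)
    qed
  qed (use assms in auto)
  then show ?thesis by simp
qed

text \<open>All radial functions are functions of \<open>t = |x|\<close>, but \<open>yy'\<close> and \<open>yy''\<close> are the derivatives of \<open>yy\<close> with
  respect to \<open>r = artanh t\<close>.\<close>

locale radial_randers =
  fixes lam kap eps :: real
  assumes lam: "lam > 1" and kap: "kap > 0" and eps: "eps > 0"
begin

definition "th = theta lam"
definition "a = 1 - th"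
definition "k = keps lam kap eps"
text \<open>Chosen so that \<open>a / (1 - \<beta>)\<close>, with \<beta> the coefficient in the
  metric, takes the closed form \<open>yy\<close>. Since \<open>drift\<close> is then defined back
  from \<open>yy\<close>, \<open>drift_eq\<close> has to recover the original coefficient.\<close>

definition "\<tau> = th * eps^2 / a"
definition "qq t = artanh t + eps"
definition "yy t = (qq t)^2 / ((qq t)^2 + \<tau>)"
definition "yy' t = 2 * qq t * \<tau> / ((qq t)^2 + \<tau>)^2"
definition "yy'' t = 2 * \<tau> * (\<tau> - 3 * (qq t)^2) / ((qq t)^2 + \<tau>)^3"
definition "drift t = 1 - a / yy t"
definition "CC = 3 / \<tau>"

lemma th: "0 < th" "th < 1" using lam by (auto simp: th_def theta_def field_simps)
lemma a: "0 < a" "a < 1" using th by (auto simp: a_def)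
lemma k: "kap \<le> k" "0 < k" using kap by (auto simp: k_def keps_def)
lemma \<tau>: "\<tau> > 0" using th a eps by (simp add: \<tau>_def)
lemma CC: "CC > 0" using \<tau> by (simp add: CC_def)

lemma qq: assumes "0 \<le> t" "t < 1" shows "qq t \<ge> eps" "qq t > 0" "qq t > t" "(qq t)^2 + \<tau> > 0"
  using artanh_ge[OF assms] assms eps \<tau> by (auto simp: qq_def add_nonneg_pos)

lemma yy_bounds: assumes "0 \<le> t" "t < 1" shows "a \<le> yy t" "yy t < 1" "yy t > 0"
proof -
  note q = qq[OF assms]
  have "eps^2 \<le> (qq t)^2" using q eps by (intro power_mono) auto
  then have "th * eps^2 \<le> th * (qq t)^2" using th by (intro mult_left_mono) auto
  moreover have "a * \<tau> = th * eps^2" using a by (simp add: \<tau>_def)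
  moreover have "a * (qq t)^2 + th * (qq t)^2 = (qq t)^2" by (simp add: a_def algebra_simps)
  ultimately have "a * ((qq t)^2 + \<tau>) \<le> (qq t)^2" unfolding distrib_left by linarith
  then show 1: "a \<le> yy t" using q by (simp add: yy_def le_divide_eq)
  then show "yy t > 0" using a by simp
  show "yy t < 1" using q \<tau> by (simp add: yy_def divide_less_eq)
qed

lemma drift_eq:
  assumes "0 \<le> t" "t < 1"
  shows "drift t = th * (artanh t * (artanh t + 2 * eps) / (artanh t + eps)^2)"
proof -
  note q = qq[OF assms]
  have "a / yy t = a + th * eps^2 / (qq t)^2"
    using q a by (simp add: yy_def \<tau>_def field_simps)
  then have "drift t = th * (1 - eps^2 / (qq t)^2)" by (simp add: drift_def a_def algebra_simps)
  also have "1 - eps^2 / (qq t)^2 = ((qq t)^2 - eps^2) / (qq t)^2"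
    using q by (simp add: diff_divide_distrib)
  also have "(qq t)^2 - eps^2 = artanh t * (artanh t + 2 * eps)"
    by (simp add: qq_def algebra_simps power2_eq_square)
  finally show ?thesis by (simp add: qq_def)
qed

lemma drift_bounds: assumes "0 \<le> t" "t < 1" shows "0 \<le> drift t" "drift t \<le> th"
proof -
  show "0 \<le> drift t" using yy_bounds[OF assms] a by (simp add: drift_def)
  have "a \<le> a / yy t" using yy_bounds[OF assms] a by (simp add: le_divide_eq mult_left_le)
  then show "drift t \<le> th" by (simp add: drift_def a_def)
qed

lemma one_minus_drift_sq: assumes "0 \<le> t" "t < 1"
  shows "1 - (drift t)^2 = a / yy t * (2 - a / yy t)" "1 - (drift t)^2 > 0" "1 - (drift t)^2 \<ge> 1 - th^2"
proof -
  show 1: "1 - (drift t)^2 = a / yy t * (2 - a / yy t)"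
    by (simp add: drift_def power2_eq_square algebra_simps)
  have "(drift t)^2 \<le> th^2" using drift_bounds[OF assms] by (intro power_mono) auto
  then show 2: "1 - (drift t)^2 \<ge> 1 - th^2" by simp
  have "th^2 < 1" using th by (simp add: abs_square_less_1)
  with 2 show "1 - (drift t)^2 > 0" by simp
qed

lemma sq_less_1: assumes "0 \<le> t" "t < (1::real)" shows "t^2 < 1" "0 < 1 - t^2"
  using assms by (simp_all add: abs_square_less_1)

lemma yy_deriv: assumes "0 \<le> t" "t < 1"
  shows "(yy has_real_derivative yy' t / (1 - t^2)) (at t)"
    and "(yy' has_real_derivative yy'' t / (1 - t^2)) (at t)"
proof -
  note q = qq[OF assms] and s = sq_less_1[OF assms]
  have dq: "(qq has_real_derivative 1 / (1 - t^2)) (at t)"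
    unfolding qq_def[abs_def] using assms by (auto intro!: derivative_eq_intros)
  define Q where "Q = qq t"
  define D where "D = Q^2 + \<tau>"
  have D: "D > 0" using q by (simp add: D_def Q_def)
  have "(yy has_real_derivative ((2 * Q * (1 / (1 - t^2))) * D - Q^2 * (2 * Q * (1 / (1 - t^2)))) / (D * D)) (at t)"
    unfolding yy_def[abs_def] Q_def D_def using q by (auto intro!: derivative_eq_intros dq)
  also have "((2 * Q * (1 / (1 - t^2))) * D - Q^2 * (2 * Q * (1 / (1 - t^2)))) / (D * D) = yy' t / (1 - t^2)"
  proof -
    have "(2 * Q * (1 / (1 - t^2))) * D - Q^2 * (2 * Q * (1 / (1 - t^2))) = 2 * Q * (1 / (1 - t^2)) * (D - Q^2)"
      by (simp only: algebra_simps)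
    also have "D - Q^2 = \<tau>" by (simp add: D_def)
    finally show ?thesis unfolding yy'_def Q_def[symmetric] D_def[symmetric] by (simp add: power2_eq_square)
  qed
  finally show "(yy has_real_derivative yy' t / (1 - t^2)) (at t)" .
  have "(yy' has_real_derivative ((2 * \<tau> * (1 / (1 - t^2))) * D^2 - (2 * Q * \<tau>) * (2 * D * (2 * Q * (1 / (1 - t^2))))) / (D^2 * D^2)) (at t)"
    unfolding yy'_def[abs_def] Q_def D_def using q by (auto intro!: derivative_eq_intros dq)
  also have "((2 * \<tau> * (1 / (1 - t^2))) * D^2 - (2 * Q * \<tau>) * (2 * D * (2 * Q * (1 / (1 - t^2))))) / (D^2 * D^2)
      = (2 * \<tau> * D * (D - 4 * Q^2)) / D^4 / (1 - t^2)"
  proof -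
    have "((2 * \<tau> * (1 / u)) * D^2 - (2 * Q * \<tau>) * (2 * D * (2 * Q * (1 / u)))) / (D^2 * D^2)
      = (2 * \<tau> * D * (D - 4 * Q^2)) / D^4 / u" if "u > 0" for u
      using D that by (simp add: divide_simps) (simp add: power2_eq_square power4_eq_xxxx algebra_simps)
    then show ?thesis using s(2) by blast
  qed
  also have "\<dots> = yy'' t / (1 - t^2)"
  proof -
    have "D - 4 * Q^2 = \<tau> - 3 * Q^2" by (simp add: D_def)
    then show ?thesis unfolding yy''_def Q_def[symmetric] D_def[symmetric]
      using D by (simp add: power3_eq_cube power4_eq_xxxx mult.assoc)
  qed
  finally show "(yy' has_real_derivative yy'' t / (1 - t^2)) (at t)" .
qed

lemma yy'_eq: assumes "0 \<le> t" "t < 1" shows "yy' t = 2 * yy t * (1 - yy t) / qq t" "yy' t \<ge> 0"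
proof -
  note q = qq[OF assms]
  have "1 - yy t = \<tau> / ((qq t)^2 + \<tau>)" using q by (simp add: yy_def field_simps)
  then show "yy' t = 2 * yy t * (1 - yy t) / qq t"
    using q by (simp add: yy'_def yy_def power2_eq_square)
  show "yy' t \<ge> 0" using q \<tau> by (simp add: yy'_def)
qed

text \<open>The left side is \<open>k y phi' + phi^2\<close> divided by \<open>k^2\<close>, with the
  derivative taken in \<open>r\<close>. That it depends on \<open>y\<close> alone, which reduces the
  problem to minimizing a polynomial, is special to this drift: both sides equal
  \<open>y^2 + 3 * Q^4 * \<tau> / D^4\<close>.\<close>

lemma quartic_identity: assumes "0 \<le> t" "t < 1"
  shows "(yy t)^2 + (yy' t)^2 / 4 - yy t * yy'' t / 2 = quartic CC (yy t)"
proof -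
  note q = qq[OF assms]
  define Q where "Q = qq t"
  define D where "D = Q^2 + \<tau>"
  have D: "D > 0" using q by (simp add: D_def Q_def)
  have y: "yy t = Q^2 / D" "yy' t = 2 * Q * \<tau> / D^2" "yy'' t = 2 * \<tau> * (\<tau> - 3 * Q^2) / D^3"
    by (simp_all add: yy_def yy'_def yy''_def Q_def D_def)
  have 1: "1 - Q^2 / D = \<tau> / D" using D by (simp add: D_def field_simps)
  have "quartic CC (yy t) = (yy t)^2 + 3 * Q^4 * \<tau> / D^4"
    unfolding quartic_def y 1 CC_def using \<tau> D by (simp add: field_simps power4_eq_xxxx power2_eq_square)
  moreover have "(yy' t)^2 / 4 - yy t * yy'' t / 2 = 3 * Q^4 * \<tau> / D^4"
    unfolding y using D by (simp add: field_simps power4_eq_xxxx power2_eq_square power3_eq_cube)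
  ultimately show ?thesis by simp
qed

text \<open>In terms of \<open>S = sqrt (1 - 8 / CC)\<close> the radical \<open>Qeps\<close> becomes
  \<open>3 * a^2 * S\<close>, everything turns rational, and both sides equal
  \<open>(3 + S)^3 / (32 * (1 + S))\<close>.\<close>

lemma Keps_eq:
  assumes "eps \<le> eps0 lam"
  shows "Keps lam eps = quartic CC ((3 + sqrt (1 - 8 / CC)) / 4)" "CC \<ge> 8" "Keps lam eps > 0"
proof -
  define w where "w = eps^2 * th"
  have w: "w > 0" using eps th by (simp add: w_def)
  have C8: "8 / CC = 8 * w / (3 * a)" using a by (simp add: CC_def \<tau>_def w_def field_simps)
  have "eps^2 \<le> (eps0 lam)^2" using assms eps by (intro power_mono) auto
  also have "(eps0 lam)^2 = 3 * a / (8 * th)"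
    using a th by (simp add: eps0_def th_def[symmetric] a_def[symmetric])
  finally have "8 * w \<le> 3 * a" using th by (simp add: w_def field_simps)
  then have C81: "8 / CC \<le> 1" unfolding C8 using a by (simp add: divide_le_eq)
  then show C8': "CC \<ge> 8" using CC by (simp add: divide_le_eq)
  define S where "S = sqrt (1 - 8 / CC)"
  have S2: "S^2 = 1 - 8 / CC" using C81 by (simp add: S_def)
  have S0: "S \<ge> 0" using C81 by (simp add: S_def)
  have S1: "S < 1" using CC by (simp add: S_def real_sqrt_lt_1_iff)
  have w_eq: "w = 3 * a * (1 - S^2) / 8" using S2 C8 a by (simp add: field_simps)
  have Q: "Qeps lam eps = 3 * a^2 * S"
  proof -
    have "3 * a^3 * (3 * a - 8 * w) = (3 * a^2 * S)^2"
    proof -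
      have "8 * w = 3 * a * (1 - S^2)" by (simp add: w_eq)
      then show ?thesis by (simp only:) (simp add: power2_eq_square power3_eq_cube algebra_simps)
    qed
    then have "Qeps lam eps = sqrt ((3 * a^2 * S)^2)"
      unfolding Qeps_def th_def[symmetric] a_def[symmetric] by (simp add: w_def mult_ac)
    also have "\<dots> = 3 * a^2 * S" using S0 a by simp
    finally show ?thesis .
  qed
  have n: "a * (3 * a - 2 * w) + 3 * a^2 * S = 3 * a^2 / 4 * ((1 + S) * (3 + S))"
    by (simp add: w_eq power2_eq_square field_simps)
  have d: "3 * a^2 + 3 * a^2 * S = 3 * a^2 * (1 + S)" by (simp add: algebra_simps)
  have "Keps lam eps = 6 * a^2 * (a * (3 * a - 2 * w) + 3 * a^2 * S)^3 / (3 * a^2 + 3 * a^2 * S)^4"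
    unfolding Keps_def Q th_def[symmetric] a_def[symmetric] w_def by (simp add: mult_ac)
  also have "\<dots> = (3 + S)^3 / (32 * (1 + S))"
  proof -
    have "6 * a^2 * (3 * a^2 / 4 * (X * Y))^3 / (3 * a^2 * X)^4 = Y^3 / (32 * X)" if "X > 0" for X Y
      using that a by (simp add: power_numeral_reduce field_simps)
    then show ?thesis unfolding n d using S0 by auto
  qed
  finally have 1: "Keps lam eps = (3 + S)^3 / (32 * (1 + S))" .
  have "1 - S^2 = 8 / CC" using S2 by simp
  then have CCS: "CC = 8 / (1 - S^2)" using CC by simp
  have f: "1 - S^2 = (1 - S) * (1 + S)" by (simp add: power2_eq_square algebra_simps)
  have g: "1 - (3 + S) / 4 = (1 - S) / 4" by (simp add: field_simps)
  have "8 / (u * v) * (u / 4)^2 = u / (2 * v)" if "u > 0" "v > 0" for u v :: real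
    using that by (simp add: field_simps power2_eq_square)
  from this[of "1 - S" "1 + S"] have "CC * (1 - (3 + S) / 4)^2 = (1 - S) / (2 * (1 + S))"
    unfolding CCS f g using S1 S0 by simp
  then have "quartic CC ((3 + S) / 4) = ((3 + S) / 4)^2 * (1 + (1 - S) / (2 * (1 + S)))"
    by (simp add: quartic_def)
  also have "\<dots> = (3 + S)^3 / (32 * (1 + S))"
    using S0 by (simp add: field_simps power2_eq_square power3_eq_cube)
  finally show "Keps lam eps = quartic CC ((3 + sqrt (1 - 8 / CC)) / 4)" using 1 by (simp add: S_def)
  show "Keps lam eps > 0" unfolding 1 using S0 by simp
qed

lemma K0_eq: "K0 lam eps = quartic CC a"
  unfolding K0_def quartic_def CC_def \<tau>_def th_def[symmetric] a_def[symmetric]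
  using a eps th by (simp add: field_simps) (simp add: a_def power2_eq_square)

lemma le_k_sqrt_imp: assumes "K > 0" "kap / sqrt K \<le> k" shows "kap^2 \<le> k^2 * K"
proof -
  have "kap \<le> k * sqrt K" using assms by (simp add: divide_le_eq)
  then have "kap^2 \<le> (k * sqrt K)^2" using kap by (intro power_mono) auto
  then show ?thesis using assms by (simp add: power_mult_distrib)
qed

text \<open>The alternatives of \<open>quartic_min\<close> match the terms with \<open>K0\<close>
  and \<open>Keps\<close> in the maximum \<open>k\<close>. Because \<open>CC \<ge> 8\<close> amounts
  to \<open>eps \<le> eps0 lam\<close>, the convention that drops \<open>Keps\<close> for larger
  \<open>eps\<close> applies exactly when the quartic has no positive critical point.\<close>

lemma quartic_lower: assumes "a \<le> y" shows "kap^2 \<le> k^2 * quartic CC y"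
  using quartic_min[OF CC a(1) assms]
proof
  assume *: "quartic CC a \<le> quartic CC y"
  have "quartic CC a > 0" using a CC by (auto simp: quartic_def intro!: mult_pos_pos add_pos_nonneg)
  then have "kap^2 \<le> k^2 * quartic CC a"
    using le_k_sqrt_imp[of "K0 lam eps"] by (simp add: K0_eq k_def keps_def)
  also have "\<dots> \<le> k^2 * quartic CC y" using * by (intro mult_left_mono) auto
  finally show ?thesis .
next
  assume *: "CC \<ge> 8 \<and> quartic CC ((3 + sqrt (1 - 8 / CC)) / 4) \<le> quartic CC y"
  have "eps \<le> eps0 lam"
  proof -
    have "8 * \<tau> \<le> 3" using * \<tau> by (simp add: CC_def le_divide_eq)
    then have "eps^2 \<le> 3 * a / (8 * th)" using a th by (simp add: \<tau>_def field_simps)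
    then have "eps \<le> sqrt (3 * a / (8 * th))" by (rule real_le_rsqrt)
    then show ?thesis by (simp add: eps0_def th_def a_def)
  qed
  note K = Keps_eq[OF this]
  have "kap^2 \<le> k^2 * Keps lam eps"
    using K(3) \<open>eps \<le> eps0 lam\<close> by (intro le_k_sqrt_imp) (auto simp: k_def keps_def kap_over_sqrtK_def)
  also have "\<dots> \<le> k^2 * quartic CC y" using * K(1) by (intro mult_left_mono) auto
  finally show ?thesis .
qed

text \<open>\<open>phi\<close> is \<open>k (y coth r - y' / 2)\<close>. At a minimum on \<open>[t0, t1]\<close> with \<open>0 < phi < kap\<close> the Riccati equation
  would make \<open>phi\<close> strictly increasing, so \<open>phi\<close> never drops below \<open>kap\<close>.\<close>

definition "phi t = k * (yy t / t - yy' t / 2)"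

text \<open>Lets \<open>phi_ge\<close> pass from \<open>phi < kap\<close> to
  \<open>phi^2 < kap^2\<close>. It rests on \<open>qq t > t\<close>: the subtracted term is
  \<open>yy t * (1 - yy t) / qq t\<close>, with numerator below \<open>yy t\<close>.\<close>

lemma phi_pos: assumes "0 < t" "t < 1" shows "phi t > 0"
proof -
  have t: "0 \<le> t" "t < 1" using assms by auto
  note y = yy_bounds[OF t] and q = qq[OF t]
  have "yy' t / 2 = yy t * ((1 - yy t) / qq t)" using yy'_eq[OF t] by simp
  moreover have "(1 - yy t) / qq t < 1 / t"
  proof -
    have "(1 - yy t) / qq t \<le> 1 / qq t" using y q by (intro divide_right_mono) auto
    also have "\<dots> < 1 / t" using q assms by (intro divide_strict_left_mono) auto
    finally show ?thesis .
  qed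
  ultimately have "yy' t / 2 < yy t / t"
    using y mult_strict_left_mono[of "(1 - yy t) / qq t" "1 / t" "yy t"] by simp
  then show ?thesis using k by (simp add: phi_def)
qed

text \<open>Here \<open>1 / t\<close> is \<open>coth r\<close>. Its derivative
  \<open>1 - coth^2 r\<close> supplies the square that makes the equation one of Riccati type, and
  \<open>1 - t^2\<close> converts from \<open>r\<close> to \<open>t\<close>.\<close>

lemma phi_deriv: assumes "0 < t" "t < 1"
  shows "(phi has_real_derivative (k^2 * quartic CC (yy t) - (phi t)^2) / (k * yy t * (1 - t^2))) (at t)"
proof -
  have t: "0 \<le> t" "t < 1" using assms by auto
  note y = yy_bounds[OF t] and s = sq_less_1[OF t]
  have "(phi has_real_derivative k * ((yy' t / (1 - t^2) * t - yy t) / (t * t) - yy'' t / (1 - t^2) / 2)) (at t)"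
    unfolding phi_def[abs_def] using assms
      DERIV_cmult[OF DERIV_diff[OF DERIV_divide[OF yy_deriv(1)[OF t] DERIV_ident] DERIV_cdivide[OF yy_deriv(2)[OF t], of 2]], of k]
    by simp
  also have "k * ((yy' t / (1 - t^2) * t - yy t) / (t * t) - yy'' t / (1 - t^2) / 2)
     = (k^2 * quartic CC (yy t) - (phi t)^2) / (k * yy t * (1 - t^2))"
  proof -
    have "k * ((y1 / s * t - y) / (t * t) - y2 / s / 2) = (k^2 * (y^2 + y1^2 / 4 - y * y2 / 2) - (k * (y / t - y1 / 2))^2) / (k * y * s)"
      if "s > 0" "y > 0" "1 - t^2 = s" for y y1 y2 s
    proof -
      have "k * ((y1 / s * t - y) / (t * t) - y2 / s / 2) = k * (y1 / t - y * s / t^2 - y2 / 2) / s"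
        using that assms by (simp add: field_simps power2_eq_square)
      also have "\<dots> = (k^2 * y * (y1 / t - y * s / t^2 - y2 / 2)) / (k * y * s)"
        using that k by (simp add: power2_eq_square)
      also have "k^2 * y * (y1 / t - y * s / t^2 - y2 / 2) = k^2 * (y^2 + y1^2 / 4 - y * y2 / 2) - (k * (y / t - y1 / 2))^2"
        unfolding that(3)[symmetric] using assms by (simp add: field_simps power2_eq_square)
      finally show ?thesis .
    qed
    from this[OF s(2) y(3) refl] show ?thesis unfolding quartic_identity[OF t, symmetric] phi_def by blast
  qed
  finally show ?thesis .
qed

lemma phi_ge: assumes t1: "0 < t1" "t1 < 1" shows "kap \<le> phi t1"
proof (rule ccontr)
  assume neg: "\<not> kap \<le> phi t1"
  \<comment> \<open>So close to the centre that \<open>yy t0 / t0\<close>, at least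
    \<open>a / t0\<close>, exceeds \<open>kap / k\<close> by at least \<open>1 / eps\<close>, which
    bounds \<open>yy' t0 / 2\<close>.\<close>
  define t0 where "t0 = min (t1 / 2) (a / (kap / k + 1 / eps))"
  have den: "kap / k + 1 / eps > 0" using kap k eps by (simp add: add_pos_pos)
  have t0: "0 < t0" "t0 < t1" using t1 a den by (auto simp: t0_def)
  have t0': "0 \<le> t0" "t0 < 1" using t0 t1 by auto
  have phi0: "kap \<le> phi t0"
  proof -
    have "t0 \<le> a / (kap / k + 1 / eps)" by (simp add: t0_def)
    then have 1: "kap / k + 1 / eps \<le> a / t0" using den t0 by (simp add: field_simps)
    have 2: "a / t0 \<le> yy t0 / t0" using yy_bounds[OF t0'] t0 by (intro divide_right_mono) auto
    have "yy' t0 / 2 = yy t0 * (1 - yy t0) / qq t0" using yy'_eq[OF t0'] by simp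
    also have "\<dots> \<le> 1 / eps"
    proof (rule frac_le)
      show "yy t0 * (1 - yy t0) \<le> 1" using yy_bounds[OF t0'] by (intro mult_le_one) auto
    qed (use eps qq[OF t0'] in auto)
    finally have "kap / k \<le> yy t0 / t0 - yy' t0 / 2" using 1 2 by linarith
    then show ?thesis using k by (simp add: phi_def divide_le_eq mult.commute)
  qed
  have "continuous_on {t0..t1} phi"
    using t0 t1 by (intro DERIV_continuous_on[OF has_field_derivative_at_within[OF phi_deriv]]) auto
  then obtain m where m: "m \<in> {t0..t1}" "\<And>x. x \<in> {t0..t1} \<Longrightarrow> phi m \<le> phi x"
    using continuous_attains_inf[of "{t0..t1}" phi] t0 by auto
  have lt: "phi m < kap" using m(2)[of t1] t0 neg by auto
  then have m0: "t0 < m" using phi0 m(1) by (cases "m = t0") auto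
  then have mm: "0 < m" "m < 1" "0 \<le> m" using t0 t1 m(1) by auto
  have "(phi m)^2 < kap^2" using lt phi_pos[OF mm(1,2)] by (intro power_strict_mono) auto
  also have "\<dots> \<le> k^2 * quartic CC (yy m)" using quartic_lower yy_bounds mm by auto
  finally have "(k^2 * quartic CC (yy m) - (phi m)^2) / (k * yy m * (1 - m^2)) > 0"
    using k yy_bounds[of m] sq_less_1[of m] mm by (intro divide_pos_pos mult_pos_pos) auto
  from DERIV_pos_inc_left[OF phi_deriv[OF mm(1,2)] this]
  obtain d where d: "d > 0" "\<And>h. 0 < h \<Longrightarrow> h < d \<Longrightarrow> phi (m - h) < phi m" by auto
  \<comment> \<open>Capped at \<open>m - t0\<close> so that \<open>m - h\<close> stays in the
    interval on which \<open>phi\<close> is minimal at \<open>m\<close>.\<close>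
  define h where "h = min (d / 2) (m - t0)"
  have "phi (m - h) < phi m" using d m0 by (intro d(2)) (auto simp: h_def)
  moreover have "phi m \<le> phi (m - h)" using m(1) m0 d(1) by (intro m(2)) (auto simp: h_def min_def)
  ultimately show False by simp
qed

end

lemma has_real_derivative_log_powr:
  assumes "(g has_real_derivative g x * m) (at x)" "g x > 0"
  shows "((\<lambda>x. g x powr r) has_real_derivative g x powr r * (r * m)) (at x)"
proof (rule DERIV_cong[OF DERIV_fun_powr[OF assms, of r]])
  show "r * g x powr (r - of_nat 1) * (g x * m) = g x powr r * (r * m)"
    using assms(2) by (simp add: powr_diff)
qed

section \<open>Radial weights and the divergence of the unit field\<close>

context radial_randers
begin

text \<open>The integral of \<open>(1 - drift) / (k * a)\<close> over \<open>r\<close> from 0; the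
  closed form exists because \<open>r^2 / (r + eps)\<close> is an antiderivative of
  \<open>r * (r + 2 * eps) / (r + eps)^2\<close>.\<close>

definition "rho0 t = (artanh t - th * (artanh t)^2 / (artanh t + eps)) / (k * a)"
text \<open>Up to the factor \<open>(k a)\<close> to the power \<open>n\<close>, \<open>wt n h |x|\<close> is the density of the measure.\<close>

definition "wt n h t = exp (- (real n - 1) * h * rho0 t) * (1 - (drift t)^2) powr ((real n + 1) / 2)
  * (1 - t^2) powr (- (real n + 1) / 2)"
text \<open>The Euclidean length of the outward radial vector of unit \<open>Feps\<close>-length,
  see \<open>Feps_sgn_pos\<close>.\<close>

definition "coef t = k * yy t * (1 - t^2)"
text \<open>Up to a constant, the flux of this unit field through the sphere of radius
  \<open>t\<close>; its derivative measures the divergence of the field.\<close>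

definition "flux n h t = coef t * wt n h t * t ^ (n - 1)"

lemma rho0_0: "rho0 0 = 0" by (simp add: rho0_def)

lemma rho0_deriv: assumes "0 \<le> t" "t < 1"
  shows "(rho0 has_real_derivative 1 / (k * yy t * (1 - t^2))) (at t)"
proof -
  note q = qq[OF assms] and s = sq_less_1[OF assms] and y = yy_bounds[OF assms]
  define r where "r = artanh t"
  have r: "r + eps > 0" using q by (simp add: qq_def r_def)
  have "(rho0 has_real_derivative (1 / (1 - t^2) - (th * (2 * r * (1 / (1 - t^2))) * (r + eps) - th * r^2 * (1 / (1 - t^2))) / ((r + eps) * (r + eps))) / (k * a)) (at t)"
    unfolding rho0_def[abs_def] r_def using assms r[unfolded r_def] k a
    by (auto intro!: derivative_eq_intros)
  also have "(1 / (1 - t^2) - (th * (2 * r * (1 / (1 - t^2))) * (r + eps) - th * r^2 * (1 / (1 - t^2))) / ((r + eps) * (r + eps)))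
     = (1 - drift t) / (1 - t^2)"
  proof -
    have "(1 / u - (th * (2 * r * (1 / u)) * (r + eps) - th * r^2 * (1 / u)) / ((r + eps) * (r + eps)))
      = (1 - th * (r * (r + 2 * eps) / (r + eps)^2)) / u" if "u > 0" for u
    proof -
      have "th * (2 * r * (1 / u)) * (r + eps) - th * r^2 * (1 / u) = th * (r * (r + 2 * eps)) / u"
        using that by (simp add: field_simps power2_eq_square)
      then show ?thesis by (simp add: power2_eq_square diff_divide_distrib)
    qed
    then show ?thesis unfolding drift_eq[OF assms] r_def[symmetric] using s by blast
  qed
  also have "(1 - drift t) / (1 - t^2) / (k * a) = 1 / (k * yy t * (1 - t^2))"
    using a y k by (simp add: drift_def)
  finally show ?thesis .
qed

lemma wt_deriv: assumes "0 \<le> t" "t < 1"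
  shows "(wt n h has_real_derivative wt n h t * (- (real n - 1) * h / (k * yy t * (1 - t^2))
    - (real n + 1) * (yy t - a) * yy' t / (yy t * (2 * yy t - a) * (1 - t^2)) + (real n + 1) * t / (1 - t^2))) (at t)"
proof -
  note s = sq_less_1[OF assms] and y = yy_bounds[OF assms] and d = one_minus_drift_sq[OF assms]
  have y2: "2 * yy t - a > 0" using y by linarith
  have E: "((\<lambda>t. exp (- (real n - 1) * h * rho0 t)) has_real_derivative
      exp (- (real n - 1) * h * rho0 t) * (- (real n - 1) * h / (k * yy t * (1 - t^2)))) (at t)"
    by (rule DERIV_cong[OF DERIV_fun_exp[OF DERIV_cmult[OF rho0_deriv[OF assms]]]]) simp
  have "((\<lambda>t. 1 - (drift t)^2) has_real_derivative - (2 * drift t * (a * (yy' t / (1 - t^2)) / (yy t * yy t)))) (at t)"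
    unfolding drift_def[abs_def] using y
    by (auto intro!: derivative_eq_intros yy_deriv(1)[OF assms])
  also have "- (2 * drift t * (a * (yy' t / (1 - t^2)) / (yy t * yy t)))
      = (1 - (drift t)^2) * (- 2 * (yy t - a) * yy' t / (yy t * (2 * yy t - a) * (1 - t^2)))"
  proof -
    have "- (2 * (1 - a / Y) * (a * (y1 / u) / (Y * Y))) = (a / Y * (2 - a / Y)) * (- 2 * (Y - a) * y1 / (Y * (2 * Y - a) * u))"
      if "Y > 0" "u > 0" "2 * Y - a > 0" for Y y1 u
    proof -
      have "a / Y * (2 - a / Y) = a * (2 * Y - a) / (Y * Y)" using that by (simp add: field_simps)
      moreover have "1 - a / Y = (Y - a) / Y" using that by (simp add: field_simps)
      ultimately show ?thesis using that by (simp add: divide_simps) (simp add: algebra_simps)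
    qed
    from this[OF y(3) s(2) y2] show ?thesis unfolding d(1) by (simp only: drift_def)
  qed
  finally have D: "((\<lambda>t. 1 - (drift t)^2) has_real_derivative (1 - (drift t)^2) * (- 2 * (yy t - a) * yy' t / (yy t * (2 * yy t - a) * (1 - t^2)))) (at t)" .
  have U: "((\<lambda>t. 1 - t^2) has_real_derivative (1 - t^2) * (- 2 * t / (1 - t^2))) (at t)"
    using s by (auto intro!: derivative_eq_intros)
  have l: "e + (N + 1) / 2 * (- 2 * X * Y / Z) + - (N + 1) / 2 * (- 2 * t / u) = e - (N + 1) * X * Y / Z + (N + 1) * t / u"
    for e N X Y Z u :: real
  proof -
    have "(N + 1) / 2 * (- 2 * X * Y / Z) = - ((N + 1) * X * Y / Z)"
      by (cases "Z = 0") (simp_all add: field_simps)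
    moreover have "- (N + 1) / 2 * (- 2 * t / u) = (N + 1) * t / u"
      by (cases "u = 0") (simp_all add: field_simps)
    ultimately show ?thesis by (simp only:)
  qed
  show ?thesis
    unfolding wt_def[abs_def]
    by (rule DERIV_cong[OF has_real_derivative_log_mult[OF has_real_derivative_log_mult[OF E
          has_real_derivative_log_powr[OF D d(2)]] has_real_derivative_log_powr[OF U s(2)]]])
      (simp only: l)
qed

lemma wt_pos: assumes "0 \<le> t" "t < 1" shows "wt n h t > 0"
  using one_minus_drift_sq(2)[OF assms] sq_less_1[OF assms] by (simp add: wt_def)

lemma coef_pos: assumes "0 \<le> t" "t < 1" shows "coef t > 0"
  using yy_bounds[OF assms] sq_less_1[OF assms] k by (simp add: coef_def)

lemma coef_deriv: assumes "0 \<le> t" "t < 1"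
  shows "(coef has_real_derivative coef t * (yy' t / (yy t * (1 - t^2)) - 2 * t / (1 - t^2))) (at t)"
proof -
  note s = sq_less_1[OF assms] and y = yy_bounds[OF assms]
  have Y: "((\<lambda>t. k * yy t) has_real_derivative (k * yy t) * (yy' t / (yy t * (1 - t^2)))) (at t)"
    using y by (intro DERIV_cong[OF DERIV_cmult[OF yy_deriv(1)[OF assms]]]) simp
  have U: "((\<lambda>t. 1 - t^2) has_real_derivative (1 - t^2) * (- 2 * t / (1 - t^2))) (at t)"
    using s by (auto intro!: derivative_eq_intros)
  show ?thesis unfolding coef_def[abs_def]
    by (rule DERIV_cong[OF has_real_derivative_log_mult[OF Y U]]) simp
qed

lemma wt_continuous: assumes "S < 1" shows "continuous_on {0..S} (wt n h)"
  using assms by (intro DERIV_continuous_on[OF has_field_derivative_at_within[OF wt_deriv]]) auto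

lemma coef_continuous: assumes "S < 1" shows "continuous_on {0..S} coef"
  using assms by (intro DERIV_continuous_on[OF has_field_derivative_at_within[OF coef_deriv]]) auto

text \<open>The logarithmic derivatives of the three factors are added and multiplied by
  \<open>coef t\<close>. The only loss before \<open>phi_ge\<close> is the estimate
  \<open>(Y - a) / (2 * Y - a) \<le> 1 / 2\<close> in the term coming from
  \<open>1 - drift^2\<close>, usable because \<open>yy'\<close> is nonnegative; with
  \<open>1 / 2\<close> in its place the sum is exactly \<open>(N - 1) * (phi t - h)\<close>.\<close>

lemma flux_deriv:
  assumes t: "0 < t" "t < 1" and n: "n \<ge> 1"
  shows "\<exists>D. (flux n h has_real_derivative D) (at t) \<and> (real n - 1) * (kap - h) * (wt n h t * t ^ (n - 1)) \<le> D"
proof -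
  have t': "0 \<le> t" "t < 1" using t by auto
  note s = sq_less_1[OF t'] and y = yy_bounds[OF t']
  define u where "u = 1 - t^2"
  define Y where "Y = yy t"
  define y1 where "y1 = yy' t"
  define N where "N = real n"
  have N: "N \<ge> 1" using n by (simp add: N_def)
  have u: "u > 0" using s by (simp add: u_def)
  have Y: "Y > 0" "a \<le> Y" "2 * Y - a > 0" using y by (auto simp: Y_def)
  have y1: "y1 \<ge> 0" using yy'_eq[OF t'] by (simp add: y1_def)
  define l where "l = y1 / (Y * u) - 2 * t / u + (- (N - 1) * h / (k * Y * u)
    - (N + 1) * (Y - a) * y1 / (Y * (2 * Y - a) * u) + (N + 1) * t / u) + (N - 1) / t"
  have P: "((\<lambda>t. t ^ (n - 1)) has_real_derivative t ^ (n - 1) * ((N - 1) / t)) (at t)"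
  proof (rule DERIV_cong[OF DERIV_pow])
    show "real (n - 1) * t ^ (n - 1 - Suc 0) = t ^ (n - 1) * ((N - 1) / t)"
      using t n by (cases "n - 1") (auto simp: N_def of_nat_diff)
  qed
  have "(flux n h has_real_derivative coef t * wt n h t * t ^ (n - 1) * l) (at t)"
    unfolding flux_def[abs_def]
    using has_real_derivative_log_mult[OF has_real_derivative_log_mult[OF coef_deriv[OF t'] wt_deriv[OF t']] P]
    by (simp add: l_def u_def Y_def y1_def N_def)
  moreover have "(N - 1) * (kap - h) * (wt n h t * t ^ (n - 1)) \<le> coef t * wt n h t * t ^ (n - 1) * l"
  proof -
    have "coef t * l = k * y1 - (N - 1) * h - k * (N + 1) * y1 * ((Y - a) / (2 * Y - a)) + k * Y * ((N - 1) * (t + u / t))"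
    proof -
      have c: "coef t = k * Y * u" by (simp add: coef_def Y_def u_def)
      have "k * Y * u * (y1 / (Y * u)) = k * y1" "k * Y * u * (2 * t / u) = k * Y * (2 * t)"
        "k * Y * u * (- (N - 1) * h / (k * Y * u)) = - (N - 1) * h"
        "k * Y * u * ((N + 1) * (Y - a) * y1 / (Y * (2 * Y - a) * u)) = k * (N + 1) * y1 * ((Y - a) / (2 * Y - a))"
        "k * Y * u * ((N + 1) * t / u) = k * Y * ((N + 1) * t)"
        "k * Y * u * ((N - 1) / t) = k * Y * ((N - 1) * (u / t))"
        using Y u k t by simp_all
      then have "coef t * l = k * y1 - k * Y * (2 * t) + (- (N - 1) * h
         - k * (N + 1) * y1 * ((Y - a) / (2 * Y - a)) + k * Y * ((N + 1) * t)) + k * Y * ((N - 1) * (u / t))"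
        unfolding l_def c by (simp only: distrib_left right_diff_distrib)
      then show ?thesis by (simp add: algebra_simps)
    qed
    also have "t + u / t = 1 / t" using t by (simp add: u_def field_simps power2_eq_square)
    finally have e: "coef t * l = k * y1 - (N - 1) * h - k * (N + 1) * y1 * ((Y - a) / (2 * Y - a)) + k * Y * ((N - 1) * (1 / t))" .
    have "(Y - a) / (2 * Y - a) \<le> 1 / 2" using Y a by (simp add: divide_le_eq)
    then have "k * (N + 1) * y1 * ((Y - a) / (2 * Y - a)) \<le> k * (N + 1) * y1 * (1 / 2)"
      using k N y1 by (intro mult_left_mono) auto
    then have "coef t * l \<ge> k * y1 - (N - 1) * h - k * (N + 1) * y1 * (1 / 2) + k * Y * ((N - 1) * (1 / t))"
      unfolding e by linarith
    also have "k * y1 - (N - 1) * h - k * (N + 1) * y1 * (1 / 2) + k * Y * ((N - 1) * (1 / t)) = (N - 1) * (phi t - h)"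
      by (simp add: phi_def Y_def y1_def field_simps)
    finally have "(N - 1) * (phi t - h) \<le> coef t * l" .
    moreover have "(N - 1) * (kap - h) \<le> (N - 1) * (phi t - h)"
      using phi_ge[OF t] N by (intro mult_left_mono) auto
    ultimately have "(N - 1) * (kap - h) \<le> coef t * l" by linarith
    then have "(N - 1) * (kap - h) * (wt n h t * t ^ (n - 1)) \<le> coef t * l * (wt n h t * t ^ (n - 1))"
      using wt_pos[OF t'] t by (intro mult_right_mono) (auto intro: less_imp_le)
    then show ?thesis by (simp add: mult_ac)
  qed
  ultimately show ?thesis unfolding N_def by blast
qed

subsection \<open>Distance and measure\<close>

text \<open>Since \<open>sgn 0 = 0\<close>, one formula also covers the centre, where
  \<open>Feps\<close> switches branch.\<close>

lemma Feps_sgn: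
  fixes x v :: "'a::euclidean_space"
  assumes x: "norm x < 1"
  shows "Feps lam kap eps x v = (sqrt ((norm v)^2 * (1 - (norm x)^2) + (norm x)^2 * (sgn x \<bullet> v)^2)
    - drift (norm x) * (sgn x \<bullet> v)) / (k * a * (1 - (norm x)^2))"
proof (cases "x = 0")
  case True
  then show ?thesis by (simp add: Feps_def Let_def k_def a_def th_def)
next
  case False
  have d: "drift (norm x) = th * (artanh (norm x) * (artanh (norm x) + 2 * eps) / (artanh (norm x) + eps)^2)"
    using drift_eq x by auto
  have "x \<bullet> v = norm x * (sgn x \<bullet> v)" using False by (simp add: sgn_div_norm)
  then have "(norm v)^2 - (norm x)^2 * (norm v)^2 + (x \<bullet> v)^2 = (norm v)^2 * (1 - (norm x)^2) + (norm x)^2 * (sgn x \<bullet> v)^2"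
    by (simp add: power_mult_distrib algebra_simps)
  moreover have "th * (x \<bullet> v) / (k * a * norm x * (1 - (norm x)^2)) * X = th * X * (sgn x \<bullet> v) / (k * a * (1 - (norm x)^2))" for X
    using False by (simp add: sgn_div_norm divide_inverse mult_ac)
  ultimately show ?thesis
    unfolding Feps_def Let_def k_def[symmetric] th_def[symmetric] a_def[symmetric] d
    using False by (simp add: diff_divide_distrib)
qed

text \<open>\<open>A\<close> is a convex combination of \<open>(norm v)^2\<close> and
  \<open>(sgn x \<bullet> v)^2\<close>, and Cauchy-Schwarz puts the second below the first.\<close>

lemma Feps_nonneg_aux:
  fixes x v :: "'a::euclidean_space"
  assumes x: "norm x < 1"
  defines "A \<equiv> (norm v)^2 * (1 - (norm x)^2) + (norm x)^2 * (sgn x \<bullet> v)^2"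
  shows "\<bar>sgn x \<bullet> v\<bar> \<le> sqrt A" "sqrt A \<le> norm v" "sqrt (1 - (norm x)^2) * norm v \<le> sqrt A"
proof -
  have s: "0 < 1 - (norm x)^2" using sq_less_1[of "norm x"] x by auto
  have "\<bar>sgn x \<bullet> v\<bar> \<le> norm (sgn x) * norm v" by (rule Cauchy_Schwarz_ineq2)
  also have "\<dots> \<le> norm v" by (cases "x = 0") (auto simp: norm_sgn)
  finally have w: "\<bar>sgn x \<bullet> v\<bar> \<le> norm v" .
  then have w2: "(sgn x \<bullet> v)^2 \<le> (norm v)^2" by (metis abs_norm_cancel abs_le_square_iff)
  have 1: "(sgn x \<bullet> v)^2 * (1 - (norm x)^2) \<le> (norm v)^2 * (1 - (norm x)^2)"
    using w2 s by (intro mult_right_mono) auto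
  have 2: "(norm x)^2 * (sgn x \<bullet> v)^2 \<le> (norm x)^2 * (norm v)^2"
    using w2 by (intro mult_left_mono) auto
  show "\<bar>sgn x \<bullet> v\<bar> \<le> sqrt A"
    using 1 by (intro real_le_rsqrt) (simp add: A_def algebra_simps)
  show "sqrt A \<le> norm v"
    using 2 by (intro real_le_lsqrt) (simp_all add: A_def algebra_simps)
  show "sqrt (1 - (norm x)^2) * norm v \<le> sqrt A"
    using s by (intro real_le_rsqrt) (simp add: A_def power_mult_distrib)
qed

text \<open>The first bound drops the tangential part of the vector; it drives the calibration and
  the upper estimate of the dual norm. The next two compare with the Euclidean norm and keep suprema
  and integrands finite.\<close>

lemma Feps_lower:
  fixes x v :: "'a::euclidean_space"
  assumes x: "norm x < 1"
  shows "Feps lam kap eps x v \<ge> (\<bar>sgn x \<bullet> v\<bar> - drift (norm x) * (sgn x \<bullet> v)) / (k * a * (1 - (norm x)^2))"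
    and "Feps lam kap eps x v \<ge> a * sqrt (1 - (norm x)^2) * norm v / (k * a * (1 - (norm x)^2))"
    and "Feps lam kap eps x v \<le> 2 * norm v / (k * a * (1 - (norm x)^2))"
    and "Feps lam kap eps x v \<ge> 0"
proof -
  note w = Feps_nonneg_aux[OF x, of v]
  have d: "0 \<le> drift (norm x)" "drift (norm x) \<le> th" using drift_bounds[of "norm x"] x by auto
  have p: "k * a * (1 - (norm x)^2) > 0" using k a sq_less_1[of "norm x"] x by auto
  let ?A = "(norm v)^2 * (1 - (norm x)^2) + (norm x)^2 * (sgn x \<bullet> v)^2"
  show "Feps lam kap eps x v \<ge> (\<bar>sgn x \<bullet> v\<bar> - drift (norm x) * (sgn x \<bullet> v)) / (k * a * (1 - (norm x)^2))"
    unfolding Feps_sgn[OF x] using p w by (intro divide_right_mono) auto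
  have dw: "drift (norm x) * \<bar>sgn x \<bullet> v\<bar> \<le> th * sqrt ?A"
    using d w th by (intro mult_mono) auto
  then have dw2: "drift (norm x) * (sgn x \<bullet> v) \<le> th * sqrt ?A" "- drift (norm x) * (sgn x \<bullet> v) \<le> th * sqrt ?A"
    using d by (auto intro: order_trans[rotated] simp: mult_left_mono abs_if split: if_splits)
      (meson dw mult_left_mono abs_ge_self abs_ge_minus_self order_trans)+
  have "a * sqrt ?A = sqrt ?A - th * sqrt ?A" by (simp add: a_def algebra_simps)
  then have "a * sqrt ?A \<le> sqrt ?A - drift (norm x) * (sgn x \<bullet> v)" using dw2 by linarith
  moreover have "a * (sqrt (1 - (norm x)^2) * norm v) \<le> a * sqrt ?A"
    using w a by (intro mult_left_mono) auto
  ultimately show 2: "Feps lam kap eps x v \<ge> a * sqrt (1 - (norm x)^2) * norm v / (k * a * (1 - (norm x)^2))"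
    unfolding Feps_sgn[OF x] using p by (intro divide_right_mono) (auto simp: mult.assoc)
  have "0 \<le> sqrt ?A" using w(1) by linarith
  then have "th * sqrt ?A \<le> 1 * sqrt ?A" using th by (intro mult_right_mono) auto
  then show "Feps lam kap eps x v \<le> 2 * norm v / (k * a * (1 - (norm x)^2))"
    unfolding Feps_sgn[OF x] using p dw2 w by (intro divide_right_mono) auto
  have "0 \<le> a * sqrt (1 - (norm x)^2) * norm v / (k * a * (1 - (norm x)^2))"
    using p a sq_less_1[of "norm x"] x by (intro divide_nonneg_pos mult_nonneg_nonneg) auto
  then show "Feps lam kap eps x v \<ge> 0" using 2 by linarith
qed

lemma one_minus_drift: assumes "0 \<le> t" "t < 1"
  shows "(1 - drift t) / (k * a * (1 - t^2)) = 1 / (k * yy t * (1 - t^2))"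
  using yy_bounds[OF assms] a by (simp add: drift_def)

lemma Feps_measurable: "(\<lambda>(x, v). Feps lam kap eps x v) \<in> borel_measurable (borel :: ('a::euclidean_space \<times> 'a) measure)"
proof -
  have "(\<lambda>(x::'a, v). Feps lam kap eps x v) \<in> borel_measurable (borel \<Otimes>\<^sub>M borel)"
    unfolding Feps_def Let_def artanh_def split_beta by measurable
  then show ?thesis by (simp only: borel_prod)
qed

lemma rho0_mono: assumes "0 \<le> s" "s \<le> t" "t < 1" shows "rho0 s \<le> rho0 t"
proof (rule DERIV_nonneg_on_imp_le[OF assms(2)])
  fix x assume x: "s \<le> x" "x \<le> t"
  then have x': "0 \<le> x" "x < 1" using assms by auto
  show "(rho0 has_real_derivative 1 / (k * yy x * (1 - x^2))) (at x)" by (rule rho0_deriv[OF x'])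
  show "0 \<le> 1 / (k * yy x * (1 - x^2))"
    using k yy_bounds[OF x'] sq_less_1[OF x'] by (intro divide_nonneg_nonneg mult_nonneg_nonneg) auto
qed

lemma rho0_lipschitz:
  assumes c: "0 \<le> c" "c < 1"
  shows "(1 / (k * a * (1 - c^2)))-lipschitz_on {0..c} rho0"
proof (rule bounded_derivative_imp_lipschitz)
  show "(rho0 has_derivative (\<lambda>h. 1 / (k * yy x * (1 - x^2)) * h)) (at x within {0..c})" if "x \<in> {0..c}" for x
  proof -
    have "0 \<le> x" "x < 1" using that c by auto
    from has_field_derivative_at_within[OF rho0_deriv[OF this]] show ?thesis
      unfolding has_field_derivative_def .
  qed
  have cc: "1 - c^2 > 0" using sq_less_1 c by auto
  show "onorm (\<lambda>h. 1 / (k * yy x * (1 - x^2)) * h) \<le> 1 / (k * a * (1 - c^2))" if "x \<in> {0..c}" for x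
  proof (rule onorm_bound)
    have x: "0 \<le> x" "x < 1" using that c by auto
    have "1 - c^2 \<le> 1 - x^2" using that by (simp add: power_mono)
    then have "k * a * (1 - c^2) \<le> k * yy x * (1 - x^2)"
      using k a yy_bounds[OF x] cc by (intro mult_mono) auto
    then have le: "1 / (k * yy x * (1 - x^2)) \<le> 1 / (k * a * (1 - c^2))"
      using k a cc by (intro divide_left_mono mult_pos_pos) (auto simp: yy_bounds[OF x] sq_less_1[OF x])
    have "0 \<le> 1 / (k * yy x * (1 - x^2))"
      using k yy_bounds[OF x] sq_less_1[OF x] by (intro divide_nonneg_nonneg mult_nonneg_nonneg) auto
    then show "norm (1 / (k * yy x * (1 - x^2)) * h) \<le> 1 / (k * a * (1 - c^2)) * norm h" for h
      unfolding norm_mult using le by (intro mult_right_mono) auto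
  qed (use k a cc in auto)
  show "0 \<le> 1 / (k * a * (1 - c^2))" using k a cc by auto
qed auto

text \<open>\<open>rho0\<close> of the norm is a calibration: away from the origin, the first bound
  of \<open>Feps_lower\<close> says that its derivative along a vector is at most the
  \<open>Feps\<close>-length of that vector.\<close>

lemma rho0_le_flength:
  fixes x :: "'a::euclidean_space"
  assumes g: "\<gamma> \<in> lip_curves 0 x"
  shows "rho0 (norm x) \<le> flength (Feps lam kap eps) \<gamma>"
proof -
  obtain L where L: "L-lipschitz_on {0..1} \<gamma>" using g by (auto simp: lip_curves_def)
  have \<gamma>1: "norm (\<gamma> t) < 1" if "t \<in> {0..1}" for t
  proof -
    have "\<gamma> t \<in> ball 0 1" using g that unfolding lip_curves_def by blast
    then show ?thesis by simp
  qed
  have e: "\<gamma> 0 = 0" "\<gamma> 1 = x" using g by (auto simp: lip_curves_def)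
  have cont: "continuous_on {0..1} (\<lambda>t. norm (\<gamma> t))"
    using lipschitz_on_continuous_on[OF L] by (intro continuous_intros)
  \<comment> \<open>The derivative of \<open>rho0\<close> blows up at 1, but the curve attains a
    largest radius \<open>c < 1\<close>, up to which \<open>rho0\<close> is Lipschitz.\<close>
  obtain t0 where t0: "t0 \<in> {0..1}" "\<And>t. t \<in> {0..1} \<Longrightarrow> norm (\<gamma> t) \<le> norm (\<gamma> t0)"
    using continuous_attains_sup[OF _ _ cont] by auto
  define c where "c = norm (\<gamma> t0)"
  have c: "0 \<le> c" "c < 1" using \<gamma>1[OF t0(1)] by (auto simp: c_def)
  have cc: "1 - c^2 > 0" using sq_less_1[OF c] by auto
  have cb: "norm (\<gamma> t) \<in> {0..c}" if "t \<in> {0..1}" for t using t0(2)[OF that] by (simp add: c_def)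
  define R where "R t = rho0 (norm (\<gamma> t))" for t
  have nL: "L-lipschitz_on {0..1} (\<lambda>t. norm (\<gamma> t))"
  proof (rule lipschitz_onI)
    fix s t :: real assume st: "s \<in> {0..1}" "t \<in> {0..1}"
    have "dist (norm (\<gamma> s)) (norm (\<gamma> t)) \<le> dist (\<gamma> s) (\<gamma> t)"
      by (simp add: dist_norm norm_triangle_ineq3)
    then show "dist (norm (\<gamma> s)) (norm (\<gamma> t)) \<le> L * dist s t" using lipschitz_onD[OF L st] by linarith
  qed (rule lipschitz_on_nonneg[OF L])
  have RL: "(1 / (k * a * (1 - c^2)) * L)-lipschitz_on {0..1} R"
    unfolding R_def
    by (rule lipschitz_on_compose2[OF nL lipschitz_on_subset[OF rho0_lipschitz[OF c]]])
      (use cb in auto)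
  have "R 1 - R 0 \<le> integral {0..1} (\<lambda>t. Feps lam kap eps (\<gamma> t) (vector_derivative \<gamma> (at t within {0..1})))"
  proof (rule lipschitz_increment_le_integral[OF L RL Feps_measurable, where B="2 / (k * a * (1 - c^2))"])
    fix t :: real and v assume t: "t \<in> {0..1}"
    show "0 \<le> Feps lam kap eps (\<gamma> t) v" by (rule Feps_lower(4)[OF \<gamma>1[OF t]])
    have "(norm (\<gamma> t))^2 \<le> c^2" using cb[OF t] by (intro power_mono) auto
    have "Feps lam kap eps (\<gamma> t) v \<le> 2 * norm v / (k * a * (1 - (norm (\<gamma> t))^2))"
      by (rule Feps_lower(3)[OF \<gamma>1[OF t]])
    also have "\<dots> \<le> 2 * norm v / (k * a * (1 - c^2))"
      using \<open>(norm (\<gamma> t))^2 \<le> c^2\<close> k a cc by (intro divide_left_mono mult_left_mono mult_pos_pos) auto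
    finally show "Feps lam kap eps (\<gamma> t) v \<le> 2 / (k * a * (1 - c^2)) * norm v" by simp
  next
    show "0 \<le> 2 / (k * a * (1 - c^2))" using k a cc by auto
  next
    fix t v d
    assume t: "t \<in> {0<..<1}" and v: "(\<gamma> has_vector_derivative v) (at t)" and d: "(R has_real_derivative d) (at t)"
    then have t': "t \<in> {0..1}" by auto
    show "d \<le> Feps lam kap eps (\<gamma> t) v"
    proof (cases "\<gamma> t = 0")
      case True
      \<comment> \<open>The norm is not differentiable at the origin. There \<open>R\<close> has a
        local minimum, so its derivative, if it exists, is 0.\<close>
      have "d = 0"
      proof (rule DERIV_local_min[OF d])
        show "0 < min t (1 - t)" using t by auto
        show "\<forall>y. \<bar>t - y\<bar> < min t (1 - t) \<longrightarrow> R t \<le> R y"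
        proof (intro allI impI)
          fix y assume "\<bar>t - y\<bar> < min t (1 - t)"
          then have "y \<in> {0..1}" by auto
          then show "R t \<le> R y" using rho0_mono[of 0 "norm (\<gamma> y)"] \<gamma>1[of y] True by (simp add: R_def)
        qed
      qed
      then show ?thesis using Feps_lower(4)[OF \<gamma>1[OF t']] by simp
    next
      case False
      have n: "0 \<le> norm (\<gamma> t)" "norm (\<gamma> t) < 1" using \<gamma>1[OF t'] by auto
      have "((\<lambda>t. norm (\<gamma> t)) has_real_derivative (sgn (\<gamma> t) \<bullet> v)) (at t)"
      proof -
        have "((\<lambda>t. norm (\<gamma> t)) has_derivative (\<lambda>h. (h *\<^sub>R v) \<bullet> sgn (\<gamma> t))) (at t)"
          using diff_chain_at[OF v[unfolded has_vector_derivative_def] has_derivative_norm[OF False]]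
          unfolding o_def .
        moreover have "(\<lambda>h. (h *\<^sub>R v) \<bullet> sgn (\<gamma> t)) = (*) (sgn (\<gamma> t) \<bullet> v)"
          by (rule ext) (simp add: inner_commute)
        ultimately show ?thesis by (simp only: has_field_derivative_def)
      qed
      from DERIV_chain2[OF rho0_deriv[OF n] this]
      have "(R has_real_derivative 1 / (k * yy (norm (\<gamma> t)) * (1 - (norm (\<gamma> t))^2)) * (sgn (\<gamma> t) \<bullet> v)) (at t)"
        unfolding R_def .
      then have "d = (1 - drift (norm (\<gamma> t))) / (k * a * (1 - (norm (\<gamma> t))^2)) * (sgn (\<gamma> t) \<bullet> v)"
        unfolding one_minus_drift[OF n] using DERIV_unique[OF d] by blast
      also have "\<dots> = (sgn (\<gamma> t) \<bullet> v - drift (norm (\<gamma> t)) * (sgn (\<gamma> t) \<bullet> v)) / (k * a * (1 - (norm (\<gamma> t))^2))"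
        by (simp add: algebra_simps)
      also have "\<dots> \<le> (\<bar>sgn (\<gamma> t) \<bullet> v\<bar> - drift (norm (\<gamma> t)) * (sgn (\<gamma> t) \<bullet> v)) / (k * a * (1 - (norm (\<gamma> t))^2))"
        using k a sq_less_1[OF n] by (intro divide_right_mono) auto
      also have "\<dots> \<le> Feps lam kap eps (\<gamma> t) v" by (rule Feps_lower(1)[OF n(2)])
      finally show ?thesis .
    qed
  qed
  then show ?thesis by (simp add: R_def e rho0_0 flength_def)
qed

lemma rho_eq:
  fixes x :: "'a::euclidean_space"
  assumes x: "norm x < 1"
  shows "rho lam kap eps x = rho0 (norm x)"
proof -
  define \<gamma> where "\<gamma> t = t *\<^sub>R x" for t :: real
  have lip: "(norm x)-lipschitz_on {0..1} \<gamma>"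
    by (rule lipschitz_onI) (auto simp: \<gamma>_def dist_norm simp flip: scaleR_diff_left)
  have s: "t * norm x \<in> {0..<1}" if "t \<in> {0..1}" for t
  proof -
    have "t * norm x \<le> 1 * norm x" using that by (intro mult_right_mono) auto
    then show ?thesis using that x by auto
  qed
  have \<gamma>in: "\<gamma> \<in> lip_curves 0 x"
    using lip s by (auto simp: lip_curves_def \<gamma>_def)
  have F: "Feps lam kap eps (\<gamma> t) x = 1 / (k * yy (t * norm x) * (1 - (t * norm x)^2)) * norm x" if t: "t \<in> {0..1}" for t
  proof -
    have t1: "norm (\<gamma> t) = t * norm x" using t by (simp add: \<gamma>_def)
    have n: "0 \<le> t * norm x" "t * norm x < 1" using s[OF t] by auto
    have w: "(t * norm x)^2 * (sgn (\<gamma> t) \<bullet> x)^2 = (t * norm x)^2 * (norm x)^2"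
      "drift (t * norm x) * (sgn (\<gamma> t) \<bullet> x) = drift (t * norm x) * norm x"
    proof -
      \<comment> \<open>At the origin \<open>sgn\<close> yields 0 instead of a unit vector, but the
        coefficients \<open>t * norm x\<close> and \<open>drift 0\<close> vanish there.\<close>
      have "sgn (\<gamma> t) \<bullet> x = norm x \<or> (t * norm x = 0 \<and> (sgn (\<gamma> t) \<bullet> x = 0))"
      proof (cases "t * norm x = 0")
        case True
        then have "\<gamma> t = 0" by (auto simp: \<gamma>_def)
        with True show ?thesis by simp
      next
        case False
        then have "t > 0" "x \<noteq> 0" using t by auto
        then have "sgn (\<gamma> t) = sgn x" by (simp add: \<gamma>_def sgn_scaleR)
        moreover have "sgn x \<bullet> x = norm x"
          using \<open>x \<noteq> 0\<close> by (simp add: sgn_div_norm dot_square_norm power2_eq_square)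
        ultimately show ?thesis by simp
      qed
      moreover have "drift 0 = 0" using drift_eq[of 0] by simp
      ultimately show "(t * norm x)^2 * (sgn (\<gamma> t) \<bullet> x)^2 = (t * norm x)^2 * (norm x)^2"
        "drift (t * norm x) * (sgn (\<gamma> t) \<bullet> x) = drift (t * norm x) * norm x" by auto
    qed
    have "(norm x)^2 * (1 - (t * norm x)^2) + (t * norm x)^2 * (norm x)^2 = (norm x)^2" by (simp add: algebra_simps)
    then have "Feps lam kap eps (\<gamma> t) x = (norm x - drift (t * norm x) * norm x) / (k * a * (1 - (t * norm x)^2))"
      using Feps_sgn[of "\<gamma> t" x] n unfolding t1 w by simp
    also have "\<dots> = (1 - drift (t * norm x)) / (k * a * (1 - (t * norm x)^2)) * norm x" by (simp add: algebra_simps)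
    finally show ?thesis unfolding one_minus_drift[OF n] .
  qed
  have vd: "vector_derivative \<gamma> (at t within {0..1}) = x" if "t \<in> {0..1}" for t
  proof (rule vector_derivative_at_within_ivl)
    show "(\<gamma> has_vector_derivative x) (at t)"
      unfolding \<gamma>_def[abs_def] by (auto intro!: derivative_eq_intros)
  qed (use that in auto)
  have "((\<lambda>t. 1 / (k * yy (t * norm x) * (1 - (t * norm x)^2)) * norm x) has_integral rho0 (1 * norm x) - rho0 (0 * norm x)) {0..1}"
  proof (rule fundamental_theorem_of_calculus)
    fix t :: real assume "t \<in> {0..1}"
    then have n: "0 \<le> t * norm x" "t * norm x < 1" using s by auto
    have "((\<lambda>t. rho0 (t * norm x)) has_real_derivative 1 / (k * yy (t * norm x) * (1 - (t * norm x)^2)) * norm x) (at t)"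
      by (rule DERIV_chain2[where f=rho0 and g="\<lambda>t. t * norm x", OF rho0_deriv[OF n]])
        (auto intro!: derivative_eq_intros)
    then show "((\<lambda>t. rho0 (t * norm x)) has_vector_derivative 1 / (k * yy (t * norm x) * (1 - (t * norm x)^2)) * norm x) (at t within {0..1})"
      by (simp add: has_real_derivative_iff_has_vector_derivative has_vector_derivative_at_within)
  qed simp
  then have "((\<lambda>t. Feps lam kap eps (\<gamma> t) (vector_derivative \<gamma> (at t within {0..1}))) has_integral
      rho0 (1 * norm x) - rho0 (0 * norm x)) {0..1}"
    by (rule has_integral_eq[rotated]) (simp only: F vd)
  then have "flength (Feps lam kap eps) \<gamma> = rho0 (norm x)"
    unfolding flength_def by (intro integral_unique) (simp add: rho0_0)
  moreover have "fdist (Feps lam kap eps) 0 x = flength (Feps lam kap eps) \<gamma>"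
    unfolding fdist_def
  proof (rule cInf_eq_minimum)
    show "flength (Feps lam kap eps) \<gamma> \<in> flength (Feps lam kap eps) ` lip_curves 0 x" using \<gamma>in by blast
    show "flength (Feps lam kap eps) \<gamma> \<le> l" if "l \<in> flength (Feps lam kap eps) ` lip_curves 0 x" for l
      using that rho0_le_flength \<open>flength (Feps lam kap eps) \<gamma> = rho0 (norm x)\<close> by auto
  qed
  ultimately show ?thesis by (simp add: rho_def)
qed

lemma sigmaF_eq:
  fixes x :: "'a::euclidean_space"
  assumes x: "norm x < 1"
  shows "sigmaF (Feps lam kap eps) x = (1 - (drift (norm x))^2) powr ((real DIM('a) + 1) / 2)
    * (1 - (norm x)^2) powr (- (real DIM('a) + 1) / 2) / (k * a) ^ DIM('a)"
proof -
  define s where "s = norm x"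
  have s: "0 \<le> s" "s < 1" using x by (auto simp: s_def)
  note s2 = sq_less_1[OF s]
  define \<beta> where "\<beta> = drift s"
  have \<beta>: "\<bar>\<beta>\<bar> < 1" using drift_bounds[OF s] th by (simp add: \<beta>_def)
  define X where "X = 1 - \<beta>^2"
  have X: "X > 0" using one_minus_drift_sq(2)[OF s] by (simp add: X_def \<beta>_def)
  obtain b :: 'a where b: "b \<in> Basis" using nonempty_Basis by blast
  \<comment> \<open>At the centre any unit vector will do, since \<open>s\<close> and
    \<open>drift s\<close> are 0.\<close>
  define e where "e = (if x = 0 then b else sgn x)"
  have e: "norm e = 1" using b by (simp add: e_def norm_sgn)
  define R where "R = k * a * (1 - s^2)"
  have R: "R > 0" using k a s2 by (simp add: R_def)
  have d0: "drift 0 = 0" using drift_eq[of 0] by simp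
  have "{y. Feps lam kap eps x y < 1} = {y. sqrt ((norm y)^2 * (1 - s^2) + s^2 * (e \<bullet> y)^2) - \<beta> * (e \<bullet> y) < R}"
  proof -
    have "Feps lam kap eps x y = (sqrt ((norm y)^2 * (1 - s^2) + s^2 * (e \<bullet> y)^2) - \<beta> * (e \<bullet> y)) / R" for y
      unfolding Feps_sgn[OF x] by (auto simp: s_def e_def \<beta>_def R_def d0)
    then show ?thesis using R by (simp add: divide_less_eq)
  qed
  then have m: "measure lebesgue {y. Feps lam kap eps x y < 1} = R ^ DIM('a) * X powr (- (real DIM('a) + 1) / 2)
      * (1 - s^2) powr (- (real DIM('a) - 1) / 2) * measure lebesgue (ball (0::'a) 1)"
    using measure_randers_ball[OF e s \<beta> R] by (simp add: X_def)
  have bp: "measure lebesgue (ball (0::'a) 1) > 0" using content_ball_pos[of 1 "0::'a"] by (simp add: measure_completion)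
  have "sigmaF (Feps lam kap eps) x = 1 / (R ^ DIM('a) * X powr (- (real DIM('a) + 1) / 2) * (1 - s^2) powr (- (real DIM('a) - 1) / 2))"
    unfolding sigmaF_def m using bp by simp
  also have "\<dots> = X powr ((real DIM('a) + 1) / 2) * ((1 - s^2) powr ((real DIM('a) - 1) / 2) / (1 - s^2) ^ DIM('a)) / (k * a) ^ DIM('a)"
  proof -
    have "X powr (- (real DIM('a) + 1) / 2) = 1 / X powr ((real DIM('a) + 1) / 2)"
      by (simp only: powr_minus_divide[symmetric] minus_divide_left)
    moreover have "(1 - s^2) powr (- (real DIM('a) - 1) / 2) = 1 / (1 - s^2) powr ((real DIM('a) - 1) / 2)"
      by (simp only: powr_minus_divide[symmetric] minus_divide_left)
    ultimately show ?thesis by (simp add: R_def power_mult_distrib)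
  qed
  also have "(1 - s^2) powr ((real DIM('a) - 1) / 2) / (1 - s^2) ^ DIM('a) = (1 - s^2) powr (- (real DIM('a) + 1) / 2)"
  proof -
    have "(real DIM('a) - 1) / 2 - real DIM('a) = - (real DIM('a) + 1) / 2" by (simp add: field_simps)
    then show ?thesis using powr_diff[of "1 - s^2" "(real DIM('a) - 1) / 2" "real DIM('a)"] powr_realpow[OF s2(2), of "DIM('a)"]
      by (simp only:)
  qed
  finally show ?thesis by (simp add: X_def \<beta>_def s_def)
qed

lemma density_eq:
  fixes x :: "'a::euclidean_space"
  assumes x: "norm x < 1"
  shows "exp (- (real DIM('a) - 1) * h * rho lam kap eps x) * sigmaF (Feps lam kap eps) x
    = wt (DIM('a)) h (norm x) / (k * a) ^ DIM('a)"
  unfolding sigmaF_eq[OF x] rho_eq[OF x] wt_def by simp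

end

subsection \<open>The Hardy inequality\<close>

lemma nn_integral_scaleR:
  fixes f :: "'a::euclidean_space \<Rightarrow> ennreal"
  assumes [measurable]: "f \<in> borel_measurable borel" and c: "c > 0"
  shows "(\<integral>\<^sup>+x. f x \<partial>lborel) = ennreal (c ^ DIM('a)) * (\<integral>\<^sup>+x. f (c *\<^sub>R x) \<partial>lborel)"
proof -
  have "(\<integral>\<^sup>+x. f x \<partial>lborel) = (\<integral>\<^sup>+x. f x \<partial>(density (distr lborel borel (\<lambda>x::'a. 0 + c *\<^sub>R x)) (\<lambda>_. ennreal (\<bar>c\<bar> ^ DIM('a)))))"
    using lborel_affine[of c "0::'a"] c by simp
  also have "\<dots> = ennreal (c ^ DIM('a)) * (\<integral>\<^sup>+x. f x \<partial>distr lborel borel (\<lambda>x::'a. 0 + c *\<^sub>R x))"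
    using c by (subst nn_integral_density) (auto simp: nn_integral_cmult)
  also have "(\<integral>\<^sup>+x. f x \<partial>distr lborel borel (\<lambda>x::'a. 0 + c *\<^sub>R x)) = (\<integral>\<^sup>+x. f (c *\<^sub>R x) \<partial>lborel)"
    by (subst nn_integral_distr) auto
  finally show ?thesis .
qed

lemma nn_integral_inverse_interval:
  fixes a b :: real
  assumes "0 < a" "a \<le> b"
  shows "(\<integral>\<^sup>+s. ennreal (1 / s) * indicator {a..b} s \<partial>lborel) = ennreal (ln b - ln a)"
proof -
  have "((\<lambda>s. 1 / s) has_integral (ln b - ln a)) {a..b}"
    using assms by (intro fundamental_theorem_of_calculus)
      (auto intro!: derivative_eq_intros simp: has_real_derivative_iff_has_vector_derivative[symmetric])
  from nn_integral_has_integral_lebesgue'[OF _ this] show ?thesis using assms by auto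
qed

text \<open>Integration over rays, without polar coordinates: averaging over the shell \<open>1 \<le> |x| \<le> 2\<close>
  weighs every ray through the origin, and a dilation turns the shell back into the whole space.\<close>

lemma nn_integral_ray_formula:
  fixes f :: "'a::euclidean_space \<Rightarrow> ennreal"
  assumes f[measurable]: "f \<in> borel_measurable borel"
  shows "ennreal (ln 2) * (\<integral>\<^sup>+x. f x \<partial>lborel)
    = (\<integral>\<^sup>+x. indicator {x. 1 \<le> norm x \<and> norm x \<le> 2} x *
        (\<integral>\<^sup>+s. f (s *\<^sub>R x) * ennreal (s ^ (DIM('a) - 1)) * indicator {0<..} s \<partial>lborel) \<partial>lborel)"
proof -
  define A where "A = {x::'a. 1 \<le> norm x \<and> norm x \<le> 2}"
  have A[measurable]: "A \<in> sets borel" unfolding A_def by measurable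
  define n where "n = DIM('a)"
  have n: "n \<ge> 1" by (simp add: n_def Suc_leI)
  \<comment> \<open>Dilation by \<open>s\<close> has Jacobian \<open>s^n\<close>; the power
    \<open>s^(n - 1)\<close> on rays thus leaves the scale-invariant measure
    \<open>ds / s\<close>.\<close>
  have pw: "s ^ (n - 1) = s ^ n * (1 / s)" if "s > 0" for s :: real
    using that n by (cases n) auto
  have scale: "(\<integral>\<^sup>+x. indicator A x * f (s *\<^sub>R x) \<partial>lborel) * ennreal (s ^ (n - 1))
      = (\<integral>\<^sup>+z. indicator A (z /\<^sub>R s) * f z * ennreal (1 / s) \<partial>lborel)" if s: "s > 0" for s
  proof -
    have "(\<integral>\<^sup>+z. indicator A (z /\<^sub>R s) * f z * ennreal (1 / s) \<partial>lborel)
      = ennreal (s ^ n) * (\<integral>\<^sup>+x. indicator A ((s *\<^sub>R x) /\<^sub>R s) * f (s *\<^sub>R x) * ennreal (1 / s) \<partial>lborel)"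
      unfolding n_def by (rule nn_integral_scaleR) (use s in \<open>auto intro!: measurable_If\<close>)
    also have "(\<lambda>x::'a. (s *\<^sub>R x) /\<^sub>R s) = (\<lambda>x. x)" using s by auto
    also have "(\<integral>\<^sup>+x. indicator A x * f (s *\<^sub>R x) * ennreal (1 / s) \<partial>lborel)
      = (\<integral>\<^sup>+x. indicator A x * f (s *\<^sub>R x) \<partial>lborel) * ennreal (1 / s)"
      using s by (subst nn_integral_multc[symmetric]) auto
    also have "ennreal (s ^ n) * ((\<integral>\<^sup>+x. indicator A x * f (s *\<^sub>R x) \<partial>lborel) * ennreal (1 / s))
       = (\<integral>\<^sup>+x. indicator A x * f (s *\<^sub>R x) \<partial>lborel) * ennreal (s ^ (n - 1))"
    proof -
      have "ennreal (s ^ n) * ennreal (1 / s) = ennreal (s ^ (n - 1))"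
        unfolding pw[OF s] using s by (intro ennreal_mult'[symmetric]) auto
      then show ?thesis by (metis mult.assoc mult.commute)
    qed
    finally show ?thesis by simp
  qed
  have "(\<integral>\<^sup>+x. indicator A x * (\<integral>\<^sup>+s. f (s *\<^sub>R x) * ennreal (s ^ (n - 1)) * indicator {0<..} s \<partial>lborel) \<partial>lborel)
    = (\<integral>\<^sup>+x. (\<integral>\<^sup>+s. indicator A x * f (s *\<^sub>R x) * ennreal (s ^ (n - 1)) * indicator {0<..} s \<partial>lborel) \<partial>lborel)"
    by (subst nn_integral_cmult[symmetric]) (auto simp: mult.assoc)
  also have "\<dots> = (\<integral>\<^sup>+s. (\<integral>\<^sup>+x. indicator A x * f (s *\<^sub>R x) * ennreal (s ^ (n - 1)) * indicator {0<..} s \<partial>lborel) \<partial>lborel)"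
    by (rule lborel_pair.Fubini') measurable
  also have "\<dots> = (\<integral>\<^sup>+s. (\<integral>\<^sup>+z. indicator A (z /\<^sub>R s) * f z * ennreal (1 / s) * indicator {0<..} s \<partial>lborel) \<partial>lborel)"
  proof (rule nn_integral_cong)
    fix s :: real
    show "(\<integral>\<^sup>+x. indicator A x * f (s *\<^sub>R x) * ennreal (s ^ (n - 1)) * indicator {0<..} s \<partial>lborel)
      = (\<integral>\<^sup>+z. indicator A (z /\<^sub>R s) * f z * ennreal (1 / s) * indicator {0<..} s \<partial>lborel)"
    proof (cases "s > 0")
      case True
      then show ?thesis using scale[OF True] by (simp add: nn_integral_multc)
    qed simp
  qed
  also have "\<dots> = (\<integral>\<^sup>+z. (\<integral>\<^sup>+s. indicator A (z /\<^sub>R s) * f z * ennreal (1 / s) * indicator {0<..} s \<partial>lborel) \<partial>lborel)"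
    by (rule lborel_pair.Fubini') measurable
  also have "\<dots> = (\<integral>\<^sup>+z. ennreal (ln 2) * f z \<partial>lborel)"
  proof (rule nn_integral_cong_AE)
    have "AE z in lborel. z \<noteq> (0::'a)" by (rule AE_lborel_singleton)
    then show "AE z in lborel. (\<integral>\<^sup>+s. indicator A (z /\<^sub>R s) * f z * ennreal (1 / s) * indicator {0<..} s \<partial>lborel) = ennreal (ln 2) * f z"
    proof eventually_elim
      case (elim z)
      then have z: "norm z > 0" by simp
      have "(\<integral>\<^sup>+s. indicator A (z /\<^sub>R s) * f z * ennreal (1 / s) * indicator {0<..} s \<partial>lborel)
        = (\<integral>\<^sup>+s. f z * (ennreal (1 / s) * indicator {norm z / 2..norm z} s) \<partial>lborel)"
      proof (rule nn_integral_cong)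
        fix s :: real
        \<comment> \<open>A point \<open>z\<close> is reached from the shell for exactly these
          \<open>s\<close>, and the integral of \<open>1 / s\<close> over them is
          \<open>ln 2\<close> whatever \<open>z\<close> is.\<close>
        have "(z /\<^sub>R s \<in> A \<and> s > 0) \<longleftrightarrow> s \<in> {norm z / 2..norm z}"
        proof (cases "s > 0")
          case True
          then show ?thesis by (auto simp: A_def divide_simps)
        next
          case False
          then have "\<not> norm z / 2 \<le> s" using z by linarith
          with False show ?thesis by auto
        qed
        then show "indicator A (z /\<^sub>R s) * f z * ennreal (1 / s) * indicator {0<..} s
          = f z * (ennreal (1 / s) * indicator {norm z / 2..norm z} s)"
          by (auto simp: indicator_def)
      qed
      also have "\<dots> = f z * ennreal (ln (norm z) - ln (norm z / 2))"
        using z by (subst nn_integral_cmult) (auto simp: nn_integral_inverse_interval)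
      also have "ln (norm z) - ln (norm z / 2) = ln 2" using z by (simp add: ln_div)
      finally show ?case by (simp add: mult.commute)
    qed
  qed
  also have "\<dots> = ennreal (ln 2) * (\<integral>\<^sup>+x. f x \<partial>lborel)" by (rule nn_integral_cmult) simp
  finally show ?thesis by (simp add: A_def n_def)
qed

section \<open>The weighted Hardy inequality on an interval\<close>

lemma powr_tangent:
  fixes X Y p :: real
  assumes "p > 1" "X \<ge> 0" "Y \<ge> 0"
  shows "X powr p \<ge> Y powr p + p * Y powr (p - 1) * (X - Y)"
proof (cases "Y = 0")
  case True then show ?thesis using assms by simp
next
  case False
  then have Y: "Y > 0" using assms by simp
  define z where "z = X / Y"
  have z: "z \<ge> 0" using Y assms by (simp add: z_def)
  \<comment> \<open>By homogeneity the claim reduces to Bernoulli's inequality at the ratio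
    \<open>z\<close>, which is Young's inequality for \<open>z powr p\<close> and 1 with weight
    \<open>1 / p\<close>.\<close>
  have "1 + p * (z - 1) \<le> z powr p"
  proof (cases "z = 0")
    case True then show ?thesis using assms by simp
  next
    case False
    then have "z \<le> (1 / p) * z powr p + (1 - 1 / p)"
      using Youngs_inequality_0[of "1 / p" "1 - 1 / p" "z powr p" 1] z assms by (simp add: powr_powr)
    then have "p * z \<le> p * ((1 / p) * z powr p + (1 - 1 / p))" using assms by (intro mult_left_mono) auto
    also have "\<dots> = z powr p + (p - 1)" using assms by (simp add: algebra_simps)
    finally show ?thesis by (simp add: algebra_simps)
  qed
  then have "Y powr p * (1 + p * (z - 1)) \<le> Y powr p * z powr p" by (intro mult_left_mono) auto
  also have "Y powr p * z powr p = X powr p" using Y assms by (simp add: z_def flip: powr_mult)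
  also have "Y powr p * (1 + p * (z - 1)) = Y powr p + p * Y powr (p - 1) * (X - Y)"
    using Y by (simp add: z_def powr_diff field_simps)
  finally show ?thesis by simp
qed

lemma DERIV_abs_powr:
  fixes x p :: real
  assumes "p > 1"
  shows "((\<lambda>x. \<bar>x\<bar> powr p) has_real_derivative p * \<bar>x\<bar> powr (p - 1) * sgn x) (at x)"
proof (cases "x = 0")
  case True
  have "((\<lambda>h. \<bar>h\<bar> powr (p - 1) * sgn h) \<longlongrightarrow> 0) (at 0)"
  proof (rule Lim_null_comparison)
    show "\<forall>\<^sub>F h in at 0. norm (\<bar>h\<bar> powr (p - 1) * sgn h) \<le> \<bar>h\<bar> powr (p - 1)"
      by (intro always_eventually) (auto simp: abs_mult abs_sgn_eq)
    have "((\<lambda>h::real. \<bar>h\<bar> powr (p - 1)) \<longlongrightarrow> \<bar>0\<bar> powr (p - 1)) (at 0)"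
      using assms by (intro tendsto_powr' tendsto_rabs tendsto_ident_at tendsto_const) auto
    then show "((\<lambda>h::real. \<bar>h\<bar> powr (p - 1)) \<longlongrightarrow> 0) (at 0)" by simp
  qed
  moreover have "\<forall>\<^sub>F h in at 0. \<bar>h\<bar> powr (p - 1) * sgn h = (\<bar>0 + h\<bar> powr p - \<bar>0\<bar> powr p) / h"
    unfolding eventually_at_filter
  proof (intro always_eventually allI impI)
    fix h :: real assume h: "h \<noteq> 0"
    then show "\<bar>h\<bar> powr (p - 1) * sgn h = (\<bar>0 + h\<bar> powr p - \<bar>0\<bar> powr p) / h"
      by (simp add: powr_diff sgn_if abs_if)
  qed
  ultimately have "((\<lambda>h. (\<bar>0 + h\<bar> powr p - \<bar>0\<bar> powr p) / h) \<longlongrightarrow> (0::real)) (at 0)"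
    by (rule Lim_transform_eventually)
  then show ?thesis using True by (simp add: DERIV_def)
next
  case False
  have "(abs has_real_derivative sgn x) (at x)"
    using False by (cases "x > 0")
      (auto intro!: has_field_derivative_transform_within_open[of "\<lambda>x. x" 1 x "{0<..}" abs]
        has_field_derivative_transform_within_open[of "\<lambda>x. - x" "-1" x "{..<0}" abs] derivative_eq_intros)
  from DERIV_fun_powr[OF this, of p] False show ?thesis by simp
qed

text \<open>The product \<open>H\<close> of \<open>\<bar>v s\<bar> powr p\<close> and
  \<open>P s * w s\<close> vanishes at both ends, so its derivative integrates to 0. Subtracting
  \<open>c\<close> times that derivative turns the tangent inequality for
  \<open>X = P s * \<bar>v' s\<bar>\<close> at \<open>Y = (m / p) * \<bar>v s\<bar>\<close> into a
  pointwise comparison of the two integrands.\<close>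

lemma hardy_interval:
  fixes v v' w P :: "real \<Rightarrow> real"
  assumes p: "p > 1" and m: "m > 0" and S: "S > 0"
    and v: "\<And>s. s \<in> {0..S} \<Longrightarrow> (v has_real_derivative v' s) (at s)" and vS: "v S = 0"
    and v': "continuous_on {0..S} v'" and w: "continuous_on {0..S} w" and P: "continuous_on {0..S} P"
    and nonneg: "\<And>s. s \<in> {0..S} \<Longrightarrow> 0 \<le> w s" "\<And>s. s \<in> {0..S} \<Longrightarrow> 0 \<le> P s"
    and g0: "P 0 * w 0 = 0"
    and g: "\<And>s. s \<in> {0<..<S} \<Longrightarrow> \<exists>D. ((\<lambda>s. P s * w s) has_real_derivative D) (at s) \<and> m * w s \<le> D"
  shows "(m / p) powr p * integral {0..S} (\<lambda>s. \<bar>v s\<bar> powr p * w s) \<le> integral {0..S} (\<lambda>s. (P s * \<bar>v' s\<bar>) powr p * w s)"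
proof -
  obtain D where D: "\<And>s. s \<in> {0<..<S} \<Longrightarrow> ((\<lambda>s. P s * w s) has_real_derivative D s) (at s)"
    "\<And>s. s \<in> {0<..<S} \<Longrightarrow> m * w s \<le> D s"
    using g by metis
  have vc: "continuous_on {0..S} v"
    using v by (intro DERIV_continuous_on[OF has_field_derivative_at_within]) auto
  \<comment> \<open>The slope of the tangent at \<open>Y\<close> is
    \<open>p * Y powr (p - 1)\<close>, and \<open>Y powr (p - 1)\<close> is \<open>c\<close> times
    \<open>\<bar>v s\<bar> powr (p - 1)\<close>.\<close>
  define c where "c = (m / p) powr (p - 1)"
  have c: "c > 0" using m p by (simp add: c_def)
  define H where "H s = \<bar>v s\<bar> powr p * (P s * w s)" for s
  define H1 where "H1 s = p * \<bar>v s\<bar> powr (p - 1) * sgn (v s) * v' s * (P s * w s) + \<bar>v s\<bar> powr p * D s" for s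
  define H' where "H' s = (if s \<in> {0<..<S} then H1 s else (m / p) powr p * (\<bar>v s\<bar> powr p * w s) / c)" for s
  have Hint: "(H' has_integral (H S - H 0)) {0..S}"
  proof (rule fundamental_theorem_of_calculus_interior)
    show "continuous_on {0..S} H"
      unfolding H_def using p by (intro continuous_intros continuous_on_powr' vc P w) auto
    fix s assume s: "s \<in> {0<..<S}"
    then have s': "s \<in> {0..S}" by auto
    have "(H has_real_derivative (p * \<bar>v s\<bar> powr (p - 1) * sgn (v s) * v' s) * (P s * w s) + D s * \<bar>v s\<bar> powr p) (at s)"
      unfolding H_def
      by (rule DERIV_mult[OF DERIV_chain2[where f="\<lambda>x. \<bar>x\<bar> powr p" and g=v, OF DERIV_abs_powr[OF p] v[OF s']] D(1)[OF s]])
    then show "(H has_vector_derivative H' s) (at s)"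
      using s by (simp add: has_real_derivative_iff_has_vector_derivative[symmetric] H'_def H1_def mult.commute)
  qed (use S in auto)
  have H0: "H S - H 0 = 0" using vS g0 p by (simp add: H_def)
  have i1: "((\<lambda>s. \<bar>v s\<bar> powr p * w s) has_integral integral {0..S} (\<lambda>s. \<bar>v s\<bar> powr p * w s)) {0..S}"
    using p by (intro integrable_integral integrable_continuous_real continuous_intros continuous_on_powr' vc w) auto
  have i2: "((\<lambda>s. (P s * \<bar>v' s\<bar>) powr p * w s) has_integral integral {0..S} (\<lambda>s. (P s * \<bar>v' s\<bar>) powr p * w s)) {0..S}"
    using p nonneg by (intro integrable_integral integrable_continuous_real continuous_intros continuous_on_powr' v' P w) auto
  have "(m / p) powr p * integral {0..S} (\<lambda>s. \<bar>v s\<bar> powr p * w s) - c * 0 \<le> integral {0..S} (\<lambda>s. (P s * \<bar>v' s\<bar>) powr p * w s)"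
  proof (rule has_integral_le[OF has_integral_diff[OF has_integral_mult_right[OF i1] has_integral_mult_right[OF Hint[unfolded H0]]] i2])
    fix s assume s: "s \<in> {0..S}"
    note nn = nonneg[OF s]
    show "(m / p) powr p * (\<bar>v s\<bar> powr p * w s) - c * H' s \<le> (P s * \<bar>v' s\<bar>) powr p * w s"
    proof (cases "s \<in> {0<..<S}")
      case False
      then have "H' s = (m / p) powr p * (\<bar>v s\<bar> powr p * w s) / c" unfolding H'_def by (rule if_not_P)
      then show ?thesis using c nn by simp
    next
      case True
      define V where "V = \<bar>v s\<bar>"
      define X where "X = P s * \<bar>v' s\<bar>"
      define Y where "Y = (m / p) * V"
      have V: "V \<ge> 0" and X: "X \<ge> 0" and Y: "Y \<ge> 0" using nn m p by (auto simp: V_def X_def Y_def)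
      have Yp: "Y powr p = (m / p) powr p * V powr p" "Y powr (p - 1) = c * V powr (p - 1)"
        unfolding Y_def c_def using m p V powr_mult[of "m / p" V] by auto
      have VV: "V powr (p - 1) * V = V powr p"
        using V p by (cases "V = 0") (auto simp: powr_diff)
      have "Y powr p + p * Y powr (p - 1) * (X - Y) \<le> X powr p" by (rule powr_tangent[OF p X Y])
      also have "Y powr p + p * Y powr (p - 1) * (X - Y) = (m / p) powr p * V powr p + p * c * V powr (p - 1) * X - c * m * V powr p"
      proof -
        have "p * Y powr (p - 1) * (X - Y) = p * c * V powr (p - 1) * X - c * m * (V powr (p - 1) * V)"
          unfolding Yp using p by (simp add: Y_def algebra_simps)
        then show ?thesis unfolding VV Yp by simp
      qed
      finally have "((m / p) powr p * V powr p + p * c * V powr (p - 1) * X - c * m * V powr p) * w s \<le> X powr p * w s"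
        using nn by (intro mult_right_mono) auto
      moreover have "c * (- H1 s) \<le> c * (p * V powr (p - 1) * X * w s - V powr p * (m * w s))"
      proof (rule mult_left_mono)
        have "- (sgn (v s) * v' s) \<le> \<bar>v' s\<bar>" by (auto simp: sgn_if)
        then have "p * V powr (p - 1) * (P s * w s) * (- (sgn (v s) * v' s)) \<le> p * V powr (p - 1) * (P s * w s) * \<bar>v' s\<bar>"
          using p nn by (intro mult_left_mono) auto
        moreover have "V powr p * (m * w s) \<le> V powr p * D s"
          using D(2)[OF True] by (intro mult_left_mono) auto
        ultimately show "- H1 s \<le> p * V powr (p - 1) * X * w s - V powr p * (m * w s)"
          by (simp add: H1_def V_def X_def algebra_simps)
      qed (use c in auto)
      ultimately show ?thesis using True unfolding H'_def X_def[symmetric] V_def[symmetric]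
        by (simp add: algebra_simps)
    qed
  qed
  then show ?thesis by simp
qed

section \<open>Continuity and measurability of derivatives\<close>

lemma frechet_derivative_eq_sum_Basis:
  fixes u :: "'a::euclidean_space \<Rightarrow> real"
  assumes "u differentiable (at x)"
  shows "frechet_derivative u (at x) v = (\<Sum>b\<in>Basis. (v \<bullet> b) * frechet_derivative u (at x) b)"
proof -
  have l: "linear (frechet_derivative u (at x))" by (rule linear_frechet_derivative[OF assms])
  have "frechet_derivative u (at x) v = frechet_derivative u (at x) (\<Sum>b\<in>Basis. (v \<bullet> b) *\<^sub>R b)"
    by (simp add: euclidean_representation)
  also have "\<dots> = (\<Sum>b\<in>Basis. (v \<bullet> b) * frechet_derivative u (at x) b)"
    by (simp add: linear_sum[OF l] linear_cmul[OF l])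
  finally show ?thesis .
qed

lemma smooth_differentiable: "smooth u \<Longrightarrow> u differentiable (at x)"
  unfolding smooth_def using iter_dder.simps(1) by metis

lemma smooth_continuous_directional:
  fixes u :: "'a::euclidean_space \<Rightarrow> real"
  assumes "smooth u"
  shows "continuous_on UNIV (\<lambda>x. frechet_derivative u (at x) v)"
proof -
  have "(\<lambda>x. frechet_derivative u (at x) v) differentiable (at x)" for x
  proof -
    have "iter_dder u [v] differentiable (at x)" using assms unfolding smooth_def by blast
    then show ?thesis by simp
  qed
  then show ?thesis
    by (intro continuous_at_imp_continuous_on ballI differentiable_imp_continuous_within) auto
qed

lemma smooth_continuous: "smooth u \<Longrightarrow> continuous_on UNIV u"
  by (intro continuous_at_imp_continuous_on ballI differentiable_imp_continuous_within) (auto simp: smooth_differentiable)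

section \<open>From rays to the ball\<close>

context radial_randers
begin

lemma Feps_sgn_pos:
  fixes x :: "'a::euclidean_space"
  assumes x: "norm x < 1" "x \<noteq> 0"
  shows "Feps lam kap eps x (sgn x) = 1 / coef (norm x)"
    and "Feps lam kap eps x (- sgn x) = (1 + drift (norm x)) / (k * a * (1 - (norm x)^2))"
proof -
  have n: "0 \<le> norm x" "norm x < 1" using x by auto
  have "norm (sgn x) = 1" using x by (simp add: norm_sgn)
  then have "sgn x \<bullet> sgn x = 1" by (simp add: dot_square_norm)
  then show "Feps lam kap eps x (sgn x) = 1 / coef (norm x)"
    unfolding Feps_sgn[OF x(1)] coef_def one_minus_drift[OF n, symmetric] using \<open>norm (sgn x) = 1\<close> by simp
  show "Feps lam kap eps x (- sgn x) = (1 + drift (norm x)) / (k * a * (1 - (norm x)^2))"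
    unfolding Feps_sgn[OF x(1)] using \<open>norm (sgn x) = 1\<close> \<open>sgn x \<bullet> sgn x = 1\<close> by simp
qed

lemma lam_a: "lam * a = 1 + th"
  using lam by (simp add: a_def th_def theta_def field_simps)

text \<open>The real supremum in \<open>dual_norm\<close> is meaningful only for a bounded family;
  boundedness follows because \<open>Feps\<close> dominates a multiple of the Euclidean
  norm.\<close>

lemma bdd_above_dual:
  fixes x :: "'a::euclidean_space"
  assumes x: "norm x < 1" and l: "linear \<xi>"
  shows "bdd_above ((\<lambda>y. \<xi> y / Feps lam kap eps x y) ` (- {0}))"
proof -
  obtain B where B: "\<And>y. norm (\<xi> y) \<le> B * norm y" using linear_bounded[OF l] by (auto simp: mult.commute)
  define c where "c = a * sqrt (1 - (norm x)^2) / (k * a * (1 - (norm x)^2))"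
  have c: "c > 0" using a k sq_less_1[of "norm x"] x by (simp add: c_def)
  show ?thesis
  proof (rule bdd_aboveI2[where M="B / c"])
    fix y :: 'a assume "y \<in> - {0}"
    then have y: "norm y > 0" by simp
    have F: "c * norm y \<le> Feps lam kap eps x y" using Feps_lower(2)[OF x, of y]
      unfolding c_def times_divide_eq_left .
    have cy: "c * norm y > 0" using c y by simp
    have "\<xi> y / Feps lam kap eps x y \<le> \<bar>\<xi> y\<bar> / Feps lam kap eps x y"
      using F cy by (intro divide_right_mono) auto
    also have "\<dots> \<le> (B * norm y) / (c * norm y)"
      using B[of y] F cy by (intro frac_le) auto
    also have "\<dots> = B / c" using y by simp
    finally show "\<xi> y / Feps lam kap eps x y \<le> B / c" .
  qed
qed

text \<open>A forward vector gives the bound even without \<open>lam\<close>. A backward one gives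
  \<open>k * a * (1 - (norm x)^2) / (1 + drift)\<close>, which \<open>lam\<close> lifts to
  \<open>k * (1 - (norm x)^2) * (1 + th) / (1 + drift)\<close>; this is at least \<open>coef\<close>
  because \<open>drift \<le> th\<close> and \<open>yy \<le> 1\<close>.\<close>

lemma dual_norm_ge:
  fixes x :: "'a::euclidean_space"
  assumes x: "norm x < 1" "x \<noteq> 0" and l: "linear \<xi>"
  shows "coef (norm x) * \<bar>\<xi> (sgn x)\<bar> \<le> lam * dual_norm (Feps lam kap eps) x \<xi>"
proof -
  have n: "0 \<le> norm x" "norm x < 1" using x by auto
  note cp = coef_pos[OF n] and y = yy_bounds[OF n] and d = drift_bounds[OF n] and s = sq_less_1[OF n]
  have sx: "sgn x \<in> - {0}" "- sgn x \<in> - {0}" using x by (auto simp: sgn_zero_iff)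
  have up: "\<xi> v / Feps lam kap eps x v \<le> dual_norm (Feps lam kap eps) x \<xi>" if "v \<in> - {0}" for v
    unfolding dual_norm_def by (rule cSUP_upper[OF that bdd_above_dual[OF x(1) l]])
  show ?thesis
  proof (cases "\<xi> (sgn x) \<ge> 0")
    case True
    have "coef (norm x) * \<xi> (sgn x) \<le> dual_norm (Feps lam kap eps) x \<xi>"
      using up[OF sx(1)] unfolding Feps_sgn_pos[OF x] by (simp add: mult.commute)
    moreover have "1 * (coef (norm x) * \<xi> (sgn x)) \<le> lam * (coef (norm x) * \<xi> (sgn x))"
      using lam True cp by (intro mult_right_mono) auto
    moreover have "lam * (coef (norm x) * \<xi> (sgn x)) \<le> lam * dual_norm (Feps lam kap eps) x \<xi>"
      using calculation(1) lam by (intro mult_left_mono) auto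
    ultimately show ?thesis using True by simp
  next
    case False
    define z where "z = - \<xi> (sgn x)"
    have z: "z > 0" using False by (simp add: z_def)
    have "z * (k * a * (1 - (norm x)^2)) / (1 + drift (norm x)) \<le> dual_norm (Feps lam kap eps) x \<xi>"
      using up[OF sx(2)] unfolding Feps_sgn_pos[OF x] by (simp add: z_def linear_neg[OF l])
    then have "lam * (z * (k * a * (1 - (norm x)^2)) / (1 + drift (norm x))) \<le> lam * dual_norm (Feps lam kap eps) x \<xi>"
      using lam by (intro mult_left_mono) auto
    also have "lam * (z * (k * a * (1 - (norm x)^2)) / (1 + drift (norm x)))
       = z * k * (1 - (norm x)^2) * ((lam * a) / (1 + drift (norm x)))" by simp
    finally have 1: "z * k * (1 - (norm x)^2) * ((1 + th) / (1 + drift (norm x))) \<le> lam * dual_norm (Feps lam kap eps) x \<xi>"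
      unfolding lam_a .
    have "yy (norm x) \<le> (1 + th) / (1 + drift (norm x))"
    proof -
      have "1 \<le> (1 + th) / (1 + drift (norm x))" using d by (simp add: le_divide_eq)
      then show ?thesis using y by linarith
    qed
    then have "z * k * (1 - (norm x)^2) * yy (norm x) \<le> z * k * (1 - (norm x)^2) * ((1 + th) / (1 + drift (norm x)))"
      using z k s by (intro mult_left_mono mult_nonneg_nonneg) auto
    then have "coef (norm x) * z \<le> lam * dual_norm (Feps lam kap eps) x \<xi>"
      using 1 by (simp add: coef_def mult_ac)
    then show ?thesis using False by (simp add: z_def)
  qed
qed

lemma radial_measurable [measurable]: "wt n h \<in> borel_measurable borel" "coef \<in> borel_measurable borel"
  unfolding wt_def[abs_def] coef_def[abs_def] rho0_def drift_def yy_def qq_def artanh_def by measurable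

text \<open>\<open>rho\<close> and \<open>sigmaF\<close> are an infimum and a quotient of measures,
  so measurability of the density is obtained through the explicit formula, which holds on the
  ball.\<close>

lemma meps_eq:
  "(meps lam kap h eps :: 'a::euclidean_space measure) = density (restrict_space lebesgue (ball 0 1))
    (\<lambda>x. ennreal (wt (DIM('a)) h (norm x) / (k * a) ^ DIM('a)))"
  (is "_ = density ?M ?d")
proof -
  have m: "?d \<in> borel_measurable ?M"
    by (intro measurable_restrict_space1 measurable_completion) measurable
  have eq: "ennreal (exp (- (real DIM('a) - 1) * h * rho lam kap eps x) * sigmaF (Feps lam kap eps) x) = ?d x"
    if "x \<in> space ?M" for x
    using that by (intro arg_cong[where f=ennreal] density_eq) (auto simp: space_restrict_space)
  show ?thesis
    unfolding meps_def
  proof (rule density_cong)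
    show "(\<lambda>x. ennreal (exp (- (real DIM('a) - 1) * h * rho lam kap eps x) * sigmaF (Feps lam kap eps) x)) \<in> borel_measurable ?M"
      using m by (subst measurable_cong[OF eq]) auto
    show "AE x in ?M. ennreal (exp (- (real DIM('a) - 1) * h * rho lam kap eps x) * sigmaF (Feps lam kap eps) x) = ?d x"
      by (rule AE_I2) (rule eq)
  qed (rule m)
qed

lemma nn_integral_meps:
  fixes g :: "'a::euclidean_space \<Rightarrow> ennreal"
  assumes g[measurable]: "g \<in> borel_measurable borel"
  shows "(\<integral>\<^sup>+x. g x \<partial>meps lam kap h eps)
    = ennreal (1 / (k * a) ^ DIM('a)) * (\<integral>\<^sup>+x. g x * ennreal (wt (DIM('a)) h (norm x)) * indicator (ball 0 1) x \<partial>lborel)"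
proof -
  let ?M = "restrict_space lebesgue (ball (0::'a) 1)"
  have m: "(\<lambda>x::'a. ennreal (wt (DIM('a)) h (norm x) / (k * a) ^ DIM('a))) \<in> borel_measurable ?M"
    by (intro measurable_restrict_space1 measurable_completion) measurable
  have "(\<integral>\<^sup>+x. g x \<partial>meps lam kap h eps) = (\<integral>\<^sup>+x. ennreal (wt (DIM('a)) h (norm x) / (k * a) ^ DIM('a)) * g x \<partial>?M)"
    unfolding meps_eq
    by (rule nn_integral_density[OF m]) (intro measurable_restrict_space1 measurable_completion, measurable)
  also have "\<dots> = (\<integral>\<^sup>+x. ennreal (wt (DIM('a)) h (norm x) / (k * a) ^ DIM('a)) * g x * indicator (ball 0 1) x \<partial>lebesgue)"
    by (rule nn_integral_restrict_space) simp
  also have "\<dots> = (\<integral>\<^sup>+x. ennreal (wt (DIM('a)) h (norm x) / (k * a) ^ DIM('a)) * g x * indicator (ball 0 1) x \<partial>lborel)"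
    by (rule nn_integral_completion)
  also have "\<dots> = (\<integral>\<^sup>+x. ennreal (1 / (k * a) ^ DIM('a)) * (g x * ennreal (wt (DIM('a)) h (norm x)) * indicator (ball 0 1) x) \<partial>lborel)"
  proof (rule nn_integral_cong)
    fix x :: 'a
    show "ennreal (wt (DIM('a)) h (norm x) / (k * a) ^ DIM('a)) * g x * indicator (ball 0 1) x
      = ennreal (1 / (k * a) ^ DIM('a)) * (g x * ennreal (wt (DIM('a)) h (norm x)) * indicator (ball 0 1) x)"
    proof (cases "x \<in> ball 0 1")
      case True
      have "ennreal (wt (DIM('a)) h (norm x) / (k * a) ^ DIM('a)) = ennreal (1 / (k * a) ^ DIM('a)) * ennreal (wt (DIM('a)) h (norm x))"
        using k a by (subst ennreal_mult'[symmetric]) auto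
      then show ?thesis by (simp only: mult_ac)
    qed simp
  qed
  also have "\<dots> = ennreal (1 / (k * a) ^ DIM('a)) * (\<integral>\<^sup>+x. g x * ennreal (wt (DIM('a)) h (norm x)) * indicator (ball 0 1) x \<partial>lborel)"
  proof (rule nn_integral_cmult)
    have [measurable]: "ball (0::'a) 1 \<in> sets borel" by simp
    show "(\<lambda>x. g x * ennreal (wt (DIM('a)) h (norm x)) * indicator (ball 0 1) x) \<in> borel_measurable lborel"
      by measurable
  qed
  finally show ?thesis .
qed

text \<open>The interval inequality is applied on the ray through \<open>x\<close>, up to the
  parameter \<open>S\<close> where \<open>u\<close> has vanished. With \<open>l = norm x\<close>,
  the chain rule turns \<open>coef\<close> into \<open>P\<close>, and \<open>flux_deriv\<close> at
  \<open>s * l\<close> is the growth condition of \<open>hardy_interval\<close>.\<close>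

lemma hardy_ray:
  fixes u :: "'a::euclidean_space \<Rightarrow> real" and x :: 'a
  assumes n2: "DIM('a) \<ge> 2" and p: "p > 1" and h: "0 \<le> h" "h < kap"
    and u: "smooth u" and c: "0 < c" "c < 1" "\<And>z. norm z \<ge> c \<Longrightarrow> u z = 0" and x: "x \<noteq> 0"
  defines "m \<equiv> (real DIM('a) - 1) * (kap - h)"
  shows "ennreal ((m / p) powr p) * (\<integral>\<^sup>+s. ennreal (\<bar>u (s *\<^sub>R x)\<bar> powr p) * ennreal (wt (DIM('a)) h (norm (s *\<^sub>R x)))
      * indicator (ball 0 1) (s *\<^sub>R x) * ennreal (s ^ (DIM('a) - 1)) * indicator {0<..} s \<partial>lborel)
    \<le> (\<integral>\<^sup>+s. ennreal ((coef (norm (s *\<^sub>R x)) * \<bar>frechet_derivative u (at (s *\<^sub>R x)) (sgn (s *\<^sub>R x))\<bar>) powr p)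
      * ennreal (wt (DIM('a)) h (norm (s *\<^sub>R x)))
      * indicator (ball 0 1) (s *\<^sub>R x) * ennreal (s ^ (DIM('a) - 1)) * indicator {0<..} s \<partial>lborel)"
proof -
  define n where "n = DIM('a)"
  have n: "n \<ge> 2" using n2 by (simp add: n_def)
  have m: "m > 0" using n2 h by (simp add: m_def)
  define l where "l = norm x"
  have l: "l > 0" using x by (simp add: l_def)
  define S where "S = c / l"
  have S: "S > 0" "S * l = c" using c l by (auto simp: S_def)
  have sl: "s * l \<in> {0..c}" if "s \<in> {0..S}" for s
  proof -
    have "s * l \<le> S * l" using that l by (intro mult_right_mono) auto
    then show ?thesis using S that l by auto
  qed
  have sl1: "0 \<le> s * l" "s * l < 1" if "s \<in> {0..S}" for s using sl[OF that] c by auto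
  have nsx: "norm (s *\<^sub>R x) = s * l" if "s \<ge> 0" for s using that by (simp add: l_def)
  define v where "v s = u (s *\<^sub>R x)" for s
  define v' where "v' s = frechet_derivative u (at (s *\<^sub>R x)) x" for s
  define w where "w s = wt n h (s * l) * s ^ (n - 1)" for s
  define P where "P s = coef (s * l) / l" for s
  have vd: "(v has_real_derivative v' s) (at s)" for s
  proof -
    have "(u has_derivative frechet_derivative u (at (s *\<^sub>R x))) (at (s *\<^sub>R x))"
      using smooth_differentiable[OF u] frechet_derivative_works by blast
    moreover have "((\<lambda>s. s *\<^sub>R x) has_derivative (\<lambda>h. h *\<^sub>R x)) (at s)"
      by (auto intro!: derivative_eq_intros)
    ultimately have "(v has_derivative (\<lambda>h. frechet_derivative u (at (s *\<^sub>R x)) (h *\<^sub>R x))) (at s)"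
      using diff_chain_at[of "\<lambda>s. s *\<^sub>R x" "\<lambda>h. h *\<^sub>R x" s u "frechet_derivative u (at (s *\<^sub>R x))"]
      unfolding v_def o_def by blast
    moreover have "(\<lambda>h. frechet_derivative u (at (s *\<^sub>R x)) (h *\<^sub>R x)) = (*) (v' s)"
      using linear_cmul[OF linear_frechet_derivative[OF smooth_differentiable[OF u]]]
      by (auto simp: v'_def mult.commute)
    ultimately show ?thesis by (simp only: has_field_derivative_def)
  qed
  have v'c: "continuous_on {0..S} v'"
    unfolding v'_def
    by (rule continuous_on_compose2[OF smooth_continuous_directional[OF u]]) (auto intro!: continuous_intros)
  have wc: "continuous_on {0..S} w"
    unfolding w_def using sl
    by (intro continuous_intros continuous_on_compose2[OF wt_continuous[OF c(2)]]) auto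
  have Pc: "continuous_on {0..S} P"
    unfolding P_def using sl l
    by (intro continuous_intros continuous_on_compose2[OF coef_continuous[OF c(2)]]) auto
  have nn: "0 \<le> w s" "0 \<le> P s" if "s \<in> {0..S}" for s
    using wt_pos[OF sl1[OF that], of n h] coef_pos[OF sl1[OF that]] that l by (auto simp: w_def P_def)
  have PW: "P s * w s = flux n h (s * l) / l ^ n" for s
    using l n by (cases n) (auto simp: P_def w_def flux_def power_mult_distrib)
  have H: "(m / p) powr p * integral {0..S} (\<lambda>s. \<bar>v s\<bar> powr p * w s) \<le> integral {0..S} (\<lambda>s. (P s * \<bar>v' s\<bar>) powr p * w s)"
  proof (rule hardy_interval[OF p m S(1) vd _ v'c wc Pc nn])
    show "v S = 0" using c(3)[of "S *\<^sub>R x"] S by (simp add: v_def l_def)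
    show "P 0 * w 0 = 0" using n by (simp add: w_def)
    fix s assume s: "s \<in> {0<..<S}"
    then have s': "s \<in> {0..S}" by auto
    have t: "0 < s * l" "s * l < 1" using s l sl1[OF s'] by auto
    obtain D where D: "(flux n h has_real_derivative D) (at (s * l))"
      "(real n - 1) * (kap - h) * (wt n h (s * l) * (s * l) ^ (n - 1)) \<le> D"
      using flux_deriv[OF t, of n h] n by auto
    have "((\<lambda>s. flux n h (s * l)) has_real_derivative D * l) (at s)"
      by (rule DERIV_chain2[where f="flux n h" and g="\<lambda>s. s * l", OF D(1)]) (auto intro!: derivative_eq_intros)
    then have "((\<lambda>s. P s * w s) has_real_derivative D * l / l ^ n) (at s)"
      unfolding PW by (rule DERIV_cdivide)
    moreover have "m * w s \<le> D * l / l ^ n"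
    proof -
      have ln: "l ^ n = l * l ^ (n - 1)" using n by (cases n) auto
      have "m * w s * l ^ (n - 1) = (real n - 1) * (kap - h) * (wt n h (s * l) * (s * l) ^ (n - 1))"
        by (simp add: m_def n_def w_def power_mult_distrib)
      then have "m * w s * l ^ (n - 1) \<le> D" using D(2) by simp
      then have "m * w s \<le> D / l ^ (n - 1)" using l by (simp add: le_divide_eq)
      also have "D / l ^ (n - 1) = D * l / l ^ n" using l by (simp add: ln)
      finally show ?thesis .
    qed
    ultimately show "\<exists>D. ((\<lambda>s. P s * w s) has_real_derivative D) (at s) \<and> m * w s \<le> D" by blast
  qed
  have vc: "continuous_on {0..S} v"
    using vd by (intro DERIV_continuous_on[OF has_field_derivative_at_within]) auto
  have i1: "((\<lambda>s. \<bar>v s\<bar> powr p * w s) has_integral integral {0..S} (\<lambda>s. \<bar>v s\<bar> powr p * w s)) {0..S}"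
    using p by (intro integrable_integral integrable_continuous_real continuous_intros continuous_on_powr' vc wc) auto
  have i2: "((\<lambda>s. (P s * \<bar>v' s\<bar>) powr p * w s) has_integral integral {0..S} (\<lambda>s. (P s * \<bar>v' s\<bar>) powr p * w s)) {0..S}"
    using p nn by (intro integrable_integral integrable_continuous_real continuous_intros continuous_on_powr' v'c Pc wc) auto
  \<comment> \<open>As \<open>n \<ge> 2\<close>, the weight vanishes at 0, so the open and the
    closed range of \<open>s\<close> give the same integrand.\<close>
  have w0: "w 0 = 0" using n by (simp add: w_def power_0_left)
  have eq1: "ennreal (\<bar>u (s *\<^sub>R x)\<bar> powr p) * ennreal (wt n h (norm (s *\<^sub>R x)))
      * indicator (ball 0 1) (s *\<^sub>R x) * ennreal (s ^ (n - 1)) * indicator {0<..} s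
      = ennreal (\<bar>v s\<bar> powr p * w s) * indicator {0..S} s" for s
  proof (cases "s \<in> {0<..S}")
    case True
    then have s: "s \<in> {0..S}" "s > 0" by auto
    have "s *\<^sub>R x \<in> ball 0 1" using nsx[of s] s sl1[OF s(1)] by simp
    moreover have "0 \<le> wt n h (s * l)" using wt_pos[OF sl1[OF s(1)]] less_imp_le by blast
    ultimately show ?thesis using s nsx[of s]
      by (simp add: v_def w_def ennreal_mult mult.assoc)
  next
    case False
    show ?thesis
    proof (cases "s = 0")
      case True
      then show ?thesis by (simp add: w0)
    next
      case s0: False
      show ?thesis
      proof (cases "s > S")
        case True
        have "S * l \<le> s * l" using True l by (intro mult_right_mono) auto
        then have "u (s *\<^sub>R x) = 0" using c(3)[of "s *\<^sub>R x"] nsx[of s] True S by simp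
        then show ?thesis using True p by simp
      next
        case F: False
        then have "s < 0" using s0 False by auto
        then show ?thesis by simp
      qed
    qed
  qed
  have le2: "ennreal ((P s * \<bar>v' s\<bar>) powr p * w s) * indicator {0..S} s
    \<le> ennreal ((coef (norm (s *\<^sub>R x)) * \<bar>frechet_derivative u (at (s *\<^sub>R x)) (sgn (s *\<^sub>R x))\<bar>) powr p)
      * ennreal (wt n h (norm (s *\<^sub>R x)))
      * indicator (ball 0 1) (s *\<^sub>R x) * ennreal (s ^ (n - 1)) * indicator {0<..} s" for s
  proof (cases "s \<in> {0<..S}")
    case True
    then have s: "s \<in> {0..S}" "s > 0" by auto
    have b: "s *\<^sub>R x \<in> ball 0 1" using nsx[of s] s sl1[OF s(1)] by simp
    have wt0: "0 \<le> wt n h (s * l)" using wt_pos[OF sl1[OF s(1)]] less_imp_le by blast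
    have "sgn (s *\<^sub>R x) = (1 / l) *\<^sub>R x" using s by (simp add: sgn_scaleR sgn_div_norm l_def divide_inverse)
    then have "frechet_derivative u (at (s *\<^sub>R x)) (sgn (s *\<^sub>R x)) = v' s / l"
      using linear_cmul[OF linear_frechet_derivative[OF smooth_differentiable[OF u]], of "s *\<^sub>R x" "1 / l" x]
      by (simp add: v'_def)
    then have "coef (norm (s *\<^sub>R x)) * \<bar>frechet_derivative u (at (s *\<^sub>R x)) (sgn (s *\<^sub>R x))\<bar> = P s * \<bar>v' s\<bar>"
      using nsx[of s] s l by (simp add: P_def abs_divide)
    then show ?thesis using s nsx[of s] b wt0
      by (simp add: w_def ennreal_mult mult.assoc)
  next
    case False
    then show ?thesis
      using w0 by (cases "s = 0") (auto simp: indicator_def)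
  qed
  have I0: "0 \<le> integral {0..S} (\<lambda>s. \<bar>v s\<bar> powr p * w s)"
    using nn by (intro integral_nonneg has_integral_integrable[OF i1]) auto
  have "ennreal ((m / p) powr p) * (\<integral>\<^sup>+s. ennreal (\<bar>v s\<bar> powr p * w s) * indicator {0..S} s \<partial>lborel)
      = ennreal ((m / p) powr p) * ennreal (integral {0..S} (\<lambda>s. \<bar>v s\<bar> powr p * w s))"
    using nn by (subst nn_integral_has_integral_lebesgue'[OF _ i1]) auto
  also have "\<dots> = ennreal ((m / p) powr p * integral {0..S} (\<lambda>s. \<bar>v s\<bar> powr p * w s))"
    using I0 by (simp add: ennreal_mult)
  also have "\<dots> \<le> ennreal (integral {0..S} (\<lambda>s. (P s * \<bar>v' s\<bar>) powr p * w s))"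
    by (rule ennreal_leI[OF H])
  also have "\<dots> = (\<integral>\<^sup>+s. ennreal ((P s * \<bar>v' s\<bar>) powr p * w s) * indicator {0..S} s \<partial>lborel)"
    using nn by (subst nn_integral_has_integral_lebesgue'[OF _ i2]) auto
  also have "\<dots> \<le> (\<integral>\<^sup>+s. ennreal ((coef (norm (s *\<^sub>R x)) * \<bar>frechet_derivative u (at (s *\<^sub>R x)) (sgn (s *\<^sub>R x))\<bar>) powr p)
      * ennreal (wt n h (norm (s *\<^sub>R x)))
      * indicator (ball 0 1) (s *\<^sub>R x) * ennreal (s ^ (n - 1)) * indicator {0<..} s \<partial>lborel)"
    by (intro nn_integral_mono le2)
  finally show ?thesis unfolding n_def[symmetric] eq1 .
qed

lemma C0inf_ball_vanish:
  fixes u :: "'a::euclidean_space \<Rightarrow> real"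
  assumes "u \<in> C0inf_ball"
  obtains c where "0 < c" "c < 1" "\<And>z. norm z \<ge> c \<Longrightarrow> u z = 0"
proof -
  have K: "compact (tsupport u)" "tsupport u \<subseteq> ball 0 1" using assms by (auto simp: C0inf_ball_def)
  have sub: "{x. u x \<noteq> 0} \<subseteq> tsupport u" unfolding tsupport_def by (rule closure_subset)
  show thesis
  proof (cases "tsupport u = {}")
    case True
    then show thesis using sub by (intro that[of "1/2"]) auto
  next
    case False
    obtain z0 where z0: "z0 \<in> tsupport u" "\<And>z. z \<in> tsupport u \<Longrightarrow> norm z \<le> norm z0"
      using continuous_attains_sup[OF K(1) False, of norm] by (auto intro: continuous_intros)
    have "norm z0 < 1" using z0 K by auto
    show thesis
    proof (rule that[of "(norm z0 + 1) / 2"])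
      show "0 < (norm z0 + 1) / 2" by (simp add: add_nonneg_pos)
      show "(norm z0 + 1) / 2 < 1" using \<open>norm z0 < 1\<close> by simp
      fix z :: 'a assume z: "(norm z0 + 1) / 2 \<le> norm z"
      show "u z = 0"
      proof (rule ccontr)
        assume "u z \<noteq> 0"
        then have "norm z \<le> norm z0" using z0 sub by auto
        then show False using z \<open>norm z0 < 1\<close> by simp
      qed
    qed
  qed
qed

lemma hardy_ball:
  fixes u :: "'a::euclidean_space \<Rightarrow> real"
  assumes n2: "DIM('a) \<ge> 2" and p: "p > 1" and h: "0 \<le> h" "h < kap" and u: "u \<in> C0inf_ball"
  shows "ennreal (((real DIM('a) - 1) * (kap - h) / p) powr p) * hardy_rhs_int lam kap h p eps u \<le> hardy_lhs lam kap h p eps u"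
proof -
  have us: "smooth u" using u by (simp add: C0inf_ball_def)
  obtain c where c: "0 < c" "c < 1" "\<And>z. norm z \<ge> c \<Longrightarrow> u z = 0"
    by (rule C0inf_ball_vanish[OF u], rule that) auto
  define C where "C = ((real DIM('a) - 1) * (kap - h) / p) powr p"
  have um[measurable]: "u \<in> borel_measurable borel"
    using smooth_continuous[OF us] by (rule borel_measurable_continuous_onI)
  have [measurable]: "(\<lambda>x. frechet_derivative u (at x) v) \<in> borel_measurable borel" for v
    using smooth_continuous_directional[OF us] by (rule borel_measurable_continuous_onI)
  have [measurable]: "(\<lambda>x. frechet_derivative u (at x) (sgn x)) \<in> borel_measurable borel"
    by (subst frechet_derivative_eq_sum_Basis[OF smooth_differentiable[OF us]]) measurable
  define f1 where "f1 x = ennreal ((coef (norm x) * \<bar>frechet_derivative u (at x) (sgn x)\<bar>) powr p)" for x :: 'a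
  define f2 where "f2 x = ennreal (\<bar>u x\<bar> powr p)" for x :: 'a
  have f1m[measurable]: "f1 \<in> borel_measurable borel" unfolding f1_def[abs_def] by measurable
  have f2m[measurable]: "f2 \<in> borel_measurable borel" unfolding f2_def[abs_def] by measurable
  define W where "W x = ennreal (wt (DIM('a)) h (norm x))" for x :: 'a
  have Wm[measurable]: "W \<in> borel_measurable borel" unfolding W_def[abs_def] by measurable
  have G1: "(\<lambda>x. f1 x * W x * indicator (ball 0 1) x) \<in> borel_measurable borel"
    by (intro borel_measurable_times_ennreal f1m Wm borel_measurable_indicator) simp
  have G2[measurable]: "(\<lambda>x. f2 x * W x * indicator (ball 0 1) x) \<in> borel_measurable borel"
    by (intro borel_measurable_times_ennreal f2m Wm borel_measurable_indicator) simp
  have G2': "(\<lambda>(x, s). f2 (s *\<^sub>R x) * W (s *\<^sub>R x) * indicator (ball 0 1) (s *\<^sub>R x)) \<in> borel_measurable (borel \<Otimes>\<^sub>M borel)"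
    using measurable_compose[OF _ G2, of "\<lambda>(x, s). s *\<^sub>R x" "borel \<Otimes>\<^sub>M borel"] by (simp add: split_beta')
  have G2''[measurable]: "(\<lambda>x. \<integral>\<^sup>+s. f2 (s *\<^sub>R x) * W (s *\<^sub>R x) * indicator (ball 0 1) (s *\<^sub>R x) * ennreal (s ^ (DIM('a) - 1)) * indicator {0<..} s \<partial>lborel) \<in> borel_measurable borel"
    using G2' by (intro lborel.borel_measurable_nn_integral) (auto simp: split_beta' intro!: borel_measurable_times_ennreal)
  define I1 where "I1 = (\<integral>\<^sup>+x. f1 x * W x * indicator (ball 0 1) x \<partial>lborel)"
  define I2 where "I2 = (\<integral>\<^sup>+x. f2 x * W x * indicator (ball 0 1) x \<partial>lborel)"
  \<comment> \<open>The ray formula puts the factor \<open>ln 2\<close> on both sides; it cancels at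
    the end.\<close>
  have "ennreal (ln 2) * (ennreal C * I2) = ennreal C * (ennreal (ln 2) * I2)" by (simp add: mult.left_commute)
  also have "\<dots> = (\<integral>\<^sup>+x. ennreal C * (indicator {x. 1 \<le> norm x \<and> norm x \<le> 2} x *
        (\<integral>\<^sup>+s. f2 (s *\<^sub>R x) * W (s *\<^sub>R x) * indicator (ball 0 1) (s *\<^sub>R x) * ennreal (s ^ (DIM('a) - 1)) * indicator {0<..} s \<partial>lborel)) \<partial>lborel)"
    unfolding I2_def nn_integral_ray_formula[OF G2] by (rule nn_integral_cmult[symmetric]) measurable
  also have "\<dots> \<le> (\<integral>\<^sup>+x. (indicator {x. 1 \<le> norm x \<and> norm x \<le> 2} x *
        (\<integral>\<^sup>+s. f1 (s *\<^sub>R x) * W (s *\<^sub>R x) * indicator (ball 0 1) (s *\<^sub>R x) * ennreal (s ^ (DIM('a) - 1)) * indicator {0<..} s \<partial>lborel)) \<partial>lborel)"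
  proof (rule nn_integral_mono)
    fix x :: 'a
    show "ennreal C * (indicator {x. 1 \<le> norm x \<and> norm x \<le> 2} x *
        (\<integral>\<^sup>+s. f2 (s *\<^sub>R x) * W (s *\<^sub>R x) * indicator (ball 0 1) (s *\<^sub>R x) * ennreal (s ^ (DIM('a) - 1)) * indicator {0<..} s \<partial>lborel))
      \<le> (indicator {x. 1 \<le> norm x \<and> norm x \<le> 2} x *
        (\<integral>\<^sup>+s. f1 (s *\<^sub>R x) * W (s *\<^sub>R x) * indicator (ball 0 1) (s *\<^sub>R x) * ennreal (s ^ (DIM('a) - 1)) * indicator {0<..} s \<partial>lborel))"
    proof (cases "1 \<le> norm x \<and> norm x \<le> 2")
      case True
      then have "x \<noteq> 0" by auto
      from hardy_ray[OF n2 p h us c this] True show ?thesis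
        unfolding C_def f1_def f2_def W_def by simp
    qed simp
  qed
  also have "\<dots> = ennreal (ln 2) * I1"
    unfolding I1_def nn_integral_ray_formula[OF G1] ..
  finally have "ennreal C * I2 \<le> I1"
    by (subst (asm) ennreal_mult_le_mult_iff) auto
  then have "ennreal (1 / (k * a) ^ DIM('a)) * (ennreal C * I2) \<le> ennreal (1 / (k * a) ^ DIM('a)) * I1"
    by (intro mult_left_mono) auto
  moreover have "(\<integral>\<^sup>+x. f1 x \<partial>meps lam kap h eps) = ennreal (1 / (k * a) ^ DIM('a)) * I1"
    using nn_integral_meps[OF f1m] by (simp add: I1_def W_def)
  moreover have "hardy_rhs_int lam kap h p eps u = ennreal (1 / (k * a) ^ DIM('a)) * I2"
    using nn_integral_meps[OF f2m] by (simp add: I2_def W_def f2_def hardy_rhs_int_def)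
  ultimately have 1: "ennreal C * hardy_rhs_int lam kap h p eps u \<le> (\<integral>\<^sup>+x. f1 x \<partial>meps lam kap h eps)"
    by (simp add: mult.left_commute)
  have pm: "ennreal ((x / lam) powr p) * ennreal (lam powr p) = ennreal (x powr p)" if "x \<ge> 0" for x
    using lam that by (simp add: ennreal_mult[symmetric] powr_mult[symmetric])
  have [measurable]: "f1 \<in> borel_measurable (meps lam kap h eps)"
    unfolding meps_def by (simp add: measurable_restrict_space1 measurable_completion)
  \<comment> \<open>The power of \<open>lam\<close> is extracted while the integrand is still the
    measurable lower bound; the passage to the dual norm then uses monotonicity alone.\<close>
  have "(\<integral>\<^sup>+x. f1 x \<partial>meps lam kap h eps)
     = (\<integral>\<^sup>+x. ennreal (lam powr p) * ennreal ((coef (norm x) * \<bar>frechet_derivative u (at x) (sgn x)\<bar> / lam) powr p) \<partial>meps lam kap h eps)"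
  proof (rule nn_integral_cong)
    fix x :: 'a assume "x \<in> space (meps lam kap h eps)"
    then have "norm x < 1" by (simp add: meps_def space_restrict_space)
    then have "coef (norm x) * \<bar>frechet_derivative u (at x) (sgn x)\<bar> \<ge> 0"
      using coef_pos[of "norm x"] by simp
    from pm[OF this] show "f1 x = ennreal (lam powr p) * ennreal ((coef (norm x) * \<bar>frechet_derivative u (at x) (sgn x)\<bar> / lam) powr p)"
      by (simp add: f1_def mult.commute)
  qed
  also have "\<dots> = ennreal (lam powr p) * (\<integral>\<^sup>+x. ennreal ((coef (norm x) * \<bar>frechet_derivative u (at x) (sgn x)\<bar> / lam) powr p) \<partial>meps lam kap h eps)"
    by (rule nn_integral_cmult) (unfold meps_def measurable_density_eq1, intro measurable_restrict_space1 measurable_completion, measurable)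
  also have "\<dots> \<le> hardy_lhs lam kap h p eps u"
    unfolding hardy_lhs_def
  proof (intro mult_left_mono nn_integral_mono)
    fix x :: 'a assume "x \<in> space (meps lam kap h eps)"
    then have x: "norm x < 1" by (simp add: meps_def space_restrict_space)
    show "ennreal ((coef (norm x) * \<bar>frechet_derivative u (at x) (sgn x)\<bar> / lam) powr p)
      \<le> ennreal (dual_norm (Feps lam kap eps) x (frechet_derivative u (at x)) powr p)"
    proof (cases "x = 0")
      case True
      have "frechet_derivative u (at 0) 0 = 0"
        using linear_0[OF linear_frechet_derivative[OF smooth_differentiable[OF us]]] .
      then show ?thesis using True p by simp
    next
      case False
      have "coef (norm x) * \<bar>frechet_derivative u (at x) (sgn x)\<bar> / lam \<le> dual_norm (Feps lam kap eps) x (frechet_derivative u (at x))"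
        using dual_norm_ge[OF x False linear_frechet_derivative[OF smooth_differentiable[OF us]]] lam
        by (simp add: divide_le_eq mult.commute)
      then show ?thesis using coef_pos[of "norm x"] x lam p
        by (intro ennreal_leI powr_mono2) auto
    qed
  qed simp
  finally show ?thesis using 1 by (simp add: C_def)
qed

end

subsection \<open>Sharpness\<close>

definition bump :: "real \<Rightarrow> real \<Rightarrow> real \<Rightarrow> real" where
  "bump d b w = (if w > 0 then w powr b * exp (- d / w) else 0)"

lemma bump_nonneg: "0 \<le> bump d b w" by (simp add: bump_def)

text \<open>This is the difference quotient at the origin. The exponential beats every power: for
  \<open>h > 0\<close>, \<open>exp (d / h)\<close> is the \<open>N\<close>-th power of
  \<open>exp (d / h / N)\<close>, which is at least \<open>d / h / N\<close>.\<close>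

lemma bump_over_tendsto_0:
  assumes d: "d > 0"
  shows "((\<lambda>h. bump d b h / h) \<longlongrightarrow> 0) (at 0)"
proof -
  \<comment> \<open>Large enough for the exponent \<open>b - 1 + N\<close> to be at least 1.\<close>
  define N where "N = nat \<lceil>3 + \<bar>b\<bar>\<rceil>"
  have N: "real N \<ge> 3 + \<bar>b\<bar>" unfolding N_def by linarith
  have N0: "N > 0" using N by (cases N) auto
  define C where "C = (real N / d) ^ N"
  have C: "C \<ge> 0" using d by (simp add: C_def)
  show ?thesis
  proof (rule Lim_null_comparison)
    have "\<forall>\<^sub>F h in at (0::real). h \<in> {-1<..<1}" by (intro eventually_at_in_open') auto
    then show "\<forall>\<^sub>F h in at 0. norm (bump d b h / h) \<le> C * \<bar>h\<bar>"
    proof eventually_elim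
      case (elim h)
      show ?case
      proof (cases "h > 0")
        case False
        have "0 \<le> C * \<bar>h\<bar>" using C by simp
        with False show ?thesis by (simp only: bump_def if_False) simp
      next
        case True
        have "d / h / N \<le> exp (d / h / N)" using exp_ge_add_one_self[of "d / h / N"] by linarith
        then have "(d / h / N) ^ N \<le> exp (d / h / N) ^ N" using d True by (intro power_mono) auto
        also have "\<dots> = exp (d / h)" using N0 by (simp flip: exp_of_nat_mult)
        finally have "1 / exp (d / h) \<le> 1 / (d / h / N) ^ N"
          using d True N0 by (intro divide_left_mono mult_pos_pos) auto
        also have "\<dots> = C * h ^ N" using d True N0 by (simp add: C_def power_divide power_mult_distrib field_simps)
        finally have e: "exp (- d / h) \<le> C * h ^ N" by (simp add: exp_minus inverse_eq_divide)
        have "bump d b h / h = h powr (b - 1) * exp (- d / h)" using True by (simp add: bump_def powr_diff)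
        also have "\<dots> \<le> h powr (b - 1) * (C * h ^ N)" using e by (intro mult_left_mono) auto
        also have "\<dots> = C * h powr (b - 1 + N)" using True by (simp add: powr_add powr_realpow)
        also have "\<dots> \<le> C * h powr 1"
        proof (rule mult_left_mono[OF _ C])
          show "h powr (b - 1 + N) \<le> h powr 1" using True elim N by (intro powr_mono') auto
        qed
        finally have "bump d b h / h \<le> C * h" using True by simp
        moreover have "bump d b h / h \<ge> 0" using True bump_nonneg by simp
        ultimately show ?thesis using True by simp
      qed
    qed
    have "((\<lambda>h. C * \<bar>h\<bar>) \<longlongrightarrow> C * \<bar>0\<bar>) (at (0::real))" by (intro tendsto_intros)
    then show "((\<lambda>h. C * \<bar>h\<bar>) \<longlongrightarrow> 0) (at (0::real))" by simp
  qed
qed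

lemma bump_deriv:
  assumes d: "d > 0"
  shows "(bump d b has_real_derivative (b * bump d (b - 1) w + d * bump d (b - 2) w)) (at w)"
proof -
  consider "w > 0" | "w < 0" | "w = 0" by linarith
  then show ?thesis
  proof cases
    case 1
    have "((\<lambda>w. w powr b * exp (- d / w)) has_real_derivative (b * bump d (b - 1) w + d * bump d (b - 2) w)) (at w)"
    proof -
      have "((\<lambda>w. w powr b) has_real_derivative b * w powr (b - 1)) (at w)"
        using 1 by (rule has_real_derivative_powr)
      moreover have "((\<lambda>w. exp (- d / w)) has_real_derivative exp (- d / w) * (d / w^2)) (at w)"
        using 1 by (auto intro!: derivative_eq_intros simp: power2_eq_square)
      ultimately have "((\<lambda>w. w powr b * exp (- d / w)) has_real_derivative
         (b * w powr (b - 1)) * exp (- d / w) + (exp (- d / w) * (d / w^2)) * w powr b) (at w)"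
        by (rule DERIV_mult)
      moreover have "w powr (b - 2) = w powr b / w^2"
        using 1 powr_diff[of w b 2] by (simp add: powr_numeral)
      ultimately show ?thesis using 1 by (simp add: bump_def mult_ac)
    qed
    then show ?thesis
      by (rule has_field_derivative_transform_within_open[of _ _ _ "{0<..}"]) (use 1 in \<open>auto simp: bump_def\<close>)
  next
    case 2
    have "((\<lambda>w. 0) has_real_derivative (b * bump d (b - 1) w + d * bump d (b - 2) w)) (at w)"
      using 2 by (simp add: bump_def)
    then show ?thesis
      by (rule has_field_derivative_transform_within_open[of _ _ _ "{..<0}"]) (use 2 in \<open>auto simp: bump_def\<close>)
  next
    case 3
    then show ?thesis
      using bump_over_tendsto_0[OF d, of b] by (simp add: DERIV_def bump_def)
  qed
qed

text \<open>\<open>smooth\<close> speaks of iterated derivatives of all orders. This algebra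
  contains the test functions and is closed under directional derivatives, so an induction on the
  list of directions suffices.\<close>

inductive bump_algebra :: "real \<Rightarrow> ('a::euclidean_space \<Rightarrow> real) \<Rightarrow> bool" for d where
  const: "bump_algebra d (\<lambda>x. c)"
| inner: "bump_algebra d (\<lambda>x. x \<bullet> v)"
| bump: "bump_algebra d (\<lambda>x. bump d b (c - x \<bullet> x))"
| add: "bump_algebra d f \<Longrightarrow> bump_algebra d g \<Longrightarrow> bump_algebra d (\<lambda>x. f x + g x)"
| mult: "bump_algebra d f \<Longrightarrow> bump_algebra d g \<Longrightarrow> bump_algebra d (\<lambda>x. f x * g x)"

lemma bump_radial_derivative:
  fixes x :: "'a::euclidean_space"
  assumes d: "d > 0"
  shows "((\<lambda>x. bump d b (c - x \<bullet> x)) has_derivative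
    (\<lambda>y. (b * bump d (b - 1) (c - x \<bullet> x) + d * bump d (b - 2) (c - x \<bullet> x)) * (-2 * (x \<bullet> y)))) (at x)"
proof -
  have 1: "((\<lambda>x. c - x \<bullet> x) has_derivative (\<lambda>y. -2 * (x \<bullet> y))) (at x)"
    by (auto intro!: derivative_eq_intros simp: inner_commute)
  have 2: "(bump d b has_derivative (*) (b * bump d (b - 1) (c - x \<bullet> x) + d * bump d (b - 2) (c - x \<bullet> x))) (at (c - x \<bullet> x))"
    using bump_deriv[OF d] by (simp only: has_field_derivative_def)
  show ?thesis using diff_chain_at[OF 1 2] by (simp only: o_def)
qed

lemma bump_algebra_derivative:
  fixes f :: "'a::euclidean_space \<Rightarrow> real"
  assumes d: "d > 0" and f: "bump_algebra d f"
  shows "\<exists>f'. (\<forall>x. (f has_derivative f' x) (at x)) \<and> (\<forall>v. bump_algebra d (\<lambda>x. f' x v))"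
  using f
proof induction
  case (const c)
  then show ?case by (intro exI[of _ "\<lambda>x v. 0"]) (auto intro: bump_algebra.intros)
next
  case (inner v)
  then show ?case
    by (intro exI[of _ "\<lambda>x y. y \<bullet> v"]) (auto intro: bump_algebra.intros intro!: derivative_eq_intros)
next
  case (bump b c)
  show ?case
  proof (intro exI conjI allI)
    show "((\<lambda>x. bump d b (c - x \<bullet> x)) has_derivative
      (\<lambda>y. (b * bump d (b - 1) (c - x \<bullet> x) + d * bump d (b - 2) (c - x \<bullet> x)) * (-2 * (x \<bullet> y)))) (at x)" for x :: 'a
      by (rule bump_radial_derivative[OF d])
    show "bump_algebra d (\<lambda>x::'a. (b * bump d (b - 1) (c - x \<bullet> x) + d * bump d (b - 2) (c - x \<bullet> x)) * (-2 * (x \<bullet> v)))" for v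
      by (intro bump_algebra.intros)
  qed
next
  case (add f g)
  then obtain f' g' where f: "\<And>x. (f has_derivative f' x) (at x)" "\<And>v. bump_algebra d (\<lambda>x. f' x v)"
    and g: "\<And>x. (g has_derivative g' x) (at x)" "\<And>v. bump_algebra d (\<lambda>x. g' x v)" by metis
  show ?case
    by (intro exI[of _ "\<lambda>x v. f' x v + g' x v"] conjI allI has_derivative_add f g bump_algebra.intros)
next
  case (mult f g)
  then obtain f' g' where f: "\<And>x. (f has_derivative f' x) (at x)" "\<And>v. bump_algebra d (\<lambda>x. f' x v)"
    and g: "\<And>x. (g has_derivative g' x) (at x)" "\<And>v. bump_algebra d (\<lambda>x. g' x v)" by metis
  show ?case
    by (intro exI[of _ "\<lambda>x v. f x * g' x v + f' x v * g x"] conjI allI has_derivative_mult f g mult.hyps bump_algebra.intros)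
qed

lemma bump_algebra_smooth:
  fixes f :: "'a::euclidean_space \<Rightarrow> real"
  assumes d: "d > 0" and f: "bump_algebra d f"
  shows "smooth f"
proof -
  have "bump_algebra d (iter_dder f vs)" for vs
  proof (induction vs)
    case Nil
    then show ?case using f by simp
  next
    case (Cons v vs)
    obtain f' where f': "\<And>x. (iter_dder f vs has_derivative f' x) (at x)" "\<And>v. bump_algebra d (\<lambda>x. f' x v)"
      using bump_algebra_derivative[OF d Cons.IH] by blast
    have "iter_dder f (v # vs) = (\<lambda>x. f' x v)"
      using frechet_derivative_at[OF f'(1)] by auto
    then show ?case using f'(2) by simp
  qed
  then show ?thesis
    unfolding smooth_def differentiable_def using bump_algebra_derivative[OF d] by blast
qed

lemma bump_radial_in_C0inf_ball:
  assumes d: "0 < d" "d < 1"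
  shows "(\<lambda>x::'a::euclidean_space. bump d b (1 - d - x \<bullet> x)) \<in> C0inf_ball"
proof -
  let ?u = "\<lambda>x::'a. bump d b (1 - d - x \<bullet> x)"
  have "{x. ?u x \<noteq> 0} \<subseteq> cball 0 (sqrt (1 - d))"
  proof
    fix x assume "x \<in> {x. ?u x \<noteq> 0}"
    then have "(norm x)^2 \<le> 1 - d" by (auto simp: bump_def power2_norm_eq_inner split: if_splits)
    then show "x \<in> cball 0 (sqrt (1 - d))" using real_le_rsqrt by simp
  qed
  then have sub: "tsupport ?u \<subseteq> cball 0 (sqrt (1 - d))"
    unfolding tsupport_def by (intro closure_minimal) auto
  have s1: "sqrt (1 - d) < 1" using d by simp
  have "cball 0 (sqrt (1 - d)) \<subseteq> ball (0::'a) 1"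
  proof
    fix x :: 'a assume "x \<in> cball 0 (sqrt (1 - d))"
    then have "norm x \<le> sqrt (1 - d)" by simp
    from le_less_trans[OF this s1] show "x \<in> ball 0 1" by simp
  qed
  moreover have "compact (tsupport ?u)"
    using compact_Int_closed[OF compact_cball, of "tsupport ?u" 0 "sqrt (1 - d)"] sub
    by (simp add: tsupport_def Int_absorb1)
  moreover have "smooth ?u" by (rule bump_algebra_smooth[OF d(1) bump_algebra.bump])
  ultimately show ?thesis using sub by (auto simp: C0inf_ball_def)
qed

text \<open>Bernoulli's inequality shows that the layer has volume of order \<open>N * d\<close>,
  which will cancel a bound of order \<open>1 / d\<close> for the integrand on it.\<close>

lemma annulus_measure_le:
  fixes N d :: real
  assumes "0 \<le> N * d" "N * d \<le> 1"
  shows "emeasure lborel {x::'a::euclidean_space. norm x < 1 \<and> 1 - (norm x)^2 < N * d}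
    \<le> ennreal (measure lborel (ball (0::'a) 1) * (real DIM('a) * (N * d)))"
proof -
  define r where "r = sqrt (1 - N * d)"
  have r: "0 \<le> r" "r \<le> 1" "r^2 = 1 - N * d" using assms by (auto simp: r_def)
  have r2: "1 - N * d \<le> r" using r power_decreasing[of 1 2 r] by simp
  have "1 - real DIM('a) * (N * d) \<le> (1 - N * d) ^ DIM('a)"
    using Bernoulli_inequality[of "- (N * d)" "DIM('a)"] assms by simp
  also have "\<dots> \<le> r ^ DIM('a)" using r2 assms by (intro power_mono) auto
  finally have rn: "1 - r ^ DIM('a) \<le> real DIM('a) * (N * d)" by simp
  have sub: "{x::'a. norm x < 1 \<and> 1 - (norm x)^2 < N * d} \<subseteq> ball 0 1 - ball 0 r"
  proof
    fix x :: 'a assume "x \<in> {x. norm x < 1 \<and> 1 - (norm x)^2 < N * d}"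
    then have "norm x < 1" "r^2 < (norm x)^2" using r by auto
    then show "x \<in> ball 0 1 - ball 0 r" using power2_less_imp_less[of r "norm x"] by auto
  qed
  have "emeasure lborel {x::'a. norm x < 1 \<and> 1 - (norm x)^2 < N * d} \<le> emeasure lborel (ball (0::'a) 1 - ball 0 r)"
    by (rule emeasure_mono[OF sub]) auto
  also have "\<dots> = emeasure lborel (ball (0::'a) 1) - emeasure lborel (ball (0::'a) r)"
    using r emeasure_lborel_ball_finite[of "0::'a" r] by (intro emeasure_Diff) (auto simp: subset_ball)
  also have "\<dots> = ennreal (measure lborel (ball (0::'a) 1) - measure lborel (ball (0::'a) r))"
    using emeasure_lborel_ball_finite[of "0::'a"] by (simp add: emeasure_eq_ennreal_measure ennreal_minus less_top[symmetric])
  also have "measure lborel (ball (0::'a) 1) - measure lborel (ball (0::'a) r) = measure lborel (ball (0::'a) 1) * (1 - r ^ DIM('a))"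
    using content_ball_conv_unit_ball[OF r(1), of "0::'a"] by (simp add: algebra_simps)
  also have "\<dots> \<le> measure lborel (ball (0::'a) 1) * (real DIM('a) * (N * d))"
    using rn by (intro mult_left_mono) auto
  finally show ?thesis by (simp add: ennreal_leI)
qed

text \<open>From dimension 2 on, \<open>r ^ DIM('a) \<le> r^2 = 1 - d\<close>, so the layer fills at
  least the fraction \<open>d\<close> of the ball.\<close>

lemma annulus_measure_ge:
  fixes d :: real
  assumes n2: "DIM('a::euclidean_space) \<ge> 2" and d: "0 < d" "d \<le> 1"
  shows "ennreal (measure lborel (ball (0::'a) 1) * d) \<le> emeasure lborel {x::'a. norm x < 1 \<and> 1 - (norm x)^2 \<le> d}"
proof -
  define r where "r = sqrt (1 - d)"
  have r: "0 \<le> r" "r \<le> 1" "r^2 = 1 - d" using d by (auto simp: r_def)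
  have rn: "d \<le> 1 - r ^ DIM('a)" using power_decreasing[OF n2 r(1,2)] r(3) by simp
  have sub: "ball 0 1 - ball 0 r \<subseteq> {x::'a. norm x < 1 \<and> 1 - (norm x)^2 \<le> d}"
  proof
    fix x :: 'a assume "x \<in> ball 0 1 - ball 0 r"
    then have "norm x < 1" "r \<le> norm x" by auto
    then show "x \<in> {x. norm x < 1 \<and> 1 - (norm x)^2 \<le> d}" using power_mono[of r "norm x" 2] r by auto
  qed
  have "measure lborel (ball (0::'a) 1) * d \<le> measure lborel (ball (0::'a) 1) * (1 - r ^ DIM('a))"
    using rn by (intro mult_left_mono) auto
  also have "\<dots> = measure lborel (ball (0::'a) 1) - measure lborel (ball (0::'a) r)"
    using content_ball_conv_unit_ball[OF r(1), of "0::'a"] by (simp add: algebra_simps)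
  finally have "ennreal (measure lborel (ball (0::'a) 1) * d) \<le> ennreal (measure lborel (ball (0::'a) 1) - measure lborel (ball (0::'a) r))"
    by (rule ennreal_leI)
  also have "\<dots> = emeasure lborel (ball (0::'a) 1) - emeasure lborel (ball (0::'a) r)"
    using emeasure_lborel_ball_finite[of "0::'a"] by (simp add: emeasure_eq_ennreal_measure ennreal_minus less_top[symmetric])
  also have "\<dots> = emeasure lborel (ball (0::'a) 1 - ball 0 r)"
    using r emeasure_lborel_ball_finite[of "0::'a" r] by (intro emeasure_Diff[symmetric]) (auto simp: subset_ball)
  also have "\<dots> \<le> emeasure lborel {x::'a. norm x < 1 \<and> 1 - (norm x)^2 \<le> d}"
  proof (rule emeasure_mono[OF sub])
    have "{x::'a. norm x < 1 \<and> 1 - (norm x)^2 \<le> d} \<in> sets borel" by measurable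
    then show "{x::'a. norm x < 1 \<and> 1 - (norm x)^2 \<le> d} \<in> sets lborel" by simp
  qed
  finally show ?thesis .
qed

text \<open>On the layer \<open>A j\<close> the integrand is at least \<open>j + 1\<close> and the
  volume at least \<open>V / (j + 1)\<close>. So each layer carries mass at least \<open>V\<close>
  although the layers shrink to the empty set, whereas a finite measure is continuous from
  above.\<close>

lemma nn_integral_inverse_boundary_distance:
  assumes n2: "DIM('a::euclidean_space) \<ge> 2"
  shows "(\<integral>\<^sup>+x. ennreal (1 / (1 - (norm x)^2)) * indicator (ball 0 1) x \<partial>(lborel :: 'a measure)) = \<infinity>"
proof (rule ccontr)
  define g where "g x = ennreal (1 / (1 - (norm x)^2)) * indicator (ball 0 1) x" for x :: 'a
  have [measurable]: "ball (0::'a) 1 \<in> sets borel" by simp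
  have gm[measurable]: "g \<in> borel_measurable lborel" unfolding g_def[abs_def] by measurable
  assume "\<not> (\<integral>\<^sup>+x. ennreal (1 / (1 - (norm x)^2)) * indicator (ball 0 1) x \<partial>(lborel :: 'a measure)) = \<infinity>"
  then have fin: "(\<integral>\<^sup>+x. g x \<partial>lborel) \<noteq> \<infinity>" by (simp add: g_def)
  define M where "M = density lborel g"
  define A where "A j = {x::'a. norm x < 1 \<and> 1 - (norm x)^2 \<le> 1 / Suc j}" for j
  have Am: "A j \<in> sets borel" for j unfolding A_def by measurable
  have MA: "emeasure M (A j) = (\<integral>\<^sup>+x. g x * indicator (A j) x \<partial>lborel)" for j
    unfolding M_def using Am by (intro emeasure_density) auto
  have "(\<lambda>j. emeasure M (A j)) \<longlonglongrightarrow> emeasure M (\<Inter>j. A j)"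
  proof (rule Lim_emeasure_decseq)
    show "range A \<subseteq> sets M" using Am by (auto simp: M_def)
    show "decseq A" unfolding decseq_Suc_iff A_def
      by (auto elim!: order_trans intro!: divide_left_mono)
    show "emeasure M (A j) \<noteq> \<infinity>" for j
    proof -
      have "emeasure M (A j) \<le> (\<integral>\<^sup>+x. g x \<partial>lborel)"
        unfolding MA by (intro nn_integral_mono) (auto simp: indicator_def)
      then show ?thesis using fin by (auto simp: top_unique)
    qed
  qed
  moreover have "(\<Inter>j. A j) = {}"
  proof (rule ccontr)
    assume "(\<Inter>j. A j) \<noteq> {}"
    then obtain x where x: "\<And>j. x \<in> A j" by auto
    then have "norm x < 1" by (auto simp: A_def)
    then have "1 - (norm x)^2 > 0" by (simp add: abs_square_less_1)
    then obtain j where "inverse (real (Suc j)) < 1 - (norm x)^2" using reals_Archimedean by blast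
    then show False using x[of j] by (auto simp: A_def inverse_eq_divide)
  qed
  ultimately have lim: "(\<lambda>j. emeasure M (A j)) \<longlonglongrightarrow> 0" by simp
  define V where "V = measure lborel (ball (0::'a) 1)"
  have V: "V > 0" using content_ball_pos[of 1 "0::'a"] by (simp add: V_def)
  have "ennreal V \<le> emeasure M (A j)" for j
  proof -
    have "V = real (Suc j) * (V * (1 / Suc j))" by (simp del: of_nat_Suc)
    moreover have "ennreal (real (Suc j) * (V * (1 / Suc j))) = ennreal (Suc j) * ennreal (V * (1 / Suc j))"
      using V by (intro ennreal_mult') auto
    ultimately have "ennreal V = ennreal (Suc j) * ennreal (V * (1 / Suc j))" by metis
    also have "\<dots> \<le> ennreal (Suc j) * emeasure lborel (A j)"
      unfolding V_def A_def by (intro mult_left_mono annulus_measure_ge[OF n2]) auto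
    also have "\<dots> = (\<integral>\<^sup>+x. ennreal (Suc j) * indicator (A j) x \<partial>lborel)"
      using Am by (simp add: nn_integral_cmult)
    also have "\<dots> \<le> emeasure M (A j)"
      unfolding MA
    proof (rule nn_integral_mono)
      fix x :: 'a
      show "ennreal (Suc j) * indicator (A j) x \<le> g x * indicator (A j) x"
      proof (cases "x \<in> A j")
        case True
        then have x: "norm x < 1" "1 - (norm x)^2 \<le> 1 / Suc j" by (auto simp: A_def)
        then have "1 - (norm x)^2 > 0" by (simp add: abs_square_less_1)
        then have "real (Suc j) \<le> 1 / (1 - (norm x)^2)" using x by (simp add: field_simps)
        then show ?thesis using True x by (simp add: g_def ennreal_leI del: of_nat_Suc)
      qed simp
    qed
    finally show ?thesis .
  qed
  then have "ennreal V \<le> 0" using lim by (intro tendsto_lowerbound[OF lim]) auto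
  then show False using V by simp
qed

section \<open>Behaviour of the weight and the metric at the boundary\<close>

context radial_randers
begin

text \<open>The exponent for which \<open>z powr (p * al)\<close> times the weight behaves like
  \<open>1 / z\<close>, just failing to be integrable. Then
  \<open>2 * k * al = (n - 1) * (k - h) / p\<close> is the base of the boundary constant.\<close>

definition "al n p h = (real n - 1) * (1 - h / k) / (2 * p)"

lemma al_pos: assumes "n \<ge> 2" "p > 1" "0 \<le> h" "h < kap" shows "al n p h > 0"
  using assms k by (simp add: al_def)

lemma rho0_bounds: assumes "0 \<le> t" "t < 1"
  shows "artanh t / k \<le> rho0 t" "rho0 t \<le> artanh t / k + th * eps / (k * a)"
proof -
  have r: "artanh t \<ge> 0" using artanh_ge[OF assms] assms by linarith
  define r where "r = artanh t"
  have r2: "r^2 / (r + eps) = r - eps * (r / (r + eps))" using r eps by (simp add: r_def field_simps power2_eq_square)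
  have "r - th * r^2 / (r + eps) = r - th * (r^2 / (r + eps))" by simp
  also have "\<dots> = a * r + th * eps * (r / (r + eps))" unfolding r2 by (simp add: a_def algebra_simps)
  finally have "r - th * r^2 / (r + eps) = a * r + th * eps * (r / (r + eps))" .
  then have e: "rho0 t = r / k + th * eps / (k * a) * (r / (r + eps))"
    using k a by (simp add: rho0_def r_def add_divide_distrib)
  have f: "0 \<le> r / (r + eps)" "r / (r + eps) \<le> 1" using r eps by (auto simp: r_def)
  have c: "0 \<le> th * eps / (k * a)" using th eps k a by simp
  show "artanh t / k \<le> rho0 t" unfolding e using mult_nonneg_nonneg[OF c f(1)] by (simp add: r_def)
  show "rho0 t \<le> artanh t / k + th * eps / (k * a)" unfolding e using mult_left_mono[OF f(2) c] by (simp add: r_def)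
qed

text \<open>The left side is \<open>((1 - t) / (1 + t)) powr q\<close>, and \<open>1 - t\<close> is
  \<open>(1 - t^2) / (1 + t)\<close>.\<close>

lemma exp_artanh: fixes t q :: real assumes "0 \<le> t" "t < 1"
  shows "exp (- 2 * q * artanh t) = (1 - t^2) powr q * (1 + t) powr (- 2 * q)"
proof -
  have s: "1 - t^2 = (1 - t) * (1 + t)" by (simp add: power2_eq_square algebra_simps)
  have "- 2 * q * artanh t = q * ln (1 - t) - q * ln (1 + t)"
  proof -
    have "0 < 1 + t" "0 < 1 - t" using assms by auto
    then have ar: "artanh t = (ln (1 + t) - ln (1 - t)) / 2" by (simp add: artanh_def ln_div)
    show ?thesis unfolding ar by (simp add: field_simps)
  qed
  also have "\<dots> = q * ln (1 - t^2) + (- 2 * q) * ln (1 + t)"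
  proof -
    have "0 < 1 + t" "0 < 1 - t" using assms by auto
    then have "ln (1 - t^2) = ln (1 - t) + ln (1 + t)" unfolding s by (simp add: ln_mult)
    then show ?thesis by (simp add: algebra_simps)
  qed
  finally show ?thesis using assms sq_less_1[OF assms] by (simp add: powr_def exp_add[symmetric])
qed

text \<open>The distance contributes the exponent \<open>q = (n - 1) * h / (2 * k)\<close>, since
  \<open>rho0\<close> differs from \<open>artanh t / k\<close> by a bounded term, and the volume
  contributes \<open>- (n + 1) / 2\<close>; the sum is \<open>-1 - p * al n p h\<close>. The
  remaining factors lie between a positive constant and 1.\<close>

lemma wt_bounds:
  assumes n: "n \<ge> 2" and p: "p > 1" and h: "0 \<le> h" "h < kap"
  obtains c where "c > 0"
    "\<And>t. 0 \<le> t \<Longrightarrow> t < 1 \<Longrightarrow> wt n h t \<le> (1 - t^2) powr (-1 - p * al n p h)"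
    "\<And>t. 0 \<le> t \<Longrightarrow> t < 1 \<Longrightarrow> c * (1 - t^2) powr (-1 - p * al n p h) \<le> wt n h t"
proof -
  define q where "q = (real n - 1) * h / (2 * k)"
  have q: "q \<ge> 0" using n h k by (simp add: q_def)
  define N where "N = (real n - 1) * h"
  have N: "N \<ge> 0" using n h by (simp add: N_def)
  have ex: "q + - (real n + 1) / 2 = -1 - p * al n p h"
    using p k by (simp add: q_def al_def field_simps)
  define c where "c = 2 powr (- 2 * q) * exp (- N * (th * eps / (k * a))) * (1 - th^2) powr ((real n + 1) / 2)"
  have th2: "1 - th^2 > 0" using th by (simp add: abs_square_less_1)
  show thesis
  proof (rule that[of c])
    show "c > 0" using th2 by (simp add: c_def)
    fix t :: real assume t: "0 \<le> t" "t < 1"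
    note d = one_minus_drift_sq[OF t] and s = sq_less_1[OF t] and r = rho0_bounds[OF t]
    have Nq: "N * (artanh t / k) = 2 * q * artanh t" using k by (simp add: N_def q_def)
    have w: "wt n h t = exp (- N * rho0 t) * (1 - (drift t)^2) powr ((real n + 1) / 2) * (1 - t^2) powr (- (real n + 1) / 2)"
    proof -
      have "- (real n - 1) * h * rho0 t = - N * rho0 t" by (simp add: N_def algebra_simps)
      then show ?thesis by (simp only: wt_def)
    qed
    have "N * (artanh t / k) \<le> N * rho0 t" by (rule mult_left_mono[OF r(1) N])
    then have "exp (- N * rho0 t) \<le> exp (- 2 * q * artanh t)" unfolding Nq by simp
    also have "\<dots> \<le> (1 - t^2) powr q * 1"
      unfolding exp_artanh[OF t] using t q powr_mono[of "-2 * q" 0 "1 + t"] by (intro mult_left_mono) auto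
    finally have e1: "exp (- N * rho0 t) \<le> (1 - t^2) powr q" by simp
    have d1: "(1 - (drift t)^2) powr ((real n + 1) / 2) \<le> 1"
      using powr_mono2[of "(real n + 1) / 2" "1 - (drift t)^2" 1] d(2) by simp
    have "wt n h t \<le> (1 - t^2) powr q * 1 * (1 - t^2) powr (- (real n + 1) / 2)"
      unfolding w using e1 d1 by (intro mult_mono mult_nonneg_nonneg) auto
    then show "wt n h t \<le> (1 - t^2) powr (-1 - p * al n p h)"
      unfolding ex[symmetric] powr_add by simp
    have "N * rho0 t \<le> N * (artanh t / k) + N * (th * eps / (k * a))"
      using mult_left_mono[OF r(2) N] by (simp add: distrib_left)
    then have "exp (- 2 * q * artanh t + - N * (th * eps / (k * a))) \<le> exp (- N * rho0 t)" unfolding Nq by simp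
    then have e2: "(1 - t^2) powr q * (1 + t) powr (- 2 * q) * exp (- N * (th * eps / (k * a))) \<le> exp (- N * rho0 t)"
      unfolding exp_add exp_artanh[OF t] .
    have t2: "2 powr (- 2 * q) \<le> (1 + t) powr (- 2 * q)"
      using t q by (intro powr_mono2') auto
    have d2: "(1 - th^2) powr ((real n + 1) / 2) \<le> (1 - (drift t)^2) powr ((real n + 1) / 2)"
      using th2 d by (intro powr_mono2) auto
    have "(1 - t^2) powr q * 2 powr (- 2 * q) * exp (- N * (th * eps / (k * a))) \<le> exp (- N * rho0 t)"
      by (rule order_trans[OF _ e2]) (intro mult_right_mono mult_left_mono t2; simp)
    then have "((1 - t^2) powr q * 2 powr (- 2 * q) * exp (- N * (th * eps / (k * a)))) * (1 - th^2) powr ((real n + 1) / 2)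
       * (1 - t^2) powr (- (real n + 1) / 2) \<le> wt n h t"
      unfolding w using d2 by (intro mult_mono mult_nonneg_nonneg) auto
    then show "c * (1 - t^2) powr (-1 - p * al n p h) \<le> wt n h t"
      unfolding ex[symmetric] powr_add c_def by (simp add: mult_ac)
  qed
qed

text \<open>This differential is positive only on vectors pointing inward, where the first bound of
  \<open>Feps_lower\<close> charges the factor \<open>1 + drift\<close>. With
  \<open>lam * a = 1 + th\<close>, the backward case of \<open>dual_norm_ge\<close> thus becomes an
  upper bound as well.\<close>

lemma dual_norm_radial_le:
  fixes x :: "'a::euclidean_space"
  assumes x: "norm x < 1" and G: "G \<ge> 0"
  shows "lam * dual_norm (Feps lam kap eps) x (\<lambda>y. - G * (x \<bullet> y))
    \<le> k * ((1 + th) / (1 + drift (norm x))) * (1 - (norm x)^2) * G"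
    and "0 \<le> dual_norm (Feps lam kap eps) x (\<lambda>y. - G * (x \<bullet> y))"
proof -
  have n: "0 \<le> norm x" "norm x < 1" using x by auto
  note d = drift_bounds[OF n] and s = sq_less_1[OF n]
  have ne: "- {0::'a} \<noteq> {}"
  proof -
    obtain b :: 'a where "b \<in> Basis" using nonempty_Basis by blast
    then show ?thesis by (auto dest: nonzero_Basis)
  qed
  have lin: "linear (\<lambda>y. - G * (x \<bullet> y))" by (intro linearI) (auto simp: inner_add algebra_simps)
  define D where "D = k * a * (1 - (norm x)^2)"
  have D: "D > 0" using k a s by (simp add: D_def)
  have "dual_norm (Feps lam kap eps) x (\<lambda>y. - G * (x \<bullet> y)) \<le> G * D / (1 + drift (norm x))"
    unfolding dual_norm_def
  proof (rule cSUP_least[OF ne])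
    fix y :: 'a assume "y \<in> - {0}"
    have xy: "x \<bullet> y = norm x * (sgn x \<bullet> y)" by (cases "x = 0") (auto simp: sgn_div_norm)
    have R: "0 \<le> G * D / (1 + drift (norm x))" using G D d by simp
    show "- G * (x \<bullet> y) / Feps lam kap eps x y \<le> G * D / (1 + drift (norm x))"
    proof (cases "sgn x \<bullet> y \<ge> 0")
      case True
      then have "- G * (x \<bullet> y) \<le> 0" using G xy by (simp add: mult_nonneg_nonneg)
      then have "- G * (x \<bullet> y) / Feps lam kap eps x y \<le> 0"
        using Feps_lower(4)[OF x] by (rule divide_nonpos_nonneg)
      then show ?thesis using R by linarith
    next
      case False
      define W where "W = - (sgn x \<bullet> y)"
      have W: "W > 0" using False by (simp add: W_def)
      have e: "(\<bar>sgn x \<bullet> y\<bar> - drift (norm x) * (sgn x \<bullet> y)) / D = (1 + drift (norm x)) * W / D"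
        using W by (simp add: W_def algebra_simps)
      have F: "(1 + drift (norm x)) * W / D \<le> Feps lam kap eps x y"
        using Feps_lower(1)[OF x, of y] unfolding D_def[symmetric] e .
      have Fp: "(1 + drift (norm x)) * W / D > 0" using d W D by simp
      have "- G * (x \<bullet> y) = G * (norm x * W)" by (simp add: xy W_def)
      also have "\<dots> \<le> G * (1 * W)" using G W n by (intro mult_left_mono mult_right_mono) auto
      finally have "- G * (x \<bullet> y) \<le> G * W" by simp
      then have "- G * (x \<bullet> y) / Feps lam kap eps x y \<le> G * W / ((1 + drift (norm x)) * W / D)"
        using F Fp G W by (intro frac_le) auto
      also have "\<dots> = G * D / (1 + drift (norm x))"
      proof -
        have "G * W / (X * W / D) = G * D / X" if "X > 0" for X using that W D by (simp add: field_simps)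
        from this[of "1 + drift (norm x)"] show ?thesis using d by simp
      qed
      finally show ?thesis .
    qed
  qed
  then have "lam * dual_norm (Feps lam kap eps) x (\<lambda>y. - G * (x \<bullet> y)) \<le> lam * (G * D / (1 + drift (norm x)))"
    using lam by (intro mult_left_mono) auto
  also have "\<dots> = k * ((lam * a) / (1 + drift (norm x))) * (1 - (norm x)^2) * G" by (simp add: D_def)
  finally show "lam * dual_norm (Feps lam kap eps) x (\<lambda>y. - G * (x \<bullet> y))
    \<le> k * ((1 + th) / (1 + drift (norm x))) * (1 - (norm x)^2) * G" unfolding lam_a .
  show "0 \<le> dual_norm (Feps lam kap eps) x (\<lambda>y. - G * (x \<bullet> y))"
  proof (cases "x = 0")
    case True
    obtain b :: 'a where "b \<in> - {0}" using ne by blast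
    from cSUP_upper[OF this bdd_above_dual[OF x lin]] show ?thesis by (simp add: dual_norm_def True)
  next
    case False
    have xm: "- x \<in> - {0}" using False by simp
    have "0 \<le> - G * (x \<bullet> - x) / Feps lam kap eps x (- x)"
      using G Feps_lower(4)[OF x] by (intro divide_nonneg_nonneg) auto
    also have "\<dots> \<le> dual_norm (Feps lam kap eps) x (\<lambda>y. - G * (x \<bullet> y))"
      unfolding dual_norm_def by (rule cSUP_upper[OF xm bdd_above_dual[OF x lin]])
    finally show ?thesis .
  qed
qed

text \<open>\<open>th - drift t\<close> equals \<open>th * eps^2 / (qq t)^2\<close> and vanishes as
  \<open>qq\<close> tends to infinity, so the factor left over from \<open>lam\<close> tends to
  1.\<close>

lemma drift_factor_near_boundary:
  assumes "\<eta> > 0"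
  obtains s0 where "0 \<le> s0" "s0 < 1" "\<And>t. s0 \<le> t \<Longrightarrow> t < 1 \<Longrightarrow> (1 + th) / (1 + drift t) \<le> 1 + \<eta>"
proof -
  \<comment> \<open>Chosen so that \<open>eps^2 / M^2 = \<eta>\<close>.\<close>
  define M where "M = eps / sqrt \<eta>"
  have "eventually (\<lambda>t::real. artanh t \<ge> M) (at_left 1)"
    using artanh_real_at_left_1 by (simp add: filterlim_at_top)
  then obtain b where b: "b < 1" "\<And>t. b < t \<Longrightarrow> t < 1 \<Longrightarrow> artanh t \<ge> M"
    by (auto simp: eventually_at_left_field)
  define s0 where "s0 = max 0 ((b + 1) / 2)"
  show thesis
  proof (rule that[of s0])
    show "0 \<le> s0" "s0 < 1" using b by (auto simp: s0_def)
    fix t assume t: "s0 \<le> t" "t < 1"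
    then have t': "0 \<le> t" "t < 1" "b < t" using b by (auto simp: s0_def)
    note q = qq[OF t'(1,2)] and d = drift_bounds[OF t'(1,2)]
    have "M \<le> qq t" using b(2)[OF t'(3,2)] eps by (simp add: qq_def)
    moreover have "M > 0" using assms eps by (simp add: M_def)
    ultimately have "M^2 \<le> (qq t)^2" by (intro power_mono) auto
    moreover have "M^2 = eps^2 / \<eta>" using assms by (simp add: M_def power_divide)
    ultimately have "eps^2 / (qq t)^2 \<le> \<eta>" using assms q by (simp add: field_simps)
    moreover have "th - drift t = th * (eps^2 / (qq t)^2)"
    proof -
      have "artanh t * (artanh t + 2 * eps) = (qq t)^2 - eps^2" by (simp add: qq_def algebra_simps power2_eq_square)
      then have "drift t = th * (((qq t)^2 - eps^2) / (qq t)^2)" unfolding drift_eq[OF t'(1,2)] by (simp add: qq_def)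
      also have "((qq t)^2 - eps^2) / (qq t)^2 = 1 - eps^2 / (qq t)^2" using q by (simp add: diff_divide_distrib)
      finally show ?thesis by (simp add: algebra_simps)
    qed
    moreover have "th * (eps^2 / (qq t)^2) \<le> 1 * (eps^2 / (qq t)^2)" using th by (intro mult_right_mono) auto
    ultimately have "th - drift t \<le> \<eta>" by linarith
    moreover have "\<eta> * 1 \<le> \<eta> * (1 + drift t)" using assms d by (intro mult_left_mono) auto
    ultimately have "1 + th \<le> (1 + \<eta>) * (1 + drift t)" by (simp add: algebra_simps)
    then show "(1 + th) / (1 + drift t) \<le> 1 + \<eta>" using d by (simp add: divide_le_eq)
  qed
qed

end

text \<open>As \<open>eps\<close> tends to 0, \<open>Keps\<close> tends to 1 and \<open>K0\<close>
  to infinity, so for small \<open>eps\<close> only \<open>kap\<close> and the term with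
  \<open>Keps\<close> compete in the maximum.\<close>

lemma keps_tendsto:
  assumes lam: "lam > 1" and kap: "kap > 0"
  shows "((\<lambda>eps. keps lam kap eps) \<longlongrightarrow> kap) (at_right 0)"
proof -
  define th where "th = theta lam"
  have th: "0 < th" "th < 1" using lam by (auto simp: th_def theta_def field_simps)
  define a where "a = 1 - th"
  have a: "0 < a" using th by (simp add: a_def)
  have "((\<lambda>eps. sqrt (3 * a^3 * (3 * a - 8 * eps^2 * th))) \<longlongrightarrow> sqrt (3 * a^3 * (3 * a - 8 * 0^2 * th))) (at_right 0)"
    by (intro tendsto_intros)
  moreover have "3 * a^3 * (3 * a - 8 * 0^2 * th) = (3 * a^2)^2" by (simp add: power2_eq_square power3_eq_cube)
  then have "sqrt (3 * a^3 * (3 * a - 8 * 0^2 * th)) = 3 * a^2" using real_sqrt_abs[of "3 * a^2"] by simp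
  ultimately have Q: "((\<lambda>eps. Qeps lam eps) \<longlongrightarrow> 3 * a^2) (at_right 0)"
    by (simp add: Qeps_def[abs_def] a_def th_def)
  have lim1: "((\<lambda>eps. 6 * a^2 * (a * (3 * a - 2 * eps^2 * th) + Qeps lam eps)^3 / (3 * a^2 + Qeps lam eps)^4)
    \<longlongrightarrow> 6 * a^2 * (a * (3 * a - 2 * 0^2 * th) + 3 * a^2)^3 / (3 * a^2 + 3 * a^2)^4) (at_right 0)"
    using a by (intro tendsto_intros Q) auto
  have eq1: "6 * a^2 * (a * (3 * a - 2 * 0^2 * th) + 3 * a^2)^3 / (3 * a^2 + 3 * a^2)^4 = 1"
  proof -
    have i: "a * (3 * a - 2 * 0^2 * th) + 3 * a^2 = 6 * a^2" "3 * a^2 + 3 * a^2 = 6 * a^2"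
      by (simp_all add: power2_eq_square)
    have j: "6 * a^2 * x^3 / x^4 = 1" if "x = 6 * a^2" for x
      using a that[symmetric] by (simp add: power3_eq_cube power4_eq_xxxx) (use that in simp)
    show ?thesis unfolding i by (rule j[OF refl])
  qed
  have K: "((\<lambda>eps. Keps lam eps) \<longlongrightarrow> 1) (at_right 0)"
    using lim1[unfolded eq1] unfolding Keps_def th_def[symmetric] a_def[symmetric] .
  have "((\<lambda>eps. max kap (kap / sqrt (Keps lam eps))) \<longlongrightarrow> max kap (kap / sqrt 1)) (at_right 0)"
    by (intro tendsto_intros K) auto
  then have lim: "((\<lambda>eps. max kap (kap / sqrt (Keps lam eps))) \<longlongrightarrow> kap) (at_right 0)" by simp
  \<comment> \<open>The first bound keeps \<open>Keps\<close> in the maximum; the second makes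
    \<open>K0 lam eps \<ge> 1\<close>, so that its term is at most \<open>kap\<close>.\<close>
  define e0 where "e0 = min (eps0 lam) (sqrt (3 * th * a^3))"
  have e0: "e0 > 0" unfolding e0_def eps0_def using a th by (simp add: a_def th_def)
  have "\<forall>\<^sub>F eps in at_right 0. eps \<in> {0<..<e0}" using e0 by (rule eventually_at_right_real)
  then have "\<forall>\<^sub>F eps in at_right 0. max kap (kap / sqrt (Keps lam eps)) = keps lam kap eps"
  proof eventually_elim
    case (elim eps)
    have "eps^2 \<le> (sqrt (3 * th * a^3))^2" using elim by (intro power_mono) (auto simp: e0_def)
    also have "\<dots> = 3 * th * a^3" using th a by simp
    finally have "1 \<le> a^2 * (3 * th * a / eps^2)"
      using elim by (simp add: field_simps power2_eq_square power3_eq_cube)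
    also have "\<dots> \<le> K0 lam eps" by (simp add: K0_def a_def th_def distrib_left)
    finally have "1 \<le> sqrt (K0 lam eps)" by simp
    then have "kap / sqrt (K0 lam eps) \<le> kap" using kap by (simp add: divide_le_eq)
    moreover have "eps \<le> eps0 lam" using elim by (auto simp: e0_def)
    ultimately show ?case by (auto simp: keps_def kap_over_sqrtK_def)
  qed
  from Lim_transform_eventually[OF lim this] show ?thesis .
qed

section \<open>Testing the inequality with cut-offs of the critical function\<close>

context radial_randers
begin

text \<open>With \<open>\<xi> = d / w\<close> one has \<open>z = w * (1 + \<xi>)\<close>, and where
  \<open>w > 0\<close> the quantity \<open>z * G\<close> becomes
  \<open>2 * (1 + \<xi>) * (A + \<xi>) * u x\<close>. Outside the exceptional set
  \<open>\<xi> \<le> e\<close> and the drift factor is at most \<open>1 + e\<close>, which gives the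
  nearly optimal \<open>\<Lambda>\<close>. The exceptional set consists of a core, where the drift
  factor need not be close to 1, and a thin layer, where the cut-off acts; a crude bound is enough
  there.\<close>

lemma bump_test_pointwise:
  fixes x :: "'a::euclidean_space"
  assumes p: "p > 1" and A: "A > 0" and d: "0 < d" and x: "norm x < 1"
    and e: "e > 0" and \<Lambda>: "2 * k * (1 + e) * (1 + e) * (A + e) \<le> \<Lambda>"
    and s0: "\<And>t. s0 \<le> t \<Longrightarrow> t < 1 \<Longrightarrow> (1 + th) / (1 + drift t) \<le> 1 + e"
  defines "u \<equiv> \<lambda>x::'a. bump d A (1 - d - x \<bullet> x)"
  shows "lam powr p * dual_norm (Feps lam kap eps) x (frechet_derivative u (at x)) powr p
    \<le> \<Lambda> powr p * u x powr p + (8 * k * (A + 2)) powr p * (1 - (norm x)^2) powr (p * A)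
        * indicator ({x. norm x < s0} \<union> {x. norm x < 1 \<and> d \<le> 1 - (norm x)^2 \<and> 1 - (norm x)^2 < (1 + 1 / e) * d}) x"
    and "u x \<le> (1 - (norm x)^2) powr A"
    and "u x \<noteq> 0 \<Longrightarrow> d \<le> 1 - (norm x)^2"
proof -
  have n: "0 \<le> norm x" "norm x < 1" using x by auto
  define z where "z = 1 - (norm x)^2"
  have z: "z > 0" using sq_less_1[OF n] by (simp add: z_def)
  define w where "w = 1 - d - x \<bullet> x"
  have wz: "w = z - d" by (simp add: w_def z_def power2_norm_eq_inner)
  define G where "G = 2 * (A * bump d (A - 1) w + d * bump d (A - 2) w)"
  have G: "G \<ge> 0" unfolding G_def using A d bump_nonneg by (intro mult_nonneg_nonneg add_nonneg_nonneg) auto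
  have "frechet_derivative u (at x) = (\<lambda>y. (A * bump d (A - 1) w + d * bump d (A - 2) w) * (-2 * (x \<bullet> y)))"
    unfolding u_def w_def by (rule frechet_derivative_at[symmetric, OF bump_radial_derivative[OF d]])
  then have fr: "frechet_derivative u (at x) = (\<lambda>y. - G * (x \<bullet> y))" by (simp add: G_def fun_eq_iff algebra_simps)
  define F where "F = (1 + th) / (1 + drift (norm x))"
  have d0: "drift (norm x) \<ge> 0" using drift_bounds[OF n] by simp
  have F: "0 \<le> F" "F \<le> 2" using d0 th by (auto simp: F_def divide_le_eq)
  define Y where "Y = k * F * z * G"
  have Y0: "Y \<ge> 0" using k F z G by (simp add: Y_def)
  define q where "q = dual_norm (Feps lam kap eps) x (frechet_derivative u (at x))"
  have q: "q \<ge> 0" "lam * q \<le> Y"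
    using dual_norm_radial_le[OF x G] unfolding q_def fr by (simp_all add: Y_def F_def z_def)
  have "lam powr p * q powr p = (lam * q) powr p" by (simp add: powr_mult)
  also have "\<dots> \<le> Y powr p" using q lam p by (intro powr_mono2) auto
  finally have lq: "lam powr p * q powr p \<le> Y powr p" .
  have ux: "u x = bump d A w" by (simp add: u_def w_def)
  let ?Bad = "{x. norm x < s0} \<union> {x. norm x < 1 \<and> d \<le> 1 - (norm x)^2 \<and> 1 - (norm x)^2 < (1 + 1 / e) * d}"
  have "Y powr p \<le> \<Lambda> powr p * u x powr p + (8 * k * (A + 2)) powr p * z powr (p * A) * indicator ?Bad x
    \<and> u x \<le> z powr A \<and> (u x \<noteq> 0 \<longrightarrow> d \<le> z)"
  proof (cases "w > 0")
    case False
    then have "G = 0" "u x = 0" by (simp_all add: G_def ux bump_def)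
    then show ?thesis using z by (simp add: Y_def)
  next
    case True
    define \<xi> where "\<xi> = d / w"
    have \<xi>: "\<xi> > 0" using d True by (simp add: \<xi>_def)
    define U where "U = w powr A * exp (- \<xi>)"
    have U: "U > 0" using True by (simp add: U_def)
    have uU: "u x = U" using True by (simp add: ux bump_def U_def \<xi>_def)
    have b1: "bump d (A - 1) w = U / w" using True by (simp add: bump_def U_def \<xi>_def powr_diff)
    have b2: "bump d (A - 2) w = U / w^2"
      using True powr_diff[of w A 2] by (simp add: bump_def U_def \<xi>_def powr_numeral)
    have zw: "z = w * (1 + \<xi>)" using True by (simp add: wz \<xi>_def field_simps)
    have zG: "z * G = 2 * (1 + \<xi>) * (A + \<xi>) * U"
    proof -
      have "A * (U / w) + d * (U / w^2) = (A + \<xi>) * U / w"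
        using True by (simp add: \<xi>_def field_simps power2_eq_square)
      then show ?thesis unfolding G_def b1 b2 zw using True by simp
    qed
    have Y: "Y = k * F * (2 * (1 + \<xi>) * (A + \<xi>) * U)" unfolding Y_def zG[symmetric] by simp
    have Uz: "U \<le> z powr A * exp (- \<xi>)"
      unfolding U_def using True d A wz by (intro mult_right_mono powr_mono2) auto
    have "z powr A * exp (- \<xi>) \<le> z powr A * 1" using \<xi> by (intro mult_left_mono) auto
    then have c2: "u x \<le> z powr A" using Uz uU by simp
    have c3: "d \<le> z" using True wz by simp
    have "Y powr p \<le> \<Lambda> powr p * u x powr p + (8 * k * (A + 2)) powr p * z powr (p * A) * indicator ?Bad x"
    proof (cases "x \<in> ?Bad")
      case False
      then have xs: "s0 \<le> norm x" "(1 + 1 / e) * d \<le> z" using x c3 by (auto simp: z_def)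
      have "d / e \<le> w" using xs(2) by (simp add: wz algebra_simps)
      then have "\<xi> \<le> e" using e True by (simp add: \<xi>_def field_simps)
      have "F \<le> 1 + e" unfolding F_def by (rule s0[OF xs(1) x])
      have "Y = 2 * k * F * (1 + \<xi>) * (A + \<xi>) * U" by (simp add: Y)
      also have "\<dots> \<le> 2 * k * (1 + e) * (1 + e) * (A + e) * U"
        using \<open>F \<le> 1 + e\<close> \<open>\<xi> \<le> e\<close> k F \<xi> A U e by (intro mult_right_mono mult_mono mult_nonneg_nonneg) auto
      also have "\<dots> \<le> \<Lambda> * U" using \<Lambda> U by (intro mult_right_mono) auto
      finally have "Y powr p \<le> (\<Lambda> * U) powr p" using Y0 p by (intro powr_mono2) auto
      then show ?thesis using False by (simp add: powr_mult uU)
    next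
      case True
      \<comment> \<open>Each of the factors \<open>1 + \<xi>\<close> and \<open>A + \<xi>\<close> is
        absorbed by half of the decay \<open>exp (- \<xi>)\<close>, so the bound is uniform in
        \<open>d\<close>.\<close>
      have ex: "1 \<le> exp (\<xi> / 2)" "\<xi> / 2 \<le> exp (\<xi> / 2)"
        using exp_ge_add_one_self[of "\<xi> / 2"] \<xi> by linarith+
      have 1: "1 + \<xi> \<le> 2 * exp (\<xi> / 2)" using exp_ge_add_one_self[of "\<xi> / 2"] by linarith
      have "A * 1 \<le> A * exp (\<xi> / 2)" using ex A by (intro mult_left_mono) auto
      then have 2: "A + \<xi> \<le> (A + 2) * exp (\<xi> / 2)" using ex(2) by (simp add: distrib_right)
      have "2 * (1 + \<xi>) * (A + \<xi>) * U \<le> 2 * (2 * exp (\<xi> / 2)) * ((A + 2) * exp (\<xi> / 2)) * (z powr A * exp (- \<xi>))"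
        using 1 2 Uz U \<xi> A by (intro mult_mono mult_nonneg_nonneg) auto
      also have "\<dots> = 4 * (A + 2) * z powr A * (exp (\<xi> / 2) * exp (\<xi> / 2) * exp (- \<xi>))" by simp
      also have "exp (\<xi> / 2) * exp (\<xi> / 2) * exp (- \<xi>) = 1" by (simp flip: exp_add)
      finally have 3: "2 * (1 + \<xi>) * (A + \<xi>) * U \<le> 4 * (A + 2) * z powr A" by simp
      have "Y \<le> k * 2 * (4 * (A + 2) * z powr A)"
        unfolding Y by (rule mult_mono[OF mult_left_mono[OF F(2)] 3]) (use k U \<xi> A in auto)
      also have "\<dots> = 8 * k * (A + 2) * z powr A" by simp
      finally have "Y powr p \<le> (8 * k * (A + 2) * z powr A) powr p" using Y0 p by (intro powr_mono2) auto
      also have "\<dots> = (8 * k * (A + 2)) powr p * z powr (p * A)"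
        by (simp only: powr_mult[of "8 * k * (A + 2)"] powr_powr mult.commute[of A p])
      finally have "Y powr p \<le> (8 * k * (A + 2)) powr p * z powr (p * A)" .
      moreover have "0 \<le> \<Lambda> powr p * u x powr p" by simp
      moreover have "indicator ?Bad x = (1::real)" using True by (rule indicator_simps(1))
      ultimately show ?thesis by (simp only: mult_1_right)
    qed
    then show ?thesis using c2 c3 by blast
  qed
  then show "lam powr p * dual_norm (Feps lam kap eps) x (frechet_derivative u (at x)) powr p
    \<le> \<Lambda> powr p * u x powr p + (8 * k * (A + 2)) powr p * (1 - (norm x)^2) powr (p * A) * indicator ?Bad x"
    "u x \<le> (1 - (norm x)^2) powr A" "u x \<noteq> 0 \<Longrightarrow> d \<le> 1 - (norm x)^2"
    using lq unfolding q_def z_def by auto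
qed


text \<open>For a larger \<open>c\<close>, pick \<open>L\<close> strictly between. Testing gives
  \<open>c * I d \<le> L * I d + D\<close> with \<open>D\<close> independent of \<open>d\<close>,
  hence \<open>I d \<le> D / (c - L)\<close> for all small \<open>d\<close>. By Fatou's lemma the
  integral for the critical function is then finite, against
  \<open>nn_integral_inverse_boundary_distance\<close>.\<close>

lemma sharp_constant:
  fixes c :: real
  assumes n2: "DIM('a::euclidean_space) \<ge> 2" and p: "p > 1" and h: "0 \<le> h" "h < kap"
    and c: "\<And>u::'a \<Rightarrow> real. u \<in> C0inf_ball \<Longrightarrow> ennreal c * hardy_rhs_int lam kap h p eps u \<le> hardy_lhs lam kap h p eps u"
  shows "c \<le> ((real DIM('a) - 1) * (k - h) / p) powr p"
proof (rule ccontr)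
  define n where "n = DIM('a)"
  have n: "n \<ge> 2" using n2 by (simp add: n_def)
  define A where "A = al n p h"
  have A: "A > 0" unfolding A_def by (rule al_pos[OF n p h])
  define \<Lambda>0 where "\<Lambda>0 = 2 * k * A"
  have \<Lambda>0: "\<Lambda>0 > 0" using k A by (simp add: \<Lambda>0_def)
  have \<Lambda>0_eq: "\<Lambda>0 = (real n - 1) * (k - h) / p"
    using k p by (simp add: \<Lambda>0_def A_def al_def field_simps)
  assume "\<not> c \<le> ((real DIM('a) - 1) * (k - h) / p) powr p"
  then have neg: "\<Lambda>0 powr p < c" by (simp add: \<Lambda>0_eq n_def)
  define L where "L = (\<Lambda>0 powr p + c) / 2"
  have L: "\<Lambda>0 powr p < L" "L < c" "0 < L"
  proof -
    have "c > 0" using neg powr_ge_zero[of \<Lambda>0 p] by linarith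
    then show "\<Lambda>0 powr p < L" "L < c" "0 < L" using neg by (simp_all add: L_def add_nonneg_pos)
  qed
  define \<Lambda> where "\<Lambda> = L powr (1 / p)"
  have \<Lambda>p: "\<Lambda> powr p = L" using L p by (simp add: \<Lambda>_def powr_powr)
  have "\<Lambda>0 < \<Lambda>"
  proof (rule ccontr)
    assume "\<not> \<Lambda>0 < \<Lambda>"
    then have "\<Lambda> powr p \<le> \<Lambda>0 powr p" using p by (intro powr_mono2) (auto simp: \<Lambda>_def)
    then show False using L \<Lambda>p by simp
  qed
  have "((\<lambda>e. 2 * k * (1 + e) * (1 + e) * (A + e)) \<longlongrightarrow> 2 * k * (1 + 0) * (1 + 0) * (A + 0)) (at_right 0)"
    by (intro tendsto_intros)
  then have "((\<lambda>e. 2 * k * (1 + e) * (1 + e) * (A + e)) \<longlongrightarrow> \<Lambda>0) (at_right 0)" by (simp add: \<Lambda>0_def)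
  from order_tendstoD(2)[OF this \<open>\<Lambda>0 < \<Lambda>\<close>]
  have "\<forall>\<^sub>F e in at_right 0. 2 * k * (1 + e) * (1 + e) * (A + e) < \<Lambda>" .
  then obtain b where b: "b > 0" "\<And>e. 0 < e \<Longrightarrow> e < b \<Longrightarrow> 2 * k * (1 + e) * (1 + e) * (A + e) < \<Lambda>"
    by (auto simp: eventually_at_right_field)
  define e where "e = b / 2"
  have e: "e > 0" "2 * k * (1 + e) * (1 + e) * (A + e) \<le> \<Lambda>" using b(1) b(2)[of e] by (auto simp: e_def)
  obtain s0 where s0: "0 \<le> s0" "s0 < 1" "\<And>t. s0 \<le> t \<Longrightarrow> t < 1 \<Longrightarrow> (1 + th) / (1 + drift t) \<le> 1 + e"
    by (rule drift_factor_near_boundary[OF e(1)], rule that) auto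
  obtain cw where cw: "cw > 0" "\<And>t. 0 \<le> t \<Longrightarrow> t < 1 \<Longrightarrow> wt n h t \<le> (1 - t^2) powr (-1 - p * A)"
    "\<And>t. 0 \<le> t \<Longrightarrow> t < 1 \<Longrightarrow> cw * (1 - t^2) powr (-1 - p * A) \<le> wt n h t"
    by (rule wt_bounds[OF n p h, folded A_def], rule that) auto
  have zpos: "1 - (norm x)^2 > 0" if "norm x < 1" for x :: 'a using sq_less_1[of "norm x"] that by auto
  define N where "N = 1 + 1 / e"
  have N: "N > 1" using e by (simp add: N_def)
  define \<omega> where "\<omega> = measure lborel (ball (0::'a) 1)"
  have \<omega>: "\<omega> \<ge> 0" by (simp add: \<omega>_def)
  have \<omega>e: "emeasure lborel (ball (0::'a) 1) = ennreal \<omega>"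
    using emeasure_lborel_ball_finite[of "0::'a" 1] by (simp add: \<omega>_def emeasure_eq_ennreal_measure less_top[symmetric])
  define B where "B = (8 * k * (A + 2)) powr p"
  \<comment> \<open>The core contributes at most its volume times \<open>B / (1 - s0^2)\<close>. The
    layer has volume at most \<open>\<omega> * n * N * d\<close> and integrand at most
    \<open>B / d\<close>, so \<open>d\<close> cancels.\<close>
  define D where "D = B * (\<omega> / (1 - s0^2) + \<omega> * (real n * N))"
  have z0: "1 - s0^2 > 0" using sq_less_1[OF s0(1,2)] by auto
  have D: "D \<ge> 0" unfolding D_def B_def using \<omega> z0 N by (intro mult_nonneg_nonneg add_nonneg_nonneg) auto
  have [measurable]: "ball (0::'a) 1 \<in> sets borel" by simp
  define W where "W x = ennreal (wt n h (norm x)) * indicator (ball 0 1) x" for x :: 'a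
  have Wm[measurable]: "W \<in> borel_measurable borel" unfolding W_def[abs_def] by measurable
  define J where "J = 1 / (k * a) ^ n"
  have J: "J > 0" using k a by (simp add: J_def)
  define u where "u d x = bump d A (1 - d - x \<bullet> x)" for d and x :: 'a
  define I where "I d = (\<integral>\<^sup>+x. ennreal (u d x powr p) * W x \<partial>lborel)" for d
  have u_nonneg: "u d x \<ge> 0" for d x unfolding u_def by (rule bump_nonneg)
  have uC: "u d \<in> C0inf_ball" if "0 < d" "d < 1" for d
    unfolding u_def by (rule bump_radial_in_C0inf_ball[OF that])
  have um: "u d \<in> borel_measurable borel" if "0 < d" "d < 1" for d
    using uC[OF that] smooth_continuous[of "u d"] by (auto simp: C0inf_ball_def intro: borel_measurable_continuous_onI)
  have zw: "(1 - (norm x)^2) powr (p * A) * wt n h (norm x) \<le> 1 / (1 - (norm x)^2)"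
    "cw * (1 / (1 - (norm x)^2)) \<le> (1 - (norm x)^2) powr (p * A) * wt n h (norm x)" if x: "norm x < 1" for x :: 'a
  proof -
    define z where "z = 1 - (norm x)^2"
    have z: "z > 0" using zpos[OF x] by (simp add: z_def)
    have e: "z powr (p * A) * z powr (-1 - p * A) = 1 / z"
      using z by (simp add: powr_add[symmetric] powr_minus_divide)
    have "z powr (p * A) * wt n h (norm x) \<le> z powr (p * A) * z powr (-1 - p * A)"
      using cw(2)[of "norm x"] x by (intro mult_left_mono) (auto simp: z_def)
    then show "(1 - (norm x)^2) powr (p * A) * wt n h (norm x) \<le> 1 / (1 - (norm x)^2)"
      unfolding e unfolding z_def .
    have "z powr (p * A) * (cw * z powr (-1 - p * A)) \<le> z powr (p * A) * wt n h (norm x)"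
      using cw(3)[of "norm x"] x by (intro mult_left_mono) (auto simp: z_def)
    moreover have "z powr (p * A) * (cw * z powr (-1 - p * A)) = cw * (1 / z)"
      unfolding e[symmetric] by (simp only: mult.left_commute)
    ultimately show "cw * (1 / (1 - (norm x)^2)) \<le> (1 - (norm x)^2) powr (p * A) * wt n h (norm x)"
      unfolding z_def by simp
  qed
  have wt0: "wt n h (norm x) \<ge> 0" if "norm x < 1" for x :: 'a using wt_pos[of "norm x" n h] that by simp
  have bound: "ennreal c * I d \<le> ennreal L * I d + ennreal D \<and> I d < \<infinity>" if d: "0 < d" "d < 1" "N * d \<le> 1" for d
  proof -
    note um[OF d(1,2), measurable]
    have pt: "lam powr p * dual_norm (Feps lam kap eps) x (frechet_derivative (u d) (at x)) powr p
      \<le> L * u d x powr p + B * (1 - (norm x)^2) powr (p * A)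
        * indicator ({x. norm x < s0} \<union> {x. norm x < 1 \<and> d \<le> 1 - (norm x)^2 \<and> 1 - (norm x)^2 < N * d}) x"
      "u d x \<le> (1 - (norm x)^2) powr A" "u d x \<noteq> 0 \<Longrightarrow> d \<le> 1 - (norm x)^2" if "norm x < 1" for x
      using bump_test_pointwise[OF p A d(1) that e s0(3)] unfolding u_def[symmetric] \<Lambda>p N_def[symmetric] B_def[symmetric]
      by auto
    define Bad where "Bad = {x::'a. norm x < s0} \<union> {x. norm x < 1 \<and> d \<le> 1 - (norm x)^2 \<and> 1 - (norm x)^2 < N * d}"
    have Badm[measurable]: "Bad \<in> sets borel" unfolding Bad_def by measurable
    define V where "V x = ennreal (B * (1 - (norm x)^2) powr (p * A)) * indicator Bad x" for x :: 'a
    have Vm[measurable]: "V \<in> borel_measurable borel" unfolding V_def[abs_def] by measurable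
    define X where "X x = ennreal L * ennreal (u d x powr p) + V x" for x
    have Xm[measurable]: "X \<in> borel_measurable borel" unfolding X_def[abs_def] by measurable
    have V_int: "(\<integral>\<^sup>+x. V x * W x \<partial>lborel) \<le> ennreal D"
    proof -
      define S where "S = {x::'a. norm x < 1 \<and> 1 - (norm x)^2 < N * d}"
      have Sm[measurable]: "S \<in> sets borel" unfolding S_def by measurable
      have "(\<integral>\<^sup>+x. V x * W x \<partial>lborel) \<le> (\<integral>\<^sup>+x. ennreal (B / (1 - s0^2)) * indicator (ball 0 1) x + ennreal (B / d) * indicator S x \<partial>lborel)"
      proof (rule nn_integral_mono)
        fix x :: 'a
        show "V x * W x \<le> ennreal (B / (1 - s0^2)) * indicator (ball 0 1) x + ennreal (B / d) * indicator S x"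
        proof (cases "norm x < 1 \<and> x \<in> Bad")
          case False
          then show ?thesis by (auto simp: V_def W_def)
        next
          case True
          then have x: "norm x < 1" "x \<in> Bad" by auto
          define z where "z = 1 - (norm x)^2"
          have z: "z > 0" using zpos[OF x(1)] by (simp add: z_def)
          have "V x * W x = ennreal (B * (z powr (p * A) * wt n h (norm x)))"
            using x wt0[OF x(1)] by (simp add: V_def W_def z_def ennreal_mult[symmetric] B_def mult.assoc)
          also have "\<dots> \<le> ennreal (B * (1 / z))"
            using zw(1)[OF x(1)] by (intro ennreal_leI mult_left_mono) (auto simp: z_def B_def)
          finally have VW: "V x * W x \<le> ennreal (B / z)" by simp
          show ?thesis
          proof (cases "norm x < s0")
            case True
            have "1 - s0^2 \<le> z" using True by (simp add: z_def power_mono)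
            then have "B / z \<le> B / (1 - s0^2)" using z0 z by (intro divide_left_mono) (auto simp: B_def)
            then have "V x * W x \<le> ennreal (B / (1 - s0^2))" using VW ennreal_leI order_trans by blast
            then show ?thesis using x(1) by (simp add: add_increasing2)
          next
            case False
            then have S: "x \<in> S" "d \<le> z" using x by (auto simp: S_def Bad_def z_def)
            then have "B / z \<le> B / d" using z d by (intro divide_left_mono) (auto simp: B_def)
            then have "V x * W x \<le> ennreal (B / d)" using VW ennreal_leI order_trans by blast
            then show ?thesis using S by (simp add: add_increasing)
          qed
        qed
      qed
      also have "\<dots> = ennreal (B / (1 - s0^2)) * emeasure lborel (ball (0::'a) 1) + ennreal (B / d) * emeasure lborel S"
        by (subst nn_integral_add) (auto simp: nn_integral_cmult)
      also have "\<dots> \<le> ennreal (B / (1 - s0^2)) * ennreal \<omega> + ennreal (B / d) * ennreal (\<omega> * (real n * (N * d)))"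
        unfolding \<omega>e S_def using annulus_measure_le[of N d, where 'a='a] N d
        by (intro add_mono mult_left_mono) (auto simp: \<omega>_def n_def)
      also have "\<dots> = ennreal (B / (1 - s0^2) * \<omega> + B / d * (\<omega> * (real n * (N * d))))"
        using z0 \<omega> d N by (simp add: ennreal_mult[symmetric] ennreal_plus[symmetric] B_def del: ennreal_plus)
      also have "B / (1 - s0^2) * \<omega> + B / d * (\<omega> * (real n * (N * d))) = D"
        using d by (simp add: D_def distrib_left)
      finally show ?thesis .
    qed
    have lhs: "hardy_lhs lam kap h p eps (u d) \<le> (\<integral>\<^sup>+x. X x \<partial>meps lam kap h eps)"
    proof -
      have lp: "ennreal (lam powr p) * ennreal (1 / lam powr p) = 1"
        using lam by (simp add: ennreal_mult[symmetric])
      have "(\<integral>\<^sup>+x. ennreal (dual_norm (Feps lam kap eps) x (frechet_derivative (u d) (at x)) powr p) \<partial>meps lam kap h eps)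
        \<le> (\<integral>\<^sup>+x. ennreal (1 / lam powr p) * X x \<partial>meps lam kap h eps)"
      proof (rule nn_integral_mono)
        fix x :: 'a assume "x \<in> space (meps lam kap h eps)"
        then have x: "norm x < 1" by (simp add: meps_def space_restrict_space)
        define q where "q = dual_norm (Feps lam kap eps) x (frechet_derivative (u d) (at x)) powr p"
        have "ennreal q = ennreal (1 / lam powr p) * ennreal (lam powr p * q)"
          using lam by (simp add: ennreal_mult[symmetric] q_def)
        also have "\<dots> \<le> ennreal (1 / lam powr p) * ennreal (L * u d x powr p + B * (1 - (norm x)^2) powr (p * A) * indicator Bad x)"
          unfolding q_def Bad_def by (intro mult_left_mono ennreal_leI pt(1)[OF x]) auto
        also have "ennreal (L * u d x powr p + B * (1 - (norm x)^2) powr (p * A) * indicator Bad x) = X x"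
          using L by (subst ennreal_plus) (auto simp: X_def V_def B_def ennreal_mult indicator_def)
        finally show "ennreal (dual_norm (Feps lam kap eps) x (frechet_derivative (u d) (at x)) powr p) \<le> ennreal (1 / lam powr p) * X x"
          unfolding q_def .
      qed
      also have "\<dots> = ennreal (1 / lam powr p) * (\<integral>\<^sup>+x. X x \<partial>meps lam kap h eps)"
        by (rule nn_integral_cmult)
          (unfold meps_def measurable_density_eq1, intro measurable_restrict_space1 measurable_completion, measurable)
      finally have "hardy_lhs lam kap h p eps (u d) \<le> ennreal (lam powr p) * (ennreal (1 / lam powr p) * (\<integral>\<^sup>+x. X x \<partial>meps lam kap h eps))"
        unfolding hardy_lhs_def by (intro mult_left_mono) auto
      then show ?thesis by (simp only: mult.assoc[symmetric] lp mult_1)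
    qed
    have X_eq: "(\<integral>\<^sup>+x. X x \<partial>meps lam kap h eps) = ennreal J * (ennreal L * I d + (\<integral>\<^sup>+x. V x * W x \<partial>lborel))"
    proof -
      have "(\<integral>\<^sup>+x. X x \<partial>meps lam kap h eps) = ennreal J * (\<integral>\<^sup>+x. ennreal L * (ennreal (u d x powr p) * W x) + V x * W x \<partial>lborel)"
        unfolding nn_integral_meps[OF Xm] unfolding J_def n_def W_def X_def by (simp add: distrib_left distrib_right mult_ac)
      also have "(\<integral>\<^sup>+x. ennreal L * (ennreal (u d x powr p) * W x) + V x * W x \<partial>lborel) = ennreal L * I d + (\<integral>\<^sup>+x. V x * W x \<partial>lborel)"
        unfolding I_def by (subst nn_integral_add) (auto simp: nn_integral_cmult)
      finally show ?thesis .
    qed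
    have rm: "(\<lambda>x. ennreal (\<bar>u d x\<bar> powr p)) \<in> borel_measurable borel" by measurable
    have "hardy_rhs_int lam kap h p eps (u d) = ennreal J * I d"
      unfolding hardy_rhs_int_def nn_integral_meps[OF rm] J_def n_def I_def W_def
      using u_nonneg by (simp add: mult_ac)
    then have "ennreal J * (ennreal c * I d) \<le> ennreal J * (ennreal L * I d + (\<integral>\<^sup>+x. V x * W x \<partial>lborel))"
      using order_trans[OF c[OF uC[OF d(1,2)]] lhs] unfolding X_eq by (simp add: mult.left_commute)
    then have "ennreal c * I d \<le> ennreal L * I d + (\<integral>\<^sup>+x. V x * W x \<partial>lborel)"
      using J by (subst (asm) ennreal_mult_le_mult_iff) auto
    also have "\<dots> \<le> ennreal L * I d + ennreal D" using V_int by (intro add_mono) auto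
    finally have 1: "ennreal c * I d \<le> ennreal L * I d + ennreal D" .
    \<comment> \<open>Finiteness is what permits subtracting \<open>L * I d\<close> in
      \<open>IE\<close>; it holds because \<open>u d\<close> vanishes where
      \<open>1 - (norm x)^2 < d\<close>.\<close>
    have "I d \<le> (\<integral>\<^sup>+x. ennreal (1 / d) * indicator (ball (0::'a) 1) x \<partial>lborel)"
      unfolding I_def
    proof (rule nn_integral_mono)
      fix x :: 'a
      show "ennreal (u d x powr p) * W x \<le> ennreal (1 / d) * indicator (ball 0 1) x"
      proof (cases "norm x < 1 \<and> u d x \<noteq> 0")
        case False
        then show ?thesis using p by (auto simp: W_def)
      next
        case True
        then have x: "norm x < 1" "u d x \<noteq> 0" by auto
        define z where "z = 1 - (norm x)^2"
        have z: "z > 0" "d \<le> z" using zpos[OF x(1)] pt(3)[OF x] by (simp_all add: z_def)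
        have "u d x powr p \<le> (z powr A) powr p"
          using pt(2)[OF x(1)] u_nonneg p by (intro powr_mono2) (auto simp: z_def)
        then have up: "u d x powr p \<le> z powr (p * A)" by (simp add: powr_powr mult.commute)
        have "u d x powr p * wt n h (norm x) \<le> z powr (p * A) * wt n h (norm x)"
          using up wt0[OF x(1)] by (intro mult_right_mono) auto
        also have "\<dots> \<le> 1 / z" using zw(1)[OF x(1)] by (simp add: z_def)
        also have "\<dots> \<le> 1 / d" using z d by (intro divide_left_mono) auto
        finally have "ennreal (u d x powr p * wt n h (norm x)) \<le> ennreal (1 / d)" by (rule ennreal_leI)
        then show ?thesis using x wt0[OF x(1)] by (simp add: W_def ennreal_mult)
      qed
    qed
    also have "\<dots> = ennreal (1 / d) * ennreal \<omega>" by (simp add: nn_integral_cmult \<omega>e)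
    also have "\<dots> < \<infinity>" using d by (simp add: ennreal_mult[symmetric] \<omega>)
    finally show ?thesis using 1 by blast
  qed
  define E where "E = D / (c - L)"
  have IE: "I d \<le> ennreal E" if d: "0 < d" "d < 1" "N * d \<le> 1" for d
  proof -
    obtain r where r: "I d = ennreal r" "r \<ge> 0"
      using bound[OF d] by (cases "I d") auto
    have "ennreal (c * r) \<le> ennreal (L * r + D)"
      using bound[OF d] L r D by (simp add: r ennreal_mult ennreal_plus)
    then have "c * r \<le> L * r + D" using L r D by (subst (asm) ennreal_le_iff) auto
    then have "(c - L) * r \<le> D" by (simp add: algebra_simps)
    then have "r \<le> E" using L by (simp add: E_def le_divide_eq mult.commute)
    then show ?thesis by (simp add: r ennreal_leI)
  qed
  \<comment> \<open>A null sequence that satisfies the side conditions \<open>dd j < 1\<close> and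
    \<open>N * dd j \<le> 1\<close> from the start.\<close>
  define dd where "dd j = 1 / (N + 1 + real j)" for j :: nat
  have dd: "0 < dd j" "dd j < 1" "N * dd j \<le> 1" for j
    using N by (auto simp: dd_def divide_less_eq divide_le_eq)
  have dd0: "dd \<longlonglongrightarrow> 0"
  proof (rule tendsto_sandwich[of "\<lambda>_. 0" _ _ "\<lambda>j. 1 / real (Suc j)"])
    show "\<forall>\<^sub>F j in sequentially. dd j \<le> 1 / real (Suc j)"
      using N by (intro always_eventually allI) (auto simp: dd_def intro!: divide_left_mono)
    show "(\<lambda>j. 1 / real (Suc j)) \<longlonglongrightarrow> 0" using LIMSEQ_inverse_real_of_nat by (simp add: inverse_eq_divide)
    show "\<forall>\<^sub>F j in sequentially. 0 \<le> dd j" using dd(1) by (intro always_eventually allI) (simp add: less_imp_le)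
  qed simp
  have fm: "(\<lambda>x. ennreal (u (dd j) x powr p) * W x) \<in> borel_measurable lborel" for j
  proof -
    note um[OF dd(1,2), of j, measurable]
    show ?thesis by measurable
  qed
  have "(\<integral>\<^sup>+x. liminf (\<lambda>j. ennreal (u (dd j) x powr p) * W x) \<partial>lborel) \<le> liminf (\<lambda>j. I (dd j))"
    unfolding I_def by (rule nn_integral_liminf[OF fm])
  also have "\<dots> \<le> liminf (\<lambda>j. ennreal E)" using IE[OF dd] by (intro Liminf_mono always_eventually) auto
  also have "\<dots> = ennreal E" by (simp add: Liminf_const)
  finally have fatou: "(\<integral>\<^sup>+x. liminf (\<lambda>j. ennreal (u (dd j) x powr p) * W x) \<partial>lborel) \<le> ennreal E" .
  have gm: "(\<lambda>x::'a. ennreal (1 / (1 - (norm x)^2)) * indicator (ball 0 1) x) \<in> borel_measurable lborel" by measurable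
  have "\<infinity> = ennreal cw * (\<integral>\<^sup>+x. ennreal (1 / (1 - (norm x)^2)) * indicator (ball 0 1) x \<partial>(lborel :: 'a measure))"
    unfolding nn_integral_inverse_boundary_distance[OF n2] using cw(1) by (simp add: ennreal_mult_top)
  also have "\<dots> = (\<integral>\<^sup>+x. ennreal cw * (ennreal (1 / (1 - (norm x)^2)) * indicator (ball 0 1) x) \<partial>(lborel :: 'a measure))"
    by (rule nn_integral_cmult[symmetric, OF gm])
  also have "\<dots> \<le> (\<integral>\<^sup>+x. liminf (\<lambda>j. ennreal (u (dd j) x powr p) * W x) \<partial>lborel)"
  proof (rule nn_integral_mono)
    fix x :: 'a
    show "ennreal cw * (ennreal (1 / (1 - (norm x)^2)) * indicator (ball 0 1) x) \<le> liminf (\<lambda>j. ennreal (u (dd j) x powr p) * W x)"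
    proof (cases "norm x < 1")
      case False
      then show ?thesis by simp
    next
      case True
      define z where "z = 1 - (norm x)^2"
      have z: "z > 0" using zpos[OF True] by (simp add: z_def)
      have wl: "(\<lambda>j. z - dd j) \<longlonglongrightarrow> z - 0" by (intro tendsto_intros dd0)
      then have wl: "(\<lambda>j. z - dd j) \<longlonglongrightarrow> z" by simp
      have "(\<lambda>j. (z - dd j) powr A * exp (- dd j / (z - dd j))) \<longlonglongrightarrow> z powr A * exp (- 0 / z)"
        using z by (intro tendsto_intros wl dd0) auto
      moreover have "\<forall>\<^sub>F j in sequentially. (z - dd j) powr A * exp (- dd j / (z - dd j)) = u (dd j) x"
        using order_tendstoD(1)[OF wl z]
      proof eventually_elim
        case (elim j)
        have w: "1 - dd j - x \<bullet> x = z - dd j" by (simp add: z_def power2_norm_eq_inner)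
        show ?case unfolding u_def bump_def w using elim by simp
      qed
      ultimately have "(\<lambda>j. u (dd j) x) \<longlonglongrightarrow> z powr A * exp (- 0 / z)" by (rule Lim_transform_eventually)
      then have "(\<lambda>j. u (dd j) x) \<longlonglongrightarrow> z powr A" by simp
      then have "(\<lambda>j. u (dd j) x powr p * wt n h (norm x)) \<longlonglongrightarrow> (z powr A) powr p * wt n h (norm x)"
        using z by (intro tendsto_intros) auto
      then have "(\<lambda>j. ennreal (u (dd j) x powr p * wt n h (norm x))) \<longlonglongrightarrow> ennreal ((z powr A) powr p * wt n h (norm x))"
        by (rule tendsto_ennrealI)
      then have "liminf (\<lambda>j. ennreal (u (dd j) x powr p * wt n h (norm x))) = ennreal ((z powr A) powr p * wt n h (norm x))"
        by (intro lim_imp_Liminf) auto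
      moreover have "ennreal (u (dd j) x powr p) * W x = ennreal (u (dd j) x powr p * wt n h (norm x))" for j
        using True wt0[OF True] by (simp add: W_def ennreal_mult)
      ultimately have l: "liminf (\<lambda>j. ennreal (u (dd j) x powr p) * W x) = ennreal (z powr (p * A) * wt n h (norm x))"
        by (simp add: powr_powr mult.commute)
      have "ennreal cw * (ennreal (1 / z) * indicator (ball 0 1) x) = ennreal (cw * (1 / z))"
        using True cw(1) z by (simp add: ennreal_mult[symmetric])
      also have "\<dots> \<le> ennreal (z powr (p * A) * wt n h (norm x))"
        using zw(2)[OF True] by (intro ennreal_leI) (simp add: z_def)
      finally show ?thesis unfolding l z_def .
    qed
  qed
  also have "\<dots> \<le> ennreal E" by (rule fatou)
  finally show False by (simp add: top_unique)
qed

end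

theorem theorem5p4:
  fixes lam p kap h :: real
  assumes "DIM('a::euclidean_space) \<ge> 2"
    and "lam > 1" and "p > 1" and "h \<ge> 0" and "kap > h"
  shows "(\<forall>eps > 0. \<forall>u \<in> (C0inf_ball :: ('a \<Rightarrow> real) set).
            hardy_lhs lam kap h p eps u
              \<ge> ennreal (((real DIM('a) - 1) * (kap - h) / p) powr p) * hardy_rhs_int lam kap h p eps u)
       \<and> (\<forall>c::real. (\<forall>eps > 0. \<forall>u \<in> (C0inf_ball :: ('a \<Rightarrow> real) set).
            hardy_lhs lam kap h p eps u \<ge> ennreal c * hardy_rhs_int lam kap h p eps u)
          \<longrightarrow> c \<le> ((real DIM('a) - 1) * (kap - h) / p) powr p)"
proof (intro conjI allI impI ballI)
  fix eps :: real and u :: "'a \<Rightarrow> real" assume eps: "eps > 0" and u: "u \<in> C0inf_ball"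
  interpret radial_randers lam kap eps by unfold_locales (use assms eps in auto)
  show "ennreal (((real DIM('a) - 1) * (kap - h) / p) powr p) * hardy_rhs_int lam kap h p eps u \<le> hardy_lhs lam kap h p eps u"
    by (rule hardy_ball[OF assms(1,3,4,5) u])
next
  fix c :: real
  assume c: "\<forall>eps > 0. \<forall>u \<in> (C0inf_ball :: ('a \<Rightarrow> real) set). ennreal c * hardy_rhs_int lam kap h p eps u \<le> hardy_lhs lam kap h p eps u"
  have kap: "kap > 0" using assms by linarith
  have le: "c \<le> ((real DIM('a) - 1) * (keps lam kap eps - h) / p) powr p" if eps: "eps > 0" for eps
  proof -
    interpret radial_randers lam kap eps by unfold_locales (use assms eps kap in auto)
    show ?thesis unfolding k_def[symmetric] using c eps by (intro sharp_constant assms) auto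
  qed
  have "((\<lambda>eps. ((real DIM('a) - 1) * (keps lam kap eps - h) / p) powr p) \<longlongrightarrow>
      ((real DIM('a) - 1) * (kap - h) / p) powr p) (at_right 0)"
    using assms by (intro tendsto_intros keps_tendsto kap) auto
  moreover have "\<forall>\<^sub>F eps in at_right 0. c \<le> ((real DIM('a) - 1) * (keps lam kap eps - h) / p) powr p"
    using eventually_at_right_less[of 0] by eventually_elim (rule le)
  ultimately show "c \<le> ((real DIM('a) - 1) * (kap - h) / p) powr p"
    by (rule tendsto_lowerbound) simp
qed

end
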